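(* Let $\bar\phi:\mathcal S(\mathfrak{gl}_d(\mathbf z,\boldsymbol\gamma))\to\overline{\mathcal D}$ and $\bar\varphi:\mathcal S(\mathfrak{gl}_{p+m|q+n}(\mathbf w,\boldsymbol\xi))\to\overline{\mathcal D}$ be the Poisson superalgebra homomorphisms, and let $\overline{\mathcal A}_d^{\mathbf w,\boldsymbol\xi}(\mathbf z,\boldsymbol\gamma)\subseteq\mathcal S(\mathfrak{gl}_d(\mathbf z,\boldsymbol\gamma))$ and $\overline{\mathcal A}_{p+m|q+n}^{\mathbf z,\boldsymbol\gamma}(\mathbf w,\boldsymbol\xi)\subseteq\mathcal S(\mathfrak{gl}_{p+m|q+n}(\mathbf w,\boldsymbol\xi))$ be the classical Gaudin algebras, all as defined in the context. Then $$\bar\phi\big(\overline{\mathcal A}_d^{\mathbf w,\boldsymbol\xi}(\mathbf z,\boldsymbol\gamma)\big)=\bar\varphi\big(\overline{\mathcal A}_{p+m|q+n}^{\mathbf z,\boldsymbol\gamma}(\mathbf w,\boldsymbol\xi)\big).$$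
   Context: Everything is over $\mathbb C$. Fix $d\ge 1$ and integers $p,q,m,n\ge 0$, not all zero. **Lie superalgebra.** $\mathbb I=\{1,\dots,p+q+m+n\}$; $|i|=\bar 0\in\mathbb Z_2$ if $i\in\{1,\dots,p\}\cup\{p+q+1,\dots,p+q+m\}$ and $|i|=\bar 1$ otherwise. $\mathfrak{gl}_{p+m|q+n}$ has homogeneous basis $E^i_j$ ($i,j\in\mathbb I$) of parity $|i|+|j|$ with $[E^i_j,E^k_l]=\delta_{jk}E^i_l-(-1)^{(|i|+|j|)(|k|+|l|)}\delta_{il}E^k_j$. $\mathfrak{gl}_d$ is the usual Lie algebra with basis $e_{ab}$. **Parameters.** Integers $1\le d'\le d$, $0\le p'\le p$, $0\le q'\le q$, $0\le m'\le m$, $0\le n'\le n$; $\ell=p'+q'+m'+n'$; $\mathbf w\in\mathbb C^{d'}$, $\mathbf z\in\mathbb C^{\ell}$ arbitrary. $\boldsymbol\xi=(\xi_1,\dots,\xi_{d'})$ and $\boldsymbol\gamma=(\gamma_1,\dots,\gamma_\ell)$ consist of positive integers with $\sum\xi_a=d$ and $\sum_{i=1}^{p'}\gamma_i=p$, $\sum_{i=1}^{q'}\gamma_{p'+i}=q$, $\sum_{i=1}^{m'}\gamma_{p'+q'+i}=m$, $\sum_{i=1}^{n'}\gamma_{p'+q'+m'+i}=n$. Put $d_1=0$, $d_{a+1}=\xi_1+\dots+\xi_a$; $l_1=0$, $l_{i+1}=\gamma_1+\dots+\gamma_i$. **Takiff superalgebras.** For a Lie superalgebra $\mathfrak g$,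 $a\in\mathbb C$, $\gamma\ge1$, put $t_a=t-a$ and $\mathfrak g(a,\gamma)=\mathfrak g[t_a]/t_a^\gamma\mathfrak g[t_a]$; the class of $A\otimes t_a^k$ is written $A\otimes\bar t_a^{\,k}$. Put $\mathfrak{gl}_d(\mathbf z,\boldsymbol\gamma)=\bigoplus_{i=1}^\ell\mathfrak{gl}_d(z_i,\gamma_i)$ and $\mathfrak{gl}_{p+m|q+n}(\mathbf w,\boldsymbol\xi)=\bigoplus_{a=1}^{d'}\mathfrak{gl}_{p+m|q+n}(w_a,\xi_a)$ (external direct sums). $\mathcal S(\mathfrak g)$ is the supersymmetric algebra of $\mathfrak g$, with the Poisson bracket determined by $\{A,B\}=[A,B]$ for $A,B\in\mathfrak g$. **The Poisson superalgebra $\overline{\mathcal D}$.** It is the polynomial superalgebra (free supercommutative) in $x^a_i,p_{x^a_i}$ ($1\le i\le m+n$, even iff $i\le m$) and $y^a_r,p_{y^a_r}$ ($1\le r\le p+q$, even iff $r\le p$), $1\le a\le d$, with Poisson bracket determined by $\{p_{x^a_i},x^b_j\}=\delta_{ij}\delta_{ab}$, $\{p_{y^a_r},y^b_s\}=\delta_{rs}\delta_{ab}$, all other brackets among the families $\{x,x\},\{x,y\},\{y,y\},\{p_x,p_x\},\{p_x,p_y\},\{p_y,p_y\},\{p_x,y\},\{p_y,x\}$ being zero. **Homomorphisms.** $\bar\phi$ is the superalgebra homomorphism with $$e_{ab}\otimes\bar t_{z_i}^{\,k}\mapsto-\sum_{r=l_i+1}^{l_{i+1}-k}y^b_r\,p_{y^a_{r+k}}\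 (1\le i\le p'+q',\ 0\le k<\gamma_i),$$ $$e_{ab}\otimes\bar t_{z_j}^{\,k}\mapsto\sum_{r=l_j+1-p-q}^{l_{j+1}-k-p-q}(-1)^{|p+q+r|}p_{x^b_r}x^a_{r+k}\ (p'+q'<j\le\ell,\ 0\le k<\gamma_j).$$ $\bar\varphi$ is the superalgebra homomorphism given, with all sums over $\alpha$ from $d_a+1$ to $d_{a+1}-k$, for $1\le a\le d'$, $0\le k<\xi_a$, $1\le r,s\le p+q$, $1\le i,j\le m+n$, by $E^r_s\otimes\bar t_{w_a}^{\,k}\mapsto\sum(-1)^{|s|+1}p_{y^{\alpha+k}_r}y^\alpha_s$; $E^r_{p+q+j}\otimes\bar t_{w_a}^{\,k}\mapsto\sum p_{y^{\alpha+k}_r}p_{x^\alpha_j}$; $E^{p+q+i}_s\otimes\bar t_{w_a}^{\,k}\mapsto\sum(-1)^{|s|+1}x^{\alpha+k}_iy^\alpha_s$; $E^{p+q+i}_{p+q+j}\otimes\bar t_{w_a}^{\,k}\mapsto\sum x^{\alpha+k}_ip_{x^\alpha_j}$. **Berezinian.** For an $N\times N$ matrix $A$ and a sequence $\mathbf s=(s_1,\dots,s_N)$ of 0's and 1's, $\mathrm{Ber}^{\mathbf s}(A)=d_1(A)^{(-1)^{s_1}}\cdots d_N(A)^{(-1)^{s_N}}$, where $d_i(A)$ is the inverse of the $(i,i)$ entry of the inverse of the upper-left $i\times i$ submatrix of $A$. **Classical Gaudin algebras.** Let $z,w$ be commuting even variables; $\mathcal A(\!(z^{-1},w^{-1})\!)$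 denotes series $\sum_{j\le s}\sum_{i\le r}a_{ij}z^iw^j$, $r,s\in\mathbb Z$. Fractions are expanded in $z^{-1}$, resp. $w^{-1}$. $\mathrm J_k(\lambda)$ is the $k\times k$ Jordan block with $\lambda$ on the diagonal and $1$ on the superdiagonal; $\mathrm J_{\boldsymbol\xi}(\mathbf w)=\bigoplus_a\mathrm J_{\xi_a}(w_a)$, $\mathrm J_{\boldsymbol\gamma}(\mathbf z)=\bigoplus_i\mathrm J_{\gamma_i}(z_i)$. (1) $\overline{\mathcal A}_d^{\mathbf w,\boldsymbol\xi}(\mathbf z,\boldsymbol\gamma)$ is the subalgebra of $\mathcal S(\mathfrak{gl}_d(\mathbf z,\boldsymbol\gamma))$ generated by all coefficients of the series $\bar a_1(z),\dots,\bar a_d(z)$ in $$\det\Big[\delta_{ab}w-\mathrm J_{\boldsymbol\xi}(\mathbf w)_{a,b}-\sum_{i=1}^\ell\sum_{k=0}^{\gamma_i-1}\frac{e_{ab}\otimes\bar t_{z_i}^{\,k}}{(z-z_i)^{k+1}}\Big]_{a,b=1}^d=w^d+\sum_{i=1}^d\bar a_i(z)w^{i-1}.$$ (2) With $\mathbf s=(0^p,1^q,0^m,1^n)$, $\overline{\mathcal A}_{p+m|q+n}^{\mathbf z,\boldsymbol\gamma}(\mathbf w,\boldsymbol\xi)$ is the subalgebra of $\mathcal S(\mathfrak{gl}_{p+m|q+n}(\mathbf w,\boldsymbol\xi))$ generated by all coefficients of the series $\bar b_i(w)$, $i\le p+m-q-n$, in $$\mathrm{Ber}^{\mathbf s}\Big[\delta_{ij}z-\mathrm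 J_{\boldsymbol\gamma}(\mathbf z)_{i,j}-(-1)^{|i|}\sum_{a=1}^{d'}\sum_{k=0}^{\xi_a-1}\frac{E^i_j\otimes\bar t_{w_a}^{\,k}}{(w-w_a)^{k+1}}\Big]_{i,j\in\mathbb I}=\sum_{i\le p+m-q-n}\bar b_i(w)z^i.$$ *)

theory Defs
  imports
    "Jordan_Normal_Form.Jordan_Normal_Form"
    "Jordan_Normal_Form.Determinant"
    "HOL-Computational_Algebra.Formal_Laurent_Series"
    "HOL-Library.Poly_Mapping"
begin

section \<open>Free supercommutative algebras\<close>

text \<open>The parity of a generator is a function of the generator, so that the free supercommutative
  algebra is a ring type. Generators whose parity depends on numerical parameters carry their
  parity as a tag.\<close>

class parity =
  fixes podd :: "'a \<Rightarrow> bool"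

class even_parity = parity +
  assumes not_podd [simp]: "\<not> podd x"

datatype 'g word = Word (letters: "'g list")

instantiation word :: (type) monoid_add
begin
definition zero_word :: "'a word" where "0 = Word []"
definition plus_word :: "'a word \<Rightarrow> 'a word \<Rightarrow> 'a word"
  where "u + v = Word (letters u @ letters v)"
instance by standard (auto simp: zero_word_def plus_word_def)
end

text \<open>The monoid algebra of the free monoid, i.e. the free associative unital algebra.\<close>

type_synonym 'g free_algebra = "'g word \<Rightarrow>\<^sub>0 complex"

definition sg :: "bool \<Rightarrow> 'a::ring_1" where
  "sg b = (if b then - 1 else 1)"

definition free_gen :: "'g \<Rightarrow> 'g free_algebra" where
  "free_gen g = Poly_Mapping.single (Word [g]) 1"

definition supercommutator :: "'g::parity \<Rightarrow> 'g \<Rightarrow> 'g free_algebra" where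
  "supercommutator a b =
     free_gen a * free_gen b - sg (podd a \<and> podd b) * (free_gen b * free_gen a)"

inductive_set super_ideal :: "'g::parity free_algebra set" where
  zero: "0 \<in> super_ideal"
| add: "x \<in> super_ideal \<Longrightarrow> x + u * supercommutator a b * v \<in> super_ideal"

lemma super_ideal_gen: "u * supercommutator a b * v \<in> super_ideal"
  using super_ideal.add[OF super_ideal.zero, of u a b v] by simp

lemma super_ideal_add:
  assumes "x \<in> super_ideal" "y \<in> super_ideal" shows "x + y \<in> super_ideal"
  using assms(2)
proof induction
  case zero
  then show ?case using assms by simp
next
  case (add y u a b v)
  from super_ideal.add[OF add.IH, of u a b v] show ?case by (simp add: add.assoc)
qed

lemma super_ideal_mult_left: "x \<in> super_ideal \<Longrightarrow> c * x \<in> super_ideal"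
proof (induction rule: super_ideal.induct)
  case zero
  then show ?case by (simp add: super_ideal.zero)
next
  case (add x u a b v)
  from super_ideal.add[OF add.IH, of "c * u" a b v] show ?case
    by (simp add: distrib_left mult.assoc)
qed

lemma super_ideal_mult_right: "x \<in> super_ideal \<Longrightarrow> x * c \<in> super_ideal"
proof (induction rule: super_ideal.induct)
  case zero
  then show ?case by (simp add: super_ideal.zero)
next
  case (add x u a b v)
  from super_ideal.add[OF add.IH, of u a b "v * c"] show ?case
    by (simp add: distrib_right mult.assoc)
qed

lemma super_ideal_uminus: "x \<in> super_ideal \<Longrightarrow> - x \<in> super_ideal"
  using super_ideal_mult_left[of x "- 1"] by simp

lemma free_algebra_induct [case_names single add]:
  fixes x :: "'g free_algebra"
  assumes single: "\<And>w k. P (Poly_Mapping.single w k)"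
    and add: "\<And>x y. P x \<Longrightarrow> P y \<Longrightarrow> P (x + y)"
  shows "P x"
proof (induction x rule: update_induct)
  case const
  then show ?case using single[of 0 0] by simp
next
  case (update f a b)
  have "Poly_Mapping.update a b f = f + Poly_Mapping.single a b"
    using update(1) by (intro poly_mapping_eqI) (auto simp: lookup_update lookup_add lookup_single in_keys_iff)
  then show ?case using add[OF update(3) single] by simp
qed

lemma lookup_mult_zero_word:
  fixes x y :: "'g free_algebra"
  shows "Poly_Mapping.lookup (x * y) (Word []) =
    Poly_Mapping.lookup x (Word []) * Poly_Mapping.lookup y (Word [])"
proof (induction x rule: free_algebra_induct)
  case (single u k)
  have eq: "u + v = Word [] \<longleftrightarrow> u = Word [] \<and> v = Word []" for u v :: "'g word"
    by (cases u; cases v) (auto simp: plus_word_def)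
  show ?case
    by (induction y rule: free_algebra_induct)
       (auto simp: mult_single lookup_single eq when_def lookup_add distrib_left)
qed (simp add: distrib_right lookup_add)

lemma super_ideal_lookup_zero: "x \<in> super_ideal \<Longrightarrow> Poly_Mapping.lookup x (Word []) = 0"
proof (induction rule: super_ideal.induct)
  case zero
  then show ?case by simp
next
  case (add x u a b v)
  have "Poly_Mapping.lookup (supercommutator a b) (Word []) = 0"
    by (simp add: supercommutator_def lookup_minus lookup_mult_zero_word free_gen_def lookup_single)
  with add show ?case by (simp add: lookup_add lookup_mult_zero_word)
qed

definition super_rel :: "'g::parity free_algebra \<Rightarrow> 'g free_algebra \<Rightarrow> bool" where
  "super_rel x y \<longleftrightarrow> x - y \<in> super_ideal"

text \<open>The quotient by the relations \<open>a b = (-1)\<^sup>|\<^sup>a\<^sup>|\<^sup>|\<^sup>b\<^sup>| b a\<close> between generators. Odd generators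
  square to zero, since 2 is invertible.\<close>

quotient_type (overloaded) 'g ssym = "'g::parity free_algebra" / super_rel
proof (rule equivpI)
  show "reflp (super_rel :: 'g free_algebra \<Rightarrow> _)"
    by (auto simp: reflp_def super_rel_def super_ideal.zero)
  show "symp (super_rel :: 'g free_algebra \<Rightarrow> _)"
  proof (rule sympI)
    fix x y :: "'g free_algebra"
    assume "super_rel x y"
    from super_ideal_uminus[OF this[unfolded super_rel_def]]
    show "super_rel y x" by (simp add: super_rel_def)
  qed
  show "transp (super_rel :: 'g free_algebra \<Rightarrow> _)"
  proof (rule transpI)
    fix x y z :: "'g free_algebra"
    assume "super_rel x y" "super_rel y z"
    from super_ideal_add[OF this[unfolded super_rel_def]]
    show "super_rel x z" by (simp add: super_rel_def)
  qed
qed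

instantiation ssym :: (parity) ring_1
begin
lift_definition zero_ssym :: "'a ssym" is 0 .
lift_definition one_ssym :: "'a ssym" is 1 .
lift_definition plus_ssym :: "'a ssym \<Rightarrow> 'a ssym \<Rightarrow> 'a ssym" is "(+)"
proof -
  fix a b c e :: "'a free_algebra"
  assume "super_rel a b" "super_rel c e"
  from super_ideal_add[OF this[unfolded super_rel_def]]
  show "super_rel (a + c) (b + e)" by (simp add: super_rel_def algebra_simps)
qed
lift_definition uminus_ssym :: "'a ssym \<Rightarrow> 'a ssym" is uminus
proof -
  fix a b :: "'a free_algebra"
  assume "super_rel a b"
  from super_ideal_uminus[OF this[unfolded super_rel_def]]
  show "super_rel (- a) (- b)" by (simp add: super_rel_def algebra_simps)
qed
lift_definition minus_ssym :: "'a ssym \<Rightarrow> 'a ssym \<Rightarrow> 'a ssym" is "(-)"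
proof -
  fix a b c e :: "'a free_algebra"
  assume "super_rel a b" "super_rel c e"
  then have "(a - b) + - (c - e) \<in> super_ideal"
    unfolding super_rel_def by (intro super_ideal_add super_ideal_uminus)
  then show "super_rel (a - c) (b - e)" by (simp add: super_rel_def algebra_simps)
qed
lift_definition times_ssym :: "'a ssym \<Rightarrow> 'a ssym \<Rightarrow> 'a ssym" is "(*)"
proof -
  fix a b c e :: "'a free_algebra"
  assume "super_rel a b" "super_rel c e"
  then have "(a - b) * c + b * (c - e) \<in> super_ideal"
    unfolding super_rel_def
    by (intro super_ideal_add super_ideal_mult_left super_ideal_mult_right)
  then show "super_rel (a * c) (b * e)" by (simp add: super_rel_def algebra_simps)
qed
instance
proof
  fix a b c :: "'a ssym"
  show "a * b * c = a * (b * c)" by transfer (simp add: mult.assoc super_rel_def super_ideal.zero)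
  show "1 * a = a" by transfer (simp add: super_rel_def super_ideal.zero)
  show "a * 1 = a" by transfer (simp add: super_rel_def super_ideal.zero)
  show "a + b + c = a + (b + c)" by transfer (simp add: add.assoc super_rel_def super_ideal.zero)
  show "a + b = b + a" by transfer (simp add: add.commute super_rel_def super_ideal.zero)
  show "0 + a = a" by transfer (simp add: super_rel_def super_ideal.zero)
  show "- a + a = 0" by transfer (simp add: super_rel_def super_ideal.zero)
  show "a - b = a + - b" by transfer (simp add: super_rel_def super_ideal.zero)
  show "(a + b) * c = a * c + b * c"
    by transfer (simp add: distrib_right super_rel_def super_ideal.zero)
  show "a * (b + c) = a * b + a * c"
    by transfer (simp add: distrib_left super_rel_def super_ideal.zero)
  show "(0::'a ssym) \<noteq> 1"
  proof transfer
    have "Poly_Mapping.lookup (0 - 1 :: 'a free_algebra) (Word []) \<noteq> 0"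
      by (simp add: lookup_one zero_word_def when_def)
    then show "\<not> super_rel (0::'a free_algebra) 1"
      unfolding super_rel_def using super_ideal_lookup_zero by blast
  qed
qed
end

lift_definition gen :: "'g::parity \<Rightarrow> 'g ssym" is free_gen .

lift_definition scal :: "complex \<Rightarrow> 'g::parity ssym" is "Poly_Mapping.single 0" .

definition mon :: "'g::parity list \<Rightarrow> 'g ssym" where
  "mon w = prod_list (map gen w)"

lemma sg_simps [simp]: "sg True = (- 1 :: 'a::ring_1)" "sg False = (1 :: 'a::ring_1)"
  by (simp_all add: sg_def)

lemma gen_commute: "gen a * gen b = sg (podd a \<and> podd b) * (gen b * gen a)"
proof -
  have *: "super_rel (free_gen a * free_gen b) (sg (podd a \<and> podd b) * (free_gen b * free_gen a))"
    using super_ideal_gen[of 1 a b 1] by (simp add: super_rel_def supercommutator_def)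
  show ?thesis
  proof (cases "podd a \<and> podd b")
    case True
    with * show ?thesis by simp (transfer, simp)
  next
    case False
    with * show ?thesis unfolding sg_def by (simp only: if_False mult_1_left) (transfer, simp)
  qed
qed

lemma scal_simps [simp]:
  "scal 0 = 0" "scal 1 = 1"
  "scal (a + b) = scal a + scal b" "scal (- a) = - scal a" "scal (a - b) = scal a - scal b"
  "scal (a * b) = scal a * scal b"
  by (transfer, simp add: super_rel_def super_ideal.zero single_add single_uminus single_diff mult_single)+

lemma scal_commute: "scal k * x = x * scal k"
proof transfer
  fix k and x :: "'a free_algebra"
  have "Poly_Mapping.single 0 k * x = x * Poly_Mapping.single 0 k"
    by (induction x rule: free_algebra_induct) (simp_all add: mult_single algebra_simps)
  then show "super_rel (Poly_Mapping.single 0 k * x) (x * Poly_Mapping.single 0 k)"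
    by (simp add: super_rel_def super_ideal.zero)
qed

lemma mon_simps [simp]: "mon [] = 1" "mon (a # w) = gen a * mon w" "mon (u @ v) = mon u * mon v"
  by (simp_all add: mon_def)

lemma abs_ssym_single: "abs_ssym (Poly_Mapping.single (Word w) k) = scal k * mon w"
proof -
  have "abs_ssym (Poly_Mapping.single (Word w) 1) = mon w"
  proof (induction w)
    case Nil
    then show ?case by (simp add: one_ssym.abs_eq zero_word_def flip: single_one)
  next
    case (Cons a w)
    have "free_gen a * Poly_Mapping.single (Word w) 1 = Poly_Mapping.single (Word (a # w)) 1"
      by (simp add: free_gen_def mult_single plus_word_def)
    then have "gen a * abs_ssym (Poly_Mapping.single (Word w) 1) =
        abs_ssym (Poly_Mapping.single (Word (a # w)) 1)"
      by (simp only: gen.abs_eq times_ssym.abs_eq)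
    then show ?case unfolding Cons by simp
  qed
  moreover have "Poly_Mapping.single 0 k * Poly_Mapping.single (Word w) 1 = Poly_Mapping.single (Word w) k"
    by (simp add: mult_single)
  ultimately show ?thesis by (metis scal.abs_eq times_ssym.abs_eq)
qed

lemma ssym_induct [case_names mon add]:
  fixes x :: "'g::parity ssym"
  assumes mon: "\<And>k w. P (scal k * mon w)"
    and add: "\<And>x y. P x \<Longrightarrow> P y \<Longrightarrow> P (x + y)"
  shows "P x"
proof (induction x rule: ssym.abs_induct)
  case (1 f)
  show "P (abs_ssym f)"
  proof (induction f rule: free_algebra_induct)
    case (single w k)
    then show ?case by (cases w) (simp add: abs_ssym_single mon)
  next
    case (add x y)
    then show ?case by (simp add: assms(2) flip: plus_ssym.abs_eq)
  qed
qed

definition linext :: "('g list \<Rightarrow> 'h::parity ssym) \<Rightarrow> 'g free_algebra \<Rightarrow> 'h ssym" where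
  "linext h x = (\<Sum>w\<in>Poly_Mapping.keys x. scal (Poly_Mapping.lookup x w) * h (letters w))"

text \<open>The linear extension of a function on monomials. It is computed on an arbitrary representative,
  which is meaningful if the function is compatible with the relations (\<open>compat\<close> below).\<close>

definition ssym_ext :: "('g::parity list \<Rightarrow> 'h::parity ssym) \<Rightarrow> 'g ssym \<Rightarrow> 'h ssym" where
  "ssym_ext h x = linext h (rep_ssym x)"

definition compat :: "('g::parity list \<Rightarrow> 'h::parity ssym) \<Rightarrow> bool" where
  "compat h \<longleftrightarrow>
     (\<forall>u a b v. h (u @ a # b # v) = sg (podd a \<and> podd b) * h (u @ b # a # v))"

lemma linext_single [simp]: "linext h (Poly_Mapping.single w k) = scal k * h (letters w)"
  by (cases "k = 0") (simp_all add: linext_def)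

lemma linext_0 [simp]: "linext h 0 = 0"
  by (simp add: linext_def)

lemma linext_add: "linext h (x + y) = linext h x + linext h y"
proof -
  let ?K = "Poly_Mapping.keys x \<union> Poly_Mapping.keys y"
  have *: "linext h z = (\<Sum>w\<in>?K. scal (Poly_Mapping.lookup z w) * h (letters w))"
    if "Poly_Mapping.keys z \<subseteq> ?K" for z
    unfolding linext_def using that
    by (intro sum.mono_neutral_left) (auto simp: in_keys_iff)
  show ?thesis
    by (simp add: * Poly_Mapping.keys_add lookup_add distrib_right sum.distrib)
qed

lemma linext_uminus: "linext h (- x) = - linext h x"
  using linext_add[of h x "- x"] by (simp add: eq_neg_iff_add_eq_0 add.commute)

lemma linext_diff: "linext h (x - y) = linext h x - linext h y"
  using linext_add[of h x "- y"] by (simp add: linext_uminus)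

lemma linext_super_ideal:
  assumes "compat h" "x \<in> super_ideal" shows "linext h x = 0"
  using assms(2)
proof induction
  case zero
  then show ?case by simp
next
  case (add x u a b v)
  have "linext h (u * supercommutator a b * v) = 0"
  proof (induction u rule: free_algebra_induct)
    case u: (single u k)
    show ?case
    proof (induction v rule: free_algebra_induct)
      case (single v l)
      have "h (letters u @ a # b # letters v) =
          sg (podd a \<and> podd b) * h (letters u @ b # a # letters v)"
        using assms(1) unfolding compat_def by blast
      moreover have "Poly_Mapping.single u k * supercommutator a b * Poly_Mapping.single v l =
          Poly_Mapping.single (Word (letters u @ a # b # letters v)) (k * l) -
          sg (podd a \<and> podd b) *
            Poly_Mapping.single (Word (letters u @ b # a # letters v)) (k * l)"
        by (cases "podd a"; cases "podd b")
           (simp_all add: supercommutator_def free_gen_def mult_single plus_word_def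
             left_diff_distrib right_diff_distrib distrib_left distrib_right)
      ultimately show ?case
        by (cases "podd a"; cases "podd b") (simp_all add: linext_diff linext_add)
    qed (simp add: linext_add distrib_left)
  qed (simp add: linext_add distrib_right)
  then show ?case using add.IH by (simp add: linext_add)
qed

lemma ssym_ext_abs:
  assumes "compat h" shows "ssym_ext h (abs_ssym x) = linext h x"
proof -
  have "rep_ssym (abs_ssym x) - x \<in> super_ideal"
    using Quotient3_rep_abs[OF Quotient3_ssym] Quotient3_ssym
    by (metis Quotient3_def super_rel_def super_ideal.zero diff_self)
  from linext_super_ideal[OF assms this] show ?thesis
    by (simp add: ssym_ext_def linext_diff)
qed

lemma ssym_ext_add:
  assumes "compat h" shows "ssym_ext h (x + y) = ssym_ext h x + ssym_ext h y"
  by (induction x rule: ssym.abs_induct; induction y rule: ssym.abs_induct)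
     (simp add: plus_ssym.abs_eq ssym_ext_abs[OF assms] linext_add)

lemma ssym_ext_mon:
  assumes "compat h" shows "ssym_ext h (scal k * mon w) = scal k * h w"
  using ssym_ext_abs[OF assms, of "Poly_Mapping.single (Word w) k"] by (simp add: abs_ssym_single)

lemma ssym_ext_scal:
  assumes "compat h" shows "ssym_ext h (scal k * x) = scal k * ssym_ext h x"
proof (induction x rule: ssym_induct)
  case (mon l w)
  have *: "scal k * (scal l * mon w) = scal (k * l) * mon w" by (simp add: mult.assoc)
  show ?case unfolding * ssym_ext_mon[OF assms] by (simp add: mult.assoc)
qed (simp add: ssym_ext_add[OF assms] distrib_left)

lemma ssym_ext_mon':
  assumes "compat h" shows "ssym_ext h (mon w) = h w"
  using ssym_ext_mon[OF assms, of 1] by simp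

subsection \<open>Homogeneous elements\<close>

primrec wpar :: "'g::parity list \<Rightarrow> bool" where
  "wpar [] = False"
| "wpar (a # w) = (podd a \<noteq> wpar w)"

lemma wpar_append [simp]: "wpar (u @ v) = (wpar u \<noteq> wpar v)"
  by (induction u) auto

inductive_set homog :: "bool \<Rightarrow> 'g::parity ssym set" for e where
  zero: "0 \<in> homog e"
| add: "x \<in> homog e \<Longrightarrow> wpar w = e \<Longrightarrow> x + scal k * mon w \<in> homog e"

lemma homog_mon: "wpar w = e \<Longrightarrow> scal k * mon w \<in> homog e"
  using homog.add[OF homog.zero, of w e k] by simp

lemma homog_add: assumes "x \<in> homog e" "y \<in> homog e" shows "x + y \<in> homog e"
  using assms(2)
proof (induction y rule: homog.induct)
  case (add y w k)
  then show ?case using homog.add[of "x + y" e w k] by (simp add: add.assoc)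
qed (simp add: assms)

lemma homog_induct [consumes 1, case_names zero mon add]:
  assumes "x \<in> homog e" "P 0" "\<And>k w. wpar w = e \<Longrightarrow> P (scal k * mon w)"
    and "\<And>x y. x \<in> homog e \<Longrightarrow> y \<in> homog e \<Longrightarrow> P x \<Longrightarrow> P y \<Longrightarrow> P (x + y)"
  shows "P x"
  using assms(1)
proof induction
  case zero
  show ?case by (rule assms(2))
next
  case (add x w k)
  then show ?case by (intro assms(3,4) homog_mon)
qed

lemma homog_scal: "x \<in> homog e \<Longrightarrow> scal k * x \<in> homog e"
proof (induction x rule: homog_induct)
  case (mon l w)
  then show ?case using homog_mon[of w e "k * l"] by (simp add: mult.assoc)
qed (simp_all add: homog.zero distrib_left homog_add)

lemma homog_uminus: "x \<in> homog e \<Longrightarrow> - x \<in> homog e"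
  using homog_scal[of x e "- 1"] by (simp)

lemma homog_sg: "x \<in> homog e \<Longrightarrow> sg b * x \<in> homog e"
  by (auto simp: sg_def homog_uminus)

lemma homog_diff: "x \<in> homog e \<Longrightarrow> y \<in> homog e \<Longrightarrow> x - y \<in> homog e"
  using homog_add[of x e "- y"] homog_uminus by fastforce

lemma homog_sum: "(\<And>i. i \<in> A \<Longrightarrow> f i \<in> homog e) \<Longrightarrow> sum f A \<in> homog e"
  by (induction A rule: infinite_finite_induct) (auto simp: homog.zero homog_add)

lemma scal_left_commute: "x * (scal k * y) = scal k * (x * y)"
  by (metis mult.assoc scal_commute)

lemma scal_mult_scal: "scal k * x * (scal l * y) = scal k * (scal l * (x * y))"
  by (simp only: mult.assoc scal_left_commute[of x l])

lemma scal_swap: "scal k * (scal l * x) = scal l * (scal k * x)"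
  by (rule scal_left_commute)

lemma homog_mult: "x \<in> homog e \<Longrightarrow> y \<in> homog f \<Longrightarrow> x * y \<in> homog (e \<noteq> f)"
proof (induction x rule: homog_induct)
  case x: (mon k u)
  from x(2) show ?case
  proof (induction y rule: homog_induct)
    case (mon l v)
    have "scal k * mon u * (scal l * mon v) = scal (k * l) * mon (u @ v)"
      unfolding scal_mult_scal by (simp add: mult.assoc)
    then show ?case using homog_mon[of "u @ v" "e \<noteq> f" "k * l"] x(1) mon by simp
  qed (simp_all add: homog.zero distrib_left homog_add)
qed (simp_all add: homog.zero distrib_right homog_add)

lemma homog_gen: "gen a \<in> homog (podd a)"
  using homog_mon[of "[a]" "podd a" 1] by simp

lemma homog_mon1: "mon w \<in> homog (wpar w)"
  using homog_mon[of w _ 1] by simp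

lemma homog_one: "1 \<in> homog False"
  using homog_mon[of "[]" False 1] by simp

lemma sg_sg [simp]: "sg b * sg c = sg (b \<noteq> c)" "sg b * (sg c * x) = sg (b \<noteq> c) * x"
  by (auto simp: sg_def)

lemma gen_mon_commute: "gen a * mon v = sg (podd a \<and> wpar v) * (mon v * gen a)"
proof (induction v)
  case (Cons b v)
  have "gen a * mon (b # v) = sg (podd a \<and> podd b) * (gen b * (gen a * mon v))"
    using arg_cong[OF gen_commute[of a b], of "\<lambda>t. t * mon v"] by (simp add: mult.assoc)
  also have "\<dots> = sg (podd a \<and> wpar (b # v)) * (mon (b # v) * gen a)"
    unfolding Cons by (cases "podd a"; cases "podd b"; cases "wpar v") (simp_all add: mult.assoc)
  finally show ?case .
qed simp

lemma mon_commute: "mon u * mon v = sg (wpar u \<and> wpar v) * (mon v * mon u)"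
proof (induction u)
  case (Cons a u)
  have "mon (a # u) * mon v = sg (wpar u \<and> wpar v) * (gen a * mon v * mon u)"
    by (cases "wpar u"; cases "wpar v") (simp_all add: mult.assoc Cons)
  also have "\<dots> = sg (wpar (a # u) \<and> wpar v) * (mon v * mon (a # u))"
    unfolding gen_mon_commute
    by (cases "podd a"; cases "wpar u"; cases "wpar v") (simp_all add: mult.assoc)
  finally show ?case .
qed simp

lemma homog_commute:
  "x \<in> homog e \<Longrightarrow> y \<in> homog f \<Longrightarrow> x * y = sg (e \<and> f) * (y * x)"
proof (induction x rule: homog_induct)
  case x: (mon k u)
  from x(2) show ?case
  proof (induction y rule: homog_induct)
    case (mon l v)
    have "scal k * mon u * (scal l * mon v) = scal k * (scal l * (mon u * mon v))"
      by (rule scal_mult_scal)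
    also have "mon u * mon v = sg (e \<and> f) * (mon v * mon u)"
      using mon_commute[of u v] x(1) mon by simp
    also have "scal k * (scal l * (sg (e \<and> f) * (mon v * mon u))) =
        sg (e \<and> f) * (scal l * mon v * (scal k * mon u))"
      unfolding scal_mult_scal scal_swap[of l]
      by (cases e; cases f) simp_all
    finally show ?case .
  qed (simp_all add: distrib_left distrib_right)
qed (simp_all add: distrib_left distrib_right)

instance ssym :: (even_parity) comm_ring_1
proof
  fix x y :: "'a ssym"
  have w: "wpar w = False" for w :: "'a list" by (induction w) auto
  have h: "x \<in> homog False" for x :: "'a ssym"
    by (induction x rule: ssym_induct) (auto simp: w homog_mon homog_add)
  show "x * y = y * x"
    using homog_commute[OF h[of x] h[of y]] by simp
qed (simp_all add: distrib_right)

subsection \<open>Superalgebra homomorphisms given on generators\<close>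

definition salg_hom :: "('g::parity \<Rightarrow> 'h::parity ssym) \<Rightarrow> 'g ssym \<Rightarrow> 'h ssym" where
  "salg_hom f = ssym_ext (\<lambda>w. prod_list (map f w))"

section \<open>Poisson brackets determined by their values on generators\<close>

text \<open>\<open>c\<close> prescribes the bracket of two generators. The bracket of the supersymmetric algebra of a Lie
  superalgebra is the case where the generators are a homogeneous basis and \<open>c\<close> is the Lie
  superbracket of basis elements. The Jacobi identity is not part of the predicate, which already
  determines the bracket (\<open>poisson_superbracket_unique\<close>).\<close>

definition poisson_superbracket ::
  "('g::parity \<Rightarrow> 'g \<Rightarrow> 'g ssym) \<Rightarrow> ('g ssym \<Rightarrow> 'g ssym \<Rightarrow> 'g ssym) \<Rightarrow> bool" where
  "poisson_superbracket c br \<longleftrightarrow>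
     (\<forall>x y z. br (x + y) z = br x z + br y z) \<and>
     (\<forall>x y z. br x (y + z) = br x y + br x z) \<and>
     (\<forall>k x y. br (scal k * x) y = scal k * br x y) \<and>
     (\<forall>k x y. br x (scal k * y) = scal k * br x y) \<and>
     (\<forall>e f. \<forall>x\<in>homog e. \<forall>y\<in>homog f. br x y = - sg (e \<and> f) * br y x) \<and>
     (\<forall>e f. \<forall>x\<in>homog e. \<forall>y\<in>homog f. \<forall>z.
        br x (y * z) = br x y * z + sg (e \<and> f) * (y * br x z)) \<and>
     (\<forall>a b. br (gen a) (gen b) = c a b)"

definition poisson :: "('g::parity \<Rightarrow> 'g \<Rightarrow> 'g ssym) \<Rightarrow> 'g ssym \<Rightarrow> 'g ssym \<Rightarrow> 'g ssym" where
  "poisson c = (THE br. poisson_superbracket c br)"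

definition poisson_superalgebra_hom ::
  "('g::parity \<Rightarrow> 'g \<Rightarrow> 'g ssym) \<Rightarrow> ('h::parity \<Rightarrow> 'h \<Rightarrow> 'h ssym) \<Rightarrow> ('g ssym \<Rightarrow> 'h ssym) \<Rightarrow> bool" where
  "poisson_superalgebra_hom c c' F \<longleftrightarrow>
     F 1 = 1 \<and>
     (\<forall>x y. F (x + y) = F x + F y) \<and>
     (\<forall>k x. F (scal k * x) = scal k * F x) \<and>
     (\<forall>x y. F (x * y) = F x * F y) \<and>
     (\<forall>e. \<forall>x\<in>homog e. F x \<in> homog e) \<and>
     (\<forall>x y. F (poisson c x y) = poisson c' (F x) (F y))"

section \<open>The Lie superalgebras and their Takiff superalgebras\<close>

text \<open>\<open>Gl i k a b\<close> is the basis element \<open>e\<^sub>a\<^sub>b \<otimes> t\<^sup>k\<close> of the i-th summand of the direct sum of Takiff algebras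
  of \<open>gl\<^sub>d\<close>; indices start at 1 (and \<open>k\<close> at 0). The type \<open>gl_label ssym\<close> contains
  the supersymmetric algebra for every choice of parameters: for given parameters it is generated by
  the labels satisfying \<open>gl_range\<close>, and the remaining labels are unused
  (they have zero brackets and are mapped to zero).\<close>

datatype gl_label = Gl nat nat nat nat

instantiation gl_label :: even_parity
begin
definition podd_gl_label :: "gl_label \<Rightarrow> bool" where "podd_gl_label x = False"
instance by standard (simp add: podd_gl_label_def)
end

text \<open>\<open>Gls e a k i j\<close> is \<open>E\<^sup>i\<^sub>j \<otimes> t\<^sup>k\<close> in the a-th summand, with \<open>e\<close> its parity \<open>|i| + |j|\<close>.\<close>

datatype gls_label = Gls bool nat nat nat nat

instantiation gls_label :: parity
begin
primrec podd_gls_label :: "gls_label \<Rightarrow> bool" where "podd_gls_label (Gls e a k i j) = e"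
instance ..
end

text \<open>The generators \<open>x\<^sup>a\<^sub>i\<close>, \<open>p\<close> of \<open>x\<^sup>a\<^sub>i\<close>, \<open>y\<^sup>a\<^sub>i\<close>, \<open>p\<close> of \<open>y\<^sup>a\<^sub>i\<close>, each as \<open>_ e a i\<close> with \<open>e\<close> its parity.\<close>

datatype d_label = LX bool nat nat | LPX bool nat nat | LY bool nat nat | LPY bool nat nat

instantiation d_label :: parity
begin
primrec podd_d_label :: "d_label \<Rightarrow> bool" where
  "podd_d_label (LX e a i) = e"
| "podd_d_label (LPX e a i) = e"
| "podd_d_label (LY e a i) = e"
| "podd_d_label (LPY e a i) = e"
instance ..
end

text \<open>\<open>True\<close> stands for the odd parity.\<close>

definition ipar :: "nat \<Rightarrow> nat \<Rightarrow> nat \<Rightarrow> nat \<Rightarrow> bool" where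
  "ipar p q m i \<longleftrightarrow> i \<notin> {1..p} \<union> {p+q+1..p+q+m}"

text \<open>The truncation at \<open>t\<^sup>\<gamma>\<close> defining the Takiff algebra is in \<open>gl_elem\<close> (and \<open>gls_elem\<close>).\<close>

definition gl_elem :: "(nat \<Rightarrow> nat) \<Rightarrow> nat \<Rightarrow> nat \<Rightarrow> nat \<Rightarrow> nat \<Rightarrow> gl_label ssym" where
  "gl_elem gam i k a b = (if k < gam i then gen (Gl i k a b) else 0)"

primrec gl_range :: "nat \<Rightarrow> nat \<Rightarrow> (nat \<Rightarrow> nat) \<Rightarrow> gl_label \<Rightarrow> bool" where
  "gl_range d l gam (Gl i k a b) \<longleftrightarrow>
     i \<in> {1..l} \<and> k < gam i \<and> a \<in> {1..d} \<and> b \<in> {1..d}"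

definition gl_bracket ::
  "nat \<Rightarrow> nat \<Rightarrow> (nat \<Rightarrow> nat) \<Rightarrow> gl_label \<Rightarrow> gl_label \<Rightarrow> gl_label ssym" where
  "gl_bracket d l gam u v =
     (if gl_range d l gam u \<and> gl_range d l gam v then
        (case (u, v) of (Gl i k a b, Gl i' k' a' b') \<Rightarrow>
           if i = i' then
             (if b = a' then gl_elem gam i (k + k') a b' else 0) -
             (if a = b' then gl_elem gam i (k + k') a' b else 0)
           else 0)
      else 0)"

definition gls_elem ::
  "nat \<Rightarrow> nat \<Rightarrow> nat \<Rightarrow> (nat \<Rightarrow> nat) \<Rightarrow> nat \<Rightarrow> nat \<Rightarrow> nat \<Rightarrow> nat \<Rightarrow> gls_label ssym" where
  "gls_elem p q m xi a k i j =
     (if k < xi a then gen (Gls (ipar p q m i \<noteq> ipar p q m j) a k i j) else 0)"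

primrec gls_range ::
  "nat \<Rightarrow> nat \<Rightarrow> nat \<Rightarrow> nat \<Rightarrow> nat \<Rightarrow> (nat \<Rightarrow> nat) \<Rightarrow> gls_label \<Rightarrow> bool" where
  "gls_range p q m n d' xi (Gls e a k i j) \<longleftrightarrow>
     a \<in> {1..d'} \<and> k < xi a \<and> i \<in> {1..p+q+m+n} \<and> j \<in> {1..p+q+m+n} \<and>
     e = (ipar p q m i \<noteq> ipar p q m j)"

definition gls_bracket ::
  "nat \<Rightarrow> nat \<Rightarrow> nat \<Rightarrow> nat \<Rightarrow> nat \<Rightarrow> (nat \<Rightarrow> nat) \<Rightarrow> gls_label \<Rightarrow> gls_label \<Rightarrow> gls_label ssym" where
  "gls_bracket p q m n d' xi u v =
     (if gls_range p q m n d' xi u \<and> gls_range p q m n d' xi v then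
        (case (u, v) of (Gls e a k i j, Gls e' a' k' r s) \<Rightarrow>
           if a = a' then
             (if j = r then gls_elem p q m xi a (k + k') i s else 0) -
             sg ((ipar p q m i \<noteq> ipar p q m j) \<and> (ipar p q m r \<noteq> ipar p q m s)) *
               (if i = s then gls_elem p q m xi a (k + k') r j else 0)
           else 0)
      else 0)"

text \<open>The values \<open>- sg e\<close> of \<open>{x, p}\<close> follow from \<open>{p, x} = 1\<close> by super skew-symmetry.\<close>

fun d_bracket :: "d_label \<Rightarrow> d_label \<Rightarrow> d_label ssym" where
  "d_bracket (LPX e a i) (LX f b j) = (if (e, a, i) = (f, b, j) then 1 else 0)"
| "d_bracket (LX e a i) (LPX f b j) = (if (e, a, i) = (f, b, j) then - sg e else 0)"
| "d_bracket (LPY e a i) (LY f b j) = (if (e, a, i) = (f, b, j) then 1 else 0)"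
| "d_bracket (LY e a i) (LPY f b j) = (if (e, a, i) = (f, b, j) then - sg e else 0)"
| "d_bracket _ _ = 0"

section \<open>The homomorphisms into the Poisson superalgebra\<close>

definition dX :: "nat \<Rightarrow> nat \<Rightarrow> nat \<Rightarrow> d_label ssym" where "dX m a i = gen (LX (m < i) a i)"
definition dPX :: "nat \<Rightarrow> nat \<Rightarrow> nat \<Rightarrow> d_label ssym" where "dPX m a i = gen (LPX (m < i) a i)"
definition dY :: "nat \<Rightarrow> nat \<Rightarrow> nat \<Rightarrow> d_label ssym" where "dY p a r = gen (LY (p < r) a r)"
definition dPY :: "nat \<Rightarrow> nat \<Rightarrow> nat \<Rightarrow> d_label ssym" where "dPY p a r = gen (LPY (p < r) a r)"

text \<open>\<open>offset gam i\<close> is \<open>l\<^sub>i\<close> and \<open>offset xi a\<close> is \<open>d\<^sub>a\<close>.\<close>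

definition offset :: "(nat \<Rightarrow> nat) \<Rightarrow> nat \<Rightarrow> nat" where
  "offset g i = (\<Sum>j\<in>{1..<i}. g j)"

primrec phi_gen ::
  "nat \<Rightarrow> nat \<Rightarrow> nat \<Rightarrow> nat \<Rightarrow> nat \<Rightarrow> nat \<Rightarrow> nat \<Rightarrow> (nat \<Rightarrow> nat) \<Rightarrow> gl_label \<Rightarrow> d_label ssym" where
  "phi_gen d p q m p' q' l gam (Gl i k a b) =
     (if gl_range d l gam (Gl i k a b) then
        if i \<le> p' + q' then
          - (\<Sum>r\<in>{offset gam i + 1 .. offset gam (i + 1) - k}. dY p b r * dPY p a (r + k))
        else
          (\<Sum>r\<in>{offset gam i + 1 - (p + q) .. offset gam (i + 1) - k - (p + q)}.
             sg (ipar p q m (p + q + r)) * (dPX m b r * dX m a (r + k)))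
      else 0)"

primrec varphi_gen ::
  "nat \<Rightarrow> nat \<Rightarrow> nat \<Rightarrow> nat \<Rightarrow> nat \<Rightarrow> (nat \<Rightarrow> nat) \<Rightarrow> gls_label \<Rightarrow> d_label ssym" where
  "varphi_gen p q m n d' xi (Gls e a k i j) =
     (if gls_range p q m n d' xi (Gls e a k i j) then
        \<Sum>\<alpha>\<in>{offset xi a + 1 .. offset xi (a + 1) - k}.
          if i \<le> p + q then
            if j \<le> p + q then sg (\<not> ipar p q m j) * (dPY p (\<alpha> + k) i * dY p \<alpha> j)
            else dPY p (\<alpha> + k) i * dPX m \<alpha> (j - (p + q))
          else
            if j \<le> p + q then sg (\<not> ipar p q m j) * (dX m (\<alpha> + k) (i - (p + q)) * dY p \<alpha> j)
            else dX m (\<alpha> + k) (i - (p + q)) * dPX m \<alpha> (j - (p + q))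
      else 0)"

text \<open>\<open>l\<close> is the number of blocks, \<open>p' + q' + m' + n'\<close>.\<close>

definition gaudin_phi ::
  "nat \<Rightarrow> nat \<Rightarrow> nat \<Rightarrow> nat \<Rightarrow> nat \<Rightarrow> nat \<Rightarrow> nat \<Rightarrow> (nat \<Rightarrow> nat) \<Rightarrow> gl_label ssym \<Rightarrow> d_label ssym" where
  "gaudin_phi d p q m p' q' l gam = salg_hom (phi_gen d p q m p' q' l gam)"

definition gaudin_varphi ::
  "nat \<Rightarrow> nat \<Rightarrow> nat \<Rightarrow> nat \<Rightarrow> nat \<Rightarrow> (nat \<Rightarrow> nat) \<Rightarrow> gls_label ssym \<Rightarrow> d_label ssym" where
  "gaudin_varphi p q m n d' xi = salg_hom (varphi_gen p q m n d' xi)"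

section \<open>Determinants and Berezinians\<close>

definition ring_inv :: "'a::ring_1 \<Rightarrow> 'a" where
  "ring_inv x = (THE y. x * y = 1 \<and> y * x = 1)"

definition matrix_inv :: "'a::ring_1 mat \<Rightarrow> 'a mat" where
  "matrix_inv A =
     (THE B. B \<in> carrier_mat (dim_row A) (dim_row A) \<and> inverts_mat A B \<and> inverts_mat B A)"

definition upper_left :: "'a mat \<Rightarrow> nat \<Rightarrow> 'a mat" where
  "upper_left A i = mat i i (\<lambda>(r, c). A $$ (r, c))"

text \<open>\<open>d\<^sub>i(A)\<close>; matrices are indexed from 0.\<close>

definition ber_factor :: "'a::ring_1 mat \<Rightarrow> nat \<Rightarrow> 'a" where
  "ber_factor A i = ring_inv (matrix_inv (upper_left A i) $$ (i - 1, i - 1))"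

definition berezinian :: "nat list \<Rightarrow> 'a::ring_1 mat \<Rightarrow> 'a" where
  "berezinian s A =
     prod_list (map (\<lambda>i. if s ! (i - 1) = 0 then ber_factor A i else ring_inv (ber_factor A i))
       [1..<dim_row A + 1])"

section \<open>Classical Gaudin algebras\<close>

inductive_set subalgebra_gen :: "'g::parity ssym set \<Rightarrow> 'g ssym set" for S where
  scal: "scal k \<in> subalgebra_gen S"
| gen: "x \<in> S \<Longrightarrow> x \<in> subalgebra_gen S"
| add: "x \<in> subalgebra_gen S \<Longrightarrow> y \<in> subalgebra_gen S \<Longrightarrow> x + y \<in> subalgebra_gen S"
| mult: "x \<in> subalgebra_gen S \<Longrightarrow> y \<in> subalgebra_gen S \<Longrightarrow> x * y \<in> subalgebra_gen S"

definition block_jordan :: "nat \<Rightarrow> (nat \<Rightarrow> nat) \<Rightarrow> (nat \<Rightarrow> complex) \<Rightarrow> complex mat" where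
  "block_jordan r g v = jordan_matrix (map (\<lambda>i. (g i, v i)) [1..<r + 1])"

text \<open>In \<open>gl_label ssym fls poly\<close> the series variable is \<open>z\<^sup>-\<^sup>1\<close> (so \<open>fls_X_inv\<close> is \<open>z\<close>) and
  the polynomial variable is \<open>w\<close>.\<close>

definition gl_gaudin_matrix ::
  "nat \<Rightarrow> nat \<Rightarrow> (nat \<Rightarrow> nat) \<Rightarrow> (nat \<Rightarrow> complex) \<Rightarrow> nat \<Rightarrow> (nat \<Rightarrow> nat) \<Rightarrow> (nat \<Rightarrow> complex) \<Rightarrow>
   gl_label ssym fls poly mat" where
  "gl_gaudin_matrix d d' xi w l gam z = mat d d (\<lambda>(a, b).
     (if a = b then [:0, 1:] else 0)
     - [:fls_const (scal (block_jordan d' xi w $$ (a, b))):]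
     - (\<Sum>i=1..l. \<Sum>k<gam i.
          [:fls_const (gl_elem gam i k (a + 1) (b + 1))
            * ring_inv ((fls_X_inv - fls_const (scal (z i))) ^ (k + 1)):]))"

definition gl_gaudin ::
  "nat \<Rightarrow> nat \<Rightarrow> (nat \<Rightarrow> nat) \<Rightarrow> (nat \<Rightarrow> complex) \<Rightarrow> nat \<Rightarrow> (nat \<Rightarrow> nat) \<Rightarrow> (nat \<Rightarrow> complex) \<Rightarrow>
   gl_label ssym set" where
  "gl_gaudin d d' xi w l gam z = subalgebra_gen
     {fls_nth (coeff (det (gl_gaudin_matrix d d' xi w l gam z)) (i - 1)) s | i s. i \<in> {1..d}}"

text \<open>In \<open>gls_label ssym fls fls\<close> the outer series variable is \<open>z\<^sup>-\<^sup>1\<close> and the inner one is \<open>w\<^sup>-\<^sup>1\<close>. This ring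
  contains the series in \<open>z\<^sup>-\<^sup>1, w\<^sup>-\<^sup>1\<close> with exponents jointly bounded above; the inverses needed for the
  Berezinian are unique and already lie in the latter.\<close>

definition gls_gaudin_matrix ::
  "nat \<Rightarrow> nat \<Rightarrow> nat \<Rightarrow> nat \<Rightarrow> nat \<Rightarrow> (nat \<Rightarrow> nat) \<Rightarrow> (nat \<Rightarrow> complex) \<Rightarrow>
   nat \<Rightarrow> (nat \<Rightarrow> nat) \<Rightarrow> (nat \<Rightarrow> complex) \<Rightarrow> gls_label ssym fls fls mat" where
  "gls_gaudin_matrix p q m n d' xi w l gam z = mat (p+q+m+n) (p+q+m+n) (\<lambda>(i, j).
     (if i = j then fls_X_inv else 0)
     - fls_const (fls_const (scal (block_jordan l gam z $$ (i, j))))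
     - sg (ipar p q m (i + 1)) *
       (\<Sum>a=1..d'. \<Sum>k<xi a.
          fls_const (fls_const (gls_elem p q m xi a k (i + 1) (j + 1))
            * ring_inv ((fls_X_inv - fls_const (scal (w a))) ^ (k + 1)))))"

definition gls_gaudin ::
  "nat \<Rightarrow> nat \<Rightarrow> nat \<Rightarrow> nat \<Rightarrow> nat \<Rightarrow> (nat \<Rightarrow> nat) \<Rightarrow> (nat \<Rightarrow> complex) \<Rightarrow>
   nat \<Rightarrow> (nat \<Rightarrow> nat) \<Rightarrow> (nat \<Rightarrow> complex) \<Rightarrow> gls_label ssym set" where
  "gls_gaudin p q m n d' xi w l gam z = subalgebra_gen
     {fls_nth (fls_nth
        (berezinian (replicate p 0 @ replicate q 1 @ replicate m 0 @ replicate n 1)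
          (gls_gaudin_matrix p q m n d' xi w l gam z)) (- i)) s
      | i s. i \<le> int p + int m - int q - int n}"

section \<open>The homomorphisms and the brackets are well defined\<close>

text \<open>The rest of the theory shows that \<open>poisson_superbracket\<close> has a unique solution (for admissible \<open>c\<close>),
  and that \<open>gaudin_phi\<close> and \<open>gaudin_varphi\<close> are Poisson superalgebra homomorphisms
  (\<open>gaudin_phi_poisson_hom\<close>, \<open>gaudin_varphi_poisson_hom\<close>) with the prescribed values on generators.\<close>

subsection \<open>Homomorphisms\<close>

lemma salg_hom_compat:
  assumes "\<And>a. f a \<in> homog (podd a)"
  shows "compat (\<lambda>w. prod_list (map f w))"
proof -
  have "prod_list (map f (u @ a # b # v)) =
      sg (podd a \<and> podd b) * prod_list (map f (u @ b # a # v))" for u a b v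
  proof -
    have "prod_list (map f (u @ a # b # v)) =
        prod_list (map f u) * (f a * f b * prod_list (map f v))"
      by (simp add: mult.assoc)
    also have "\<dots> = prod_list (map f u) *
        (sg (podd a \<and> podd b) * (f b * f a) * prod_list (map f v))"
      by (simp only: homog_commute[OF assms assms, of a b])
    also have "\<dots> = sg (podd a \<and> podd b) * prod_list (map f (u @ b # a # v))"
      by (cases "podd a"; cases "podd b") (simp_all add: mult.assoc)
    finally show ?thesis .
  qed
  then show ?thesis unfolding compat_def by blast
qed

lemma salg_hom:
  fixes f :: "'g::parity \<Rightarrow> 'h::parity ssym"
  assumes "\<And>a. f a \<in> homog (podd a)"
  shows "salg_hom f (gen a) = f a"
    and "salg_hom f 1 = 1"
    and "salg_hom f (x + y) = salg_hom f x + salg_hom f y"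
    and "salg_hom f (scal k * x) = scal k * salg_hom f x"
    and "salg_hom f (x * y) = salg_hom f x * salg_hom f y"
    and "x \<in> homog e \<Longrightarrow> salg_hom f x \<in> homog e"
proof -
  note c = salg_hom_compat[where f = f, OF assms]
  show g: "salg_hom f (gen a) = f a" for a
    using ssym_ext_mon'[OF c, of "[a]"] by (simp add: salg_hom_def)
  show "salg_hom f 1 = 1"
    using ssym_ext_mon'[OF c, of "[]"] by (simp add: salg_hom_def)
  show add: "salg_hom f (x + y) = salg_hom f x + salg_hom f y" for x y
    by (simp add: salg_hom_def ssym_ext_add[OF c])
  show sc: "salg_hom f (scal k * x) = scal k * salg_hom f x" for k x
    by (simp add: salg_hom_def ssym_ext_scal[OF c])
  have m: "salg_hom f (mon w) = prod_list (map f w)" for w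
    by (simp add: salg_hom_def ssym_ext_mon'[OF c])
  show "salg_hom f (x * y) = salg_hom f x * salg_hom f y"
  proof (induction x rule: ssym_induct)
    case x: (mon k u)
    show ?case
    proof (induction y rule: ssym_induct)
      case (mon l v)
      have "scal k * mon u * (scal l * mon v) = scal k * (scal l * mon (u @ v))"
        unfolding scal_mult_scal by simp
      also have "salg_hom f \<dots> = scal k * (scal l * (salg_hom f (mon u) * salg_hom f (mon v)))"
        by (simp only: sc m) simp
      also have "\<dots> = salg_hom f (scal k * mon u) * salg_hom f (scal l * mon v)"
        by (simp only: sc scal_mult_scal)
      finally show ?case .
    qed (simp add: add distrib_left)
  qed (simp add: add distrib_right)
  have ph: "prod_list (map f w) \<in> homog (wpar w)" for w
  proof (induction w)
    case (Cons a w)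
    then show ?case using homog_mult[OF assms[of a], of "prod_list (map f w)" "wpar w"] by simp
  qed (simp add: homog_one)
  show "x \<in> homog e \<Longrightarrow> salg_hom f x \<in> homog e"
  proof (induction x rule: homog_induct)
    case zero
    then show ?case using sc[of 0 0] by (simp add: homog.zero)
  next
    case (mon k w)
    then show ?case using ph[of w] by (simp add: sc m homog_scal)
  qed (simp add: add homog_add)
qed

subsection \<open>Superderivations given on generators\<close>

primrec der_mon :: "bool \<Rightarrow> ('g::parity \<Rightarrow> 'g ssym) \<Rightarrow> 'g list \<Rightarrow> 'g ssym" where
  "der_mon e f [] = 0"
| "der_mon e f (a # w) = f a * mon w + sg (e \<and> podd a) * (gen a * der_mon e f w)"

definition der :: "bool \<Rightarrow> ('g::parity \<Rightarrow> 'g ssym) \<Rightarrow> 'g ssym \<Rightarrow> 'g ssym" where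
  "der e f = ssym_ext (der_mon e f)"

lemma der_mon_append:
  "der_mon e f (u @ v) = der_mon e f u * mon v + sg (e \<and> wpar u) * (mon u * der_mon e f v)"
proof (induction u)
  case (Cons a u)
  show ?case
    unfolding append_Cons der_mon.simps Cons wpar.simps mon_simps
    by (cases e; cases "podd a"; cases "wpar u")
       (simp_all add: mult.assoc distrib_left distrib_right right_diff_distrib left_diff_distrib)
qed simp

lemma der_compat:
  fixes f :: "'g::parity \<Rightarrow> 'g ssym"
  assumes f: "\<And>a. f a \<in> homog (e \<noteq> podd a)"
  shows "compat (der_mon e f)"
  unfolding compat_def
proof (intro allI)
  fix u v :: "'g list" and a b :: 'g
  have 1: "f a * (gen b * x) = sg ((e \<noteq> podd a) \<and> podd b) * (gen b * (f a * x))" for a b :: 'g and x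
    using arg_cong[OF homog_commute[OF f[of a] homog_gen[of b]], of "\<lambda>t. t * x"]
    by (simp add: mult.assoc)
  have 2: "gen a * (gen b * x) = sg (podd a \<and> podd b) * (gen b * (gen a * x))" for a b :: 'g and x
    using arg_cong[OF gen_commute[of a b], of "\<lambda>t. t * x"] by (simp add: mult.assoc)
  have 3: "mon (a # b # v) = sg (podd a \<and> podd b) * mon (b # a # v)"
    using 2[of a b "mon v"] by simp
  have 4: "der_mon e f (a # b # v) = sg (podd a \<and> podd b) * der_mon e f (b # a # v)"
    by (cases e; cases "podd a"; cases "podd b")
       (simp_all add: distrib_left right_diff_distrib 1[of a b] 1[of b a] 2[of a b])
  show "der_mon e f (u @ a # b # v) = sg (podd a \<and> podd b) * der_mon e f (u @ b # a # v)"
    unfolding der_mon_append[of e f u] 3 4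
    by (cases "podd a"; cases "podd b"; cases e; cases "wpar u")
       (simp_all add: distrib_left del: der_mon.simps mon_simps)
qed

context
  fixes e :: bool and f :: "'g::parity \<Rightarrow> 'g ssym"
  assumes f: "\<And>a. f a \<in> homog (e \<noteq> podd a)"
begin

lemma der_add: "der e f (x + y) = der e f x + der e f y"
  by (simp add: der_def ssym_ext_add[OF der_compat[where f = f, OF f]])

lemma der_scal: "der e f (scal k * x) = scal k * der e f x"
  by (simp add: der_def ssym_ext_scal[OF der_compat[where f = f, OF f]])

lemma der_mon: "der e f (mon w) = der_mon e f w"
  by (simp add: der_def ssym_ext_mon'[OF der_compat[where f = f, OF f]])

lemma der_0: "der e f 0 = 0"
  using der_scal[of 0 0] by simp

lemma der_gen: "der e f (gen a) = f a"
  using der_mon[of "[a]"] by simp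

lemma der_1: "der e f 1 = 0"
  using der_mon[of "[]"] by simp

lemma der_mult:
  assumes "x \<in> homog e'"
  shows "der e f (x * y) = der e f x * y + sg (e \<and> e') * (x * der e f y)"
  using assms
proof (induction x rule: homog_induct)
  case x: (mon k u)
  show ?case
  proof (induction y rule: ssym_induct)
    case (mon l v)
    have "der e f (scal k * mon u * (scal l * mon v)) =
        scal k * (scal l * der_mon e f (u @ v))"
      unfolding scal_mult_scal by (simp only: der_scal der_mon flip: mon_simps)
    also have "\<dots> = scal k * (scal l * (der_mon e f u * mon v)) +
        sg (e \<and> e') * (scal k * (scal l * (mon u * der_mon e f v)))"
      using x by (cases e; cases e') (simp_all add: der_mon_append distrib_left right_diff_distrib)
    also have "\<dots> = der e f (scal k * mon u) * (scal l * mon v) +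
        sg (e \<and> e') * (scal k * mon u * der e f (scal l * mon v))"
      by (simp only: der_scal der_mon scal_mult_scal)
    finally show ?case .
  next
    case (add y z)
    then show ?case by (simp add: der_add distrib_left add_ac)
  qed
next
  case (add x z)
  then show ?case by (simp add: der_add distrib_left distrib_right add_ac)
qed (simp add: der_0)

lemma der_homog: "x \<in> homog e' \<Longrightarrow> der e f x \<in> homog (e \<noteq> e')"
proof (induction x rule: homog_induct)
  case (mon k w)
  have "der_mon e f w \<in> homog (e \<noteq> wpar w)" for w
  proof (induction w)
    case (Cons a w)
    have "f a * mon w \<in> homog ((e \<noteq> podd a) \<noteq> wpar w)"
      by (intro homog_mult f homog_mon1)
    moreover have "gen a * der_mon e f w \<in> homog (podd a \<noteq> (e \<noteq> wpar w))"
      by (intro homog_mult homog_gen Cons)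
    moreover have "((e \<noteq> podd a) \<noteq> wpar w) = (e \<noteq> wpar (a # w))"
      "(podd a \<noteq> (e \<noteq> wpar w)) = (e \<noteq> wpar (a # w))"
      by auto
    ultimately show ?case by (auto intro!: homog_add homog_sg)
  qed (simp add: homog.zero)
  with mon show ?case by (auto simp: der_scal der_mon intro!: homog_scal)
qed (simp_all add: der_0 der_add homog.zero homog_add)

end

lemma der_cong_on_gen: "(\<And>a. f a = g a) \<Longrightarrow> der e f = der e g"
  by (metis ext)

definition parity_part :: "bool \<Rightarrow> 'g::parity ssym \<Rightarrow> 'g ssym" where
  "parity_part e = ssym_ext (\<lambda>w. if wpar w = e then mon w else 0)"

lemma parity_part_compat: "compat (\<lambda>w. if wpar w = e then mon w else 0 :: 'g::parity ssym)"
  unfolding compat_def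
proof (intro allI)
  fix u v :: "'g list" and a b
  have "mon (u @ a # b # v) = mon u * (gen a * gen b * mon v)"
    by (simp add: mult.assoc)
  also have "\<dots> = sg (podd a \<and> podd b) * mon (u @ b # a # v)"
    unfolding gen_commute[of a b]
    by (cases "podd a"; cases "podd b") (simp_all add: mult.assoc)
  finally show "(if wpar (u @ a # b # v) = e then mon (u @ a # b # v) else 0 :: 'g ssym) =
      sg (podd a \<and> podd b) * (if wpar (u @ b # a # v) = e then mon (u @ b # a # v) else 0)"
    by auto
qed

lemma parity_part_add: "parity_part e (x + y) = parity_part e x + parity_part e y"
  by (simp add: parity_part_def ssym_ext_add[OF parity_part_compat])

lemma parity_part_scal: "parity_part e (scal k * x) = scal k * parity_part e x"
  by (simp add: parity_part_def ssym_ext_scal[OF parity_part_compat])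

lemma parity_part_mon: "parity_part e (mon w) = (if wpar w = e then mon w else 0)"
  by (simp add: parity_part_def ssym_ext_mon'[OF parity_part_compat])

lemma parity_part_0: "parity_part e 0 = 0"
  using parity_part_scal[of e 0 0] by simp

lemma parity_part_homog: "parity_part e x \<in> homog e"
  by (induction x rule: ssym_induct)
     (auto simp: parity_part_scal parity_part_mon parity_part_add intro!: homog_mon homog_add homog.zero)

lemma parity_part_of_homog: "x \<in> homog f \<Longrightarrow> parity_part e x = (if e = f then x else 0)"
  by (induction x rule: homog_induct) (auto simp: parity_part_0 parity_part_add parity_part_scal parity_part_mon)

lemma parity_part_decomp: "parity_part False x + parity_part True x = x"
  by (induction x rule: ssym_induct)
     (auto simp: parity_part_scal parity_part_mon parity_part_add algebra_simps)

subsection \<open>Existence and uniqueness of the bracket\<close>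

lemma poisson_superbracket_unique:
  assumes "poisson_superbracket c br" "poisson_superbracket c br'"
  shows "br = br'"
proof -
  have one: "br x 1 = 0" if "poisson_superbracket c br" "x \<in> homog e" for br e x
  proof -
    have "br x (1 * 1) = br x 1 * 1 + sg (e \<and> False) * (1 * br x 1)"
      using that homog_one unfolding poisson_superbracket_def by blast
    then show ?thesis by simp
  qed
  have ext: "br x (mon w) = br' x (mon w)"
    if x: "x \<in> homog e" and g: "\<And>a. br x (gen a) = br' x (gen a)" for x e w
  proof (induction w)
    case Nil
    show ?case using one[OF assms(1) x] one[OF assms(2) x] by simp
  next
    case (Cons a w)
    have *: "br x (gen a * mon w) = br x (gen a) * mon w + sg (e \<and> podd a) * (gen a * br x (mon w))"
      if "poisson_superbracket c br" for br
      using that x homog_gen[of a] unfolding poisson_superbracket_def by blast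
    show ?case unfolding mon_simps *[OF assms(1)] *[OF assms(2)] g Cons ..
  qed
  have gg: "br (gen a) (gen b) = br' (gen a) (gen b)" for a b
    using assms unfolding poisson_superbracket_def by simp
  have gw: "br (gen a) (mon w) = br' (gen a) (mon w)" for a w
    by (rule ext[OF homog_gen gg])
  have wg: "br (mon w) (gen a) = br' (mon w) (gen a)" for a w
  proof -
    have *: "br (mon w) (gen a) = - sg (wpar w \<and> podd a) * br (gen a) (mon w)"
      if "poisson_superbracket c br" for br
      using that homog_gen[of a] homog_mon1[of w] unfolding poisson_superbracket_def by blast
    show ?thesis unfolding *[OF assms(1)] *[OF assms(2)] gw ..
  qed
  have ww: "br (mon v) (mon w) = br' (mon v) (mon w)" for v w
    by (rule ext[OF homog_mon1 wg])
  have "br x y = br' x y" for x y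
  proof (induction x rule: ssym_induct)
    case (mon k v)
    have "br (mon v) y = br' (mon v) y"
      by (induction y rule: ssym_induct)
         (use assms ww in \<open>simp_all add: poisson_superbracket_def\<close>)
    then show ?case using assms by (simp add: poisson_superbracket_def)
  next
    case (add x y)
    then show ?case using assms by (simp add: poisson_superbracket_def)
  qed
  then show ?thesis by blast
qed

locale generator_bracket =
  fixes c :: "'g::parity \<Rightarrow> 'g \<Rightarrow> 'g ssym"
  assumes c_homog: "c a b \<in> homog (podd a \<noteq> podd b)"
    and c_skew: "c a b = - sg (podd a \<and> podd b) * c b a"
begin

definition D where "D b = der (podd b) (c b)"

definition br_homog where
  "br_homog e x = der e (\<lambda>b. - sg (podd b \<and> e) * D b x)"

definition br where
  "br x y = br_homog False (parity_part False x) y + br_homog True (parity_part True x) y"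

lemmas D_add = der_add[of "c b" "podd b" for b, OF c_homog, folded D_def]
  and D_scal = der_scal[of "c b" "podd b" for b, OF c_homog, folded D_def]
  and D_0 = der_0[of "c b" "podd b" for b, OF c_homog, folded D_def]
  and D_gen = der_gen[of "c b" "podd b" for b, OF c_homog, folded D_def]
  and D_mult = der_mult[of "c b" "podd b" for b, OF c_homog, folded D_def]
  and D_homog = der_homog[of "c b" "podd b" for b, OF c_homog, folded D_def]

lemma br_gens_homog:
  assumes "x \<in> homog e"
  shows "- sg (podd b \<and> e) * D b x \<in> homog (e \<noteq> podd b)"
proof -
  have "(podd b \<noteq> e) = (e \<noteq> podd b)" by auto
  with D_homog[OF assms, of b] show ?thesis
    by (cases "podd b"; cases e) (simp_all add: homog_uminus)
qed

lemma brh_add: "x \<in> homog e \<Longrightarrow> br_homog e x (y + z) = br_homog e x y + br_homog e x z"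
  unfolding br_homog_def by (rule der_add) (rule br_gens_homog)

lemma brh_scal: "x \<in> homog e \<Longrightarrow> br_homog e x (scal k * y) = scal k * br_homog e x y"
  unfolding br_homog_def by (rule der_scal) (rule br_gens_homog)

lemma brh_gen: "x \<in> homog e \<Longrightarrow> br_homog e x (gen a) = - sg (podd a \<and> e) * D a x"
  unfolding br_homog_def by (rule der_gen) (rule br_gens_homog)

lemma brh_1: "x \<in> homog e \<Longrightarrow> br_homog e x 1 = 0"
  unfolding br_homog_def by (rule der_1) (rule br_gens_homog)

lemma brh_mult: "x \<in> homog e \<Longrightarrow> y \<in> homog f \<Longrightarrow>
    br_homog e x (y * z) = br_homog e x y * z + sg (e \<and> f) * (y * br_homog e x z)"
  unfolding br_homog_def by (rule der_mult) (rule br_gens_homog)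

lemma brh_homog: "x \<in> homog e \<Longrightarrow> y \<in> homog f \<Longrightarrow> br_homog e x y \<in> homog (e \<noteq> f)"
  unfolding br_homog_def by (rule der_homog) (rule br_gens_homog)

lemma brh_mon:
  assumes "x \<in> homog e"
  shows "br_homog e x (gen a * mon w) =
    - sg (podd a \<and> e) * (D a x * mon w) + sg (e \<and> podd a) * (gen a * br_homog e x (mon w))"
  using brh_mult[OF assms homog_gen, of a "mon w"] by (simp add: brh_gen[OF assms] mult.assoc)

lemma brh_add_left:
  assumes "x \<in> homog e" "y \<in> homog e"
  shows "br_homog e (x + y) z = br_homog e x z + br_homog e y z"
proof (induction z rule: ssym_induct)
  case (mon k w)
  have "br_homog e (x + y) (mon w) = br_homog e x (mon w) + br_homog e y (mon w)"
  proof (induction w)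
    case Nil
    show ?case using brh_1[OF homog_add[OF assms]] brh_1[OF assms(1)] brh_1[OF assms(2)] by simp
  next
    case (Cons a w)
    then show ?case
      by (simp add: brh_mon assms homog_add D_add algebra_simps)
  qed
  then show ?case using assms homog_add[OF assms] by (simp add: brh_scal distrib_left)
next
  case (add u v)
  then show ?case using assms homog_add[OF assms] by (simp add: brh_add)
qed

lemma brh_scal_left:
  assumes "x \<in> homog e"
  shows "br_homog e (scal k * x) z = scal k * br_homog e x z"
proof (induction z rule: ssym_induct)
  case (mon l w)
  have "br_homog e (scal k * x) (mon w) = scal k * br_homog e x (mon w)"
  proof (induction w)
    case Nil
    show ?case using brh_1[OF homog_scal[OF assms]] brh_1[OF assms] by simp
  next
    case (Cons a w)
    show ?case
      unfolding mon_simps brh_mon[OF homog_scal[OF assms]] brh_mon[OF assms] Cons D_scal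
      by (cases "podd a"; cases e)
        (simp_all add: mult.assoc distrib_left right_diff_distrib scal_left_commute[of "gen a" k])
  qed
  then show ?case using assms homog_scal[OF assms] by (simp add: brh_scal scal_swap[of k])
next
  case (add u v)
  then show ?case using assms homog_scal[OF assms] by (simp add: brh_add distrib_left)
qed

lemma br_eq: "x \<in> homog e \<Longrightarrow> br x y = br_homog e x y"
proof -
  have z: "br_homog e 0 y = 0" for e
    using brh_scal_left[OF homog.zero, where k = 0 and z = y] by simp
  show "x \<in> homog e \<Longrightarrow> br x y = br_homog e x y"
    by (cases e) (simp_all add: br_def parity_part_of_homog z)
qed

lemma br_gen_left: "br (gen a) x = D a x"
proof -
  have "(\<lambda>b. - sg (podd b \<and> podd a) * D b (gen a)) = c a"
  proof
    show "- sg (podd b \<and> podd a) * D b (gen a) = c a b" for b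
      unfolding D_gen c_skew[of a b] conj_commute[of "podd b"] ..
  qed
  then show ?thesis
    by (simp add: br_eq[OF homog_gen] br_homog_def D_def)
qed

lemma br_gen_right: "x \<in> homog e \<Longrightarrow> br x (gen a) = - sg (podd a \<and> e) * D a x"
  by (simp add: br_eq brh_gen)

lemma br_add_left: "br (x + y) z = br x z + br y z"
  by (simp add: br_def parity_part_add brh_add_left parity_part_homog)

lemma br_scal_left: "br (scal k * x) z = scal k * br x z"
  by (simp add: br_def parity_part_scal brh_scal_left parity_part_homog distrib_left)

lemma br_add_right: "br x (y + z) = br x y + br x z"
  by (simp add: br_def brh_add parity_part_homog)

lemma br_scal_right: "br x (scal k * z) = scal k * br x z"
  by (simp add: br_def brh_scal parity_part_homog distrib_left)

lemma br_mult_right: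
  "x \<in> homog e \<Longrightarrow> y \<in> homog f \<Longrightarrow> br x (y * z) = br x y * z + sg (e \<and> f) * (y * br x z)"
  by (simp add: br_eq brh_mult)

lemma br_one_right: "br x 1 = 0"
  by (simp add: br_def brh_1 parity_part_homog)

lemma br_homog: "x \<in> homog e \<Longrightarrow> y \<in> homog f \<Longrightarrow> br x y \<in> homog (e \<noteq> f)"
  using brh_homog[of x e y f] by (simp only: br_eq)

lemma br_mult_left:
  assumes x: "x \<in> homog e" and y: "y \<in> homog f"
  shows "br (x * y) (mon w) = x * br y (mon w) + sg (f \<and> wpar w) * (br x (mon w) * y)"
proof (induction w)
  case Nil
  then show ?case by (simp add: br_one_right)
next
  case (Cons a w)
  have ya: "y * gen a = sg (f \<and> podd a) * (gen a * y)"
    by (rule homog_commute[OF y homog_gen])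
  have ax: "gen a * (x * u) = sg (podd a \<and> e) * (x * (gen a * u))" for u
    using arg_cong[OF homog_commute[OF homog_gen[of a] x], of "\<lambda>t. t * u"]
    by (simp add: mult.assoc)
  have yw: "y * mon w = sg (f \<and> wpar w) * (mon w * y)"
    by (rule homog_commute[OF y homog_mon1])
  have 1: "br (x * y) (gen a * mon w) =
      - sg (podd a \<and> (e \<noteq> f)) * (D a (x * y) * mon w) +
      sg ((e \<noteq> f) \<and> podd a) * (gen a * br (x * y) (mon w))"
    using br_mult_right[OF homog_mult[OF x y] homog_gen, of a "mon w"]
    by (simp add: br_gen_right[OF homog_mult[OF x y]] mult.assoc)
  have 2: "br x (gen a * mon w) = - sg (podd a \<and> e) * (D a x * mon w) +
      sg (e \<and> podd a) * (gen a * br x (mon w))"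
    using br_mult_right[OF x homog_gen, of a "mon w"]
    by (simp add: br_gen_right[OF x] mult.assoc)
  have 3: "br y (gen a * mon w) = - sg (podd a \<and> f) * (D a y * mon w) +
      sg (f \<and> podd a) * (gen a * br y (mon w))"
    using br_mult_right[OF y homog_gen, of a "mon w"]
    by (simp add: br_gen_right[OF y] mult.assoc)
  show ?case
    unfolding mon_simps wpar.simps 1 2 3 Cons D_mult[OF x]
    by (cases e; cases f; cases "podd a"; cases "wpar w")
       (simp_all add: algebra_simps ax yw)
qed

lemma br_skew:
  assumes "x \<in> homog e" "y \<in> homog f"
  shows "br x y = - sg (e \<and> f) * br y x"
proof -
  have "br (mon u) (mon v) = - sg (wpar u \<and> wpar v) * br (mon v) (mon u)" for u v
  proof (induction u)
    case Nil
    show ?case using br_mult_left[OF homog_one homog_one, of v] by (simp add: br_one_right)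
  next
    case (Cons a u)
    have 1: "br (mon v) (gen a * mon u) = - sg (podd a \<and> wpar v) * (D a (mon v) * mon u) +
        sg (wpar v \<and> podd a) * (gen a * br (mon v) (mon u))"
      using br_mult_right[OF homog_mon1 homog_gen, of v a "mon u"]
      by (simp add: br_gen_right[OF homog_mon1] mult.assoc)
    show ?case
      unfolding mon_simps wpar.simps 1 br_mult_left[OF homog_gen homog_mon1] br_gen_left Cons
      by (cases "podd a"; cases "wpar u"; cases "wpar v") (simp_all add: algebra_simps)
  qed
  note ww = this
  from assms show ?thesis
  proof (induction x rule: homog_induct)
    case zero
    then show ?case using br_scal_left[of 0 0 y] br_scal_right[of y 0 0] by simp
  next
    case u: (mon k u)
    from u(2) have "br (mon u) y = - sg (e \<and> f) * br y (mon u)"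
    proof (induction y rule: homog_induct)
      case zero
      then show ?case
        using br_scal_left[of 0 0 "mon u"] br_scal_right[of "mon u" 0 0] by simp
    next
      case (mon l v)
      with u(1) ww[of u v] show ?case
        by (cases e; cases f) (simp_all add: br_scal_left br_scal_right)
    next
      case (add x y)
      then show ?case by (simp add: br_add_left br_add_right algebra_simps)
    qed
    then show ?case by (cases e; cases f) (simp_all add: br_scal_left br_scal_right)
  next
    case (add x y)
    then show ?case by (simp add: br_add_left br_add_right algebra_simps)
  qed
qed

lemma poisson_superbracket_br: "poisson_superbracket c br"
  unfolding poisson_superbracket_def
  by (intro conjI allI ballI)
     (rule br_add_left, rule br_add_right, rule br_scal_left, rule br_scal_right,
      rule br_skew, assumption, assumption, rule br_mult_right, assumption, assumption,
      simp add: br_gen_left D_gen)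

lemma poisson_eq: "poisson c = br"
  unfolding poisson_def
  by (rule the_equality) (use poisson_superbracket_br poisson_superbracket_unique in blast)+

lemma poisson_superbracket: "poisson_superbracket c (poisson c)"
  using poisson_superbracket_br by (simp add: poisson_eq)

end

lemma salg_hom_poisson:
  fixes c :: "'g::parity \<Rightarrow> 'g \<Rightarrow> 'g ssym" and c' :: "'h::parity \<Rightarrow> 'h \<Rightarrow> 'h ssym"
  assumes "generator_bracket c" "generator_bracket c'"
    and f: "\<And>a. f a \<in> homog (podd a)"
    and gens: "\<And>a b. poisson c' (f a) (f b) = salg_hom f (c a b)"
  shows "salg_hom f (poisson c x y) = poisson c' (salg_hom f x) (salg_hom f y)"
proof -
  let ?F = "salg_hom f"
  note F = salg_hom[where f = f, OF f]
  have P: "poisson_superbracket c (poisson c)" "poisson_superbracket c' (poisson c')"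
    using assms(1,2) generator_bracket.poisson_superbracket by blast+
  note bil = P[unfolded poisson_superbracket_def]
  have Fsg1: "?F (sg b) = sg b" for b
    using F(4)[of "-1" 1] F(2) by (auto simp: sg_def)
  have Fsg: "?F (sg b * x) = sg b * ?F x" "?F (- sg b * x) = - sg b * ?F x" for b x
    using F(4)[of "-1" x] F(4)[of 1 x] by (auto simp: sg_def)
  have one: "poisson c x 1 = 0" "poisson c' y 1 = 0" for x y
    using assms(1,2) by (simp_all add: generator_bracket.poisson_eq generator_bracket.br_one_right)
  have ext: "?F (poisson c x (mon w)) = poisson c' (?F x) (?F (mon w))"
    if x: "x \<in> homog e" and g: "\<And>a. ?F (poisson c x (gen a)) = poisson c' (?F x) (f a)" for x e w
  proof (induction w)
    case Nil
    then show ?case using F(4)[of 0 0] by (simp add: one F(2))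
  next
    case (Cons a w)
    have 1: "poisson c x (gen a * mon w) =
        poisson c x (gen a) * mon w + sg (e \<and> podd a) * (gen a * poisson c x (mon w))"
      using P(1) x homog_gen[of a] unfolding poisson_superbracket_def by blast
    have 2: "poisson c' (?F x) (f a * ?F (mon w)) =
        poisson c' (?F x) (f a) * ?F (mon w) + sg (e \<and> podd a) * (f a * poisson c' (?F x) (?F (mon w)))"
      using P(2) F(6)[OF x] f[of a] unfolding poisson_superbracket_def by blast
    show ?case by (simp add: 1 F(5) F(1) 2 F(3) Fsg1 g Cons)
  qed
  have gg: "?F (poisson c (gen a) (gen b)) = poisson c' (?F (gen a)) (f b)" for a b
    using bil gens[of a b] by (simp add: F(1))
  have wg: "?F (poisson c (mon w) (gen a)) = poisson c' (?F (mon w)) (f a)" for a w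
  proof -
    have "poisson c (mon w) (gen a) = - sg (wpar w \<and> podd a) * poisson c (gen a) (mon w)"
      using P(1) homog_gen[of a] homog_mon1[of w] unfolding poisson_superbracket_def by blast
    moreover have "poisson c' (?F (mon w)) (f a) =
        - sg (wpar w \<and> podd a) * poisson c' (f a) (?F (mon w))"
      using P(2) f[of a] F(6)[OF homog_mon1[of w]] unfolding poisson_superbracket_def by blast
    ultimately show ?thesis
      using ext[OF homog_gen gg, of a w] by (simp only: Fsg F(1))
  qed
  have ww: "?F (poisson c (mon v) (mon w)) = poisson c' (?F (mon v)) (?F (mon w))" for v w
    by (rule ext[OF homog_mon1 wg])
  show ?thesis
  proof (induction x rule: ssym_induct)
    case (mon k v)
    have "?F (poisson c (mon v) y) = poisson c' (?F (mon v)) (?F y)"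
    proof (induction y rule: ssym_induct)
      case (mon l w)
      then show ?case using bil ww[of v w] by (simp add: F(4))
    next
      case (add x y)
      then show ?case using bil by (simp add: F(3))
    qed
    then show ?case using bil by (simp add: F(4))
  next
    case (add x y)
    then show ?case using bil by (simp add: F(3))
  qed
qed

subsection \<open>Both maps are homomorphisms of Poisson superalgebras\<close>

lemma homog_sg1: "sg b \<in> homog False"
  using homog_sg[OF homog_one, of b] by simp

lemma gl_generator_bracket: "generator_bracket (gl_bracket d l gam)"
proof
  fix a b :: gl_label
  have h: "x \<in> homog False" for x :: "gl_label ssym"
  proof (induction x rule: ssym_induct)
    case (mon k w)
    have "wpar w = False" for w :: "gl_label list" by (induction w) auto
    then show ?case by (auto intro: homog_mon)
  qed (rule homog_add)
  show "gl_bracket d l gam a b \<in> homog (podd a \<noteq> podd b)" using h by simp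
  show "gl_bracket d l gam a b = - sg (podd a \<and> podd b) * gl_bracket d l gam b a"
    by (cases a; cases b) (auto simp: gl_bracket_def add.commute)
qed

lemma gls_generator_bracket: "generator_bracket (gls_bracket p q m n d' xi)"
proof
  fix u v :: gls_label
  obtain e a k i j where u: "u = Gls e a k i j" by (cases u)
  obtain e' a' k' r s where v: "v = Gls e' a' k' r s" by (cases v)
  let ?P = "ipar p q m"
  have h: "gls_elem p q m xi a l i j \<in> homog (?P i \<noteq> ?P j)" for a l i j
    using homog_gen[of "Gls (?P i \<noteq> ?P j) a l i j"] by (simp add: gls_elem_def homog.zero)
  show "gls_bracket p q m n d' xi u v \<in> homog (podd u \<noteq> podd v)"
  proof (cases "gls_range p q m n d' xi u \<and> gls_range p q m n d' xi v")
    case True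
    then have e: "e = (?P i \<noteq> ?P j)" "e' = (?P r \<noteq> ?P s)" by (auto simp: u v)
    have 1: "(if j = r then gls_elem p q m xi a (k + k') i s else 0) \<in> homog (e \<noteq> e')"
      using h[of a "k + k'" i s] e by (auto simp: homog.zero split: if_splits)
    have 2: "(if i = s then gls_elem p q m xi a (k + k') r j else 0) \<in> homog (e \<noteq> e')"
      using h[of a "k + k'" r j] e by (auto simp: homog.zero split: if_splits)
    show ?thesis
      using homog_diff[OF 1 homog_sg[OF 2]] True
      by (simp add: gls_bracket_def u v homog.zero)
  next
    case False
    then show ?thesis by (auto simp: gls_bracket_def homog.zero)
  qed
  show "gls_bracket p q m n d' xi u v = - sg (podd u \<and> podd v) * gls_bracket p q m n d' xi v u"
  proof (cases "gls_range p q m n d' xi u \<and> gls_range p q m n d' xi v")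
    case True
    then have e: "e = (?P i \<noteq> ?P j)" "e' = (?P r \<noteq> ?P s)" by (auto simp: u v)
    show ?thesis
      using True
      by (cases "?P i"; cases "?P j"; cases "?P r"; cases "?P s")
         (auto simp: gls_bracket_def u v e add.commute)
  next
    case False
    then show ?thesis by (auto simp: gls_bracket_def)
  qed
qed

lemma d_generator_bracket: "generator_bracket d_bracket"
proof
  fix a b :: d_label
  show "d_bracket a b \<in> homog (podd a \<noteq> podd b)"
    by (cases a; cases b) (auto simp: homog.zero homog_one homog_sg1 homog_uminus)
  show "d_bracket a b = - sg (podd a \<and> podd b) * d_bracket b a"
    by (cases a; cases b) (auto simp: sg_def)
qed

interpretation dpb: generator_bracket d_bracket
  by (rule d_generator_bracket)

abbreviation (input) pb where "pb \<equiv> dpb.br"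

lemma pb_0: "pb 0 y = 0" "pb x 0 = 0"
  using dpb.br_scal_left[of 0 0 y] dpb.br_scal_right[of x 0 0] by simp_all

lemma pb_sum_left: "pb (sum f A) y = (\<Sum>i\<in>A. pb (f i) y)"
  by (induction A rule: infinite_finite_induct) (auto simp: pb_0 dpb.br_add_left)

lemma pb_sum_right: "pb x (sum f A) = (\<Sum>i\<in>A. pb x (f i))"
  by (induction A rule: infinite_finite_induct) (auto simp: pb_0 dpb.br_add_right)

lemma pb_sg: "pb (sg b * x) y = sg b * pb x y" "pb x (sg b * y) = sg b * pb x y"
  using dpb.br_scal_left[of "-1" x y] dpb.br_scal_right[of x "-1" y] by (auto simp: sg_def)

lemma pb_quad:
  "pb (gen u * gen v) (gen s * gen t) =
     (gen u * d_bracket v s + sg (podd v \<and> podd s) * (d_bracket u s * gen v)) * gen t +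
     sg ((podd u \<noteq> podd v) \<and> podd s) *
       (gen s * (gen u * d_bracket v t + sg (podd v \<and> podd t) * (d_bracket u t * gen v)))"
proof -
  have 1: "pb (gen u * gen v) (gen s) =
      gen u * d_bracket v s + sg (podd v \<and> podd s) * (d_bracket u s * gen v)" for s
    using dpb.br_mult_left[OF homog_gen homog_gen, of u v "[s]"]
    by (simp add: dpb.br_gen_left dpb.D_gen)
  show ?thesis
    unfolding dpb.br_mult_right[OF homog_mult[OF homog_gen homog_gen] homog_gen] 1 ..
qed

definition VU :: "nat \<Rightarrow> nat \<Rightarrow> nat \<Rightarrow> nat \<Rightarrow> nat \<Rightarrow> d_label" where
  "VU p q m a r = (if r \<le> p + q then LY (p < r) a r else LPX (m < r - (p + q)) a (r - (p + q)))"

definition VV :: "nat \<Rightarrow> nat \<Rightarrow> nat \<Rightarrow> nat \<Rightarrow> nat \<Rightarrow> d_label" where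
  "VV p q m a r = (if r \<le> p + q then LPY (p < r) a r else LX (m < r - (p + q)) a (r - (p + q)))"

definition kap :: "nat \<Rightarrow> nat \<Rightarrow> nat \<Rightarrow> nat \<Rightarrow> bool" where
  "kap p q m r = (if r \<le> p + q then False else \<not> ipar p q m r)"

context
  fixes p q m :: nat
begin

private abbreviation (input) "U \<equiv> VU p q m"
private abbreviation (input) "V \<equiv> VV p q m"
private abbreviation (input) "P \<equiv> ipar p q m"
private abbreviation (input) "K \<equiv> kap p q m"

lemma podd_UV: assumes "1 \<le> r" shows "podd (U a r) = P r" "podd (V a r) = P r"
  using assms by (auto simp: VU_def VV_def ipar_def)

lemma c_UU: "d_bracket (U a r) (U b s) = 0" "d_bracket (V a r) (V b s) = 0"
  by (auto simp: VU_def VV_def)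

lemma c_VU: assumes "1 \<le> r"
  shows "d_bracket (V a r) (U b s) = (if a = b \<and> r = s then sg (K r) else 0)"
  using assms by (auto simp: VU_def VV_def kap_def ipar_def sg_def)

lemma c_UV: assumes "1 \<le> r"
  shows "d_bracket (U a r) (V b s) = (if a = b \<and> r = s then - sg (K r \<noteq> P r) else 0)"
  using assms by (auto simp: VU_def VV_def kap_def ipar_def sg_def)

lemma range_le:
  fixes r k L M :: nat
  assumes "r \<in> {L+1..M-k}" shows "L < r" "r \<le> M" "L < r + k" "r + k \<le> M"
  using assms by auto

lemma sum_shift:
  fixes F :: "nat \<Rightarrow> 'b::comm_monoid_add"
  shows "(\<Sum>r\<in>{L+1..M-k}. \<Sum>s\<in>{L+1..M-k'}. if r + k = s then F r else 0) =
    (\<Sum>r\<in>{L+1..M-(k+k')}. F r)"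
proof -
  have "(\<Sum>r\<in>{L+1..M-k}. \<Sum>s\<in>{L+1..M-k'}. if r + k = s then F r else 0) =
      (\<Sum>r\<in>{L+1..M-k}. if r + k \<in> {L+1..M-k'} then F r else 0)"
    by (intro sum.cong refl) (auto simp: sum.delta')
  also have "\<dots> = sum F {r \<in> {L+1..M-k}. r + k \<in> {L+1..M-k'}}"
    by (rule sum.inter_filter[symmetric]) simp
  also have "{r \<in> {L+1..M-k}. r + k \<in> {L+1..M-k'}} = {L+1..M-(k+k')}" by auto
  finally show ?thesis .
qed

lemma sum_shift':
  fixes F :: "nat \<Rightarrow> 'b::comm_monoid_add"
  shows "(\<Sum>r\<in>{L+1..M-k}. \<Sum>s\<in>{L+1..M-k'}. if r = s + k' then F s else 0) =
    (\<Sum>r\<in>{L+1..M-(k+k')}. F r)"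
  using sum_shift[where L = L and M = M and k = k' and k' = k and F = F]
  by (subst sum.swap) (simp add: eq_commute add.commute)

lemma pb_phi_term:
  assumes "1 \<le> r" "1 \<le> s" "P (r + k) = P r" "P (s + k') = P s" "K r = K (r + k)"
  shows "pb (gen (U b r) * gen (V a (r + k))) (gen (U b' s) * gen (V a' (s + k'))) =
    (if a = b' \<and> r + k = s then sg (K r) * (gen (U b r) * gen (V a' (r + k + k'))) else 0) -
    (if b = a' \<and> r = s + k' then sg (K r) * (gen (U b' s) * gen (V a (s + k' + k))) else 0)"
  using assms
  by (cases "K (r+k)"; cases "P r"; cases "P s")
     (auto simp: pb_quad c_UU c_VU c_UV podd_UV mult.assoc)

lemma pb_varphi_term:
  assumes "1 \<le> i" "1 \<le> j" "1 \<le> i'" "1 \<le> j'"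
  shows "pb (gen (V (\<alpha> + k) i) * gen (U \<alpha> j)) (gen (V (\<beta> + k') i') * gen (U \<beta> j')) =
    (if j = i' then if \<alpha> = \<beta> + k' then
       - sg (K j \<noteq> P j) * (gen (V (\<beta> + k' + k) i) * gen (U \<beta> j')) else 0 else 0) +
    (if i = j' then if \<alpha> + k = \<beta> then
       sg ((((P i \<noteq> P j) \<and> P i') \<noteq> (P j \<and> P i)) \<noteq> K i) *
         (gen (V (\<alpha> + k + k') i') * gen (U \<alpha> j)) else 0 else 0)"
  unfolding pb_quad c_UU c_VU[OF assms(1)] c_UV[OF assms(2)]
    podd_UV[OF assms(1)] podd_UV[OF assms(2)] podd_UV[OF assms(3)] podd_UV[OF assms(4)]
  by (cases "K i"; cases "K j"; cases "P i"; cases "P j"; cases "P i'"; cases "P j'")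
     (auto simp: mult.assoc)

end

context
  fixes d p q m n d' p' q' m' n' :: nat and xi gam :: "nat \<Rightarrow> nat"
  assumes p: "(\<Sum>i=1..p'. gam i) = p" and q: "(\<Sum>i=1..q'. gam (p' + i)) = q"
    and m: "(\<Sum>i=1..m'. gam (p' + q' + i)) = m" and n: "(\<Sum>i=1..n'. gam (p' + q' + m' + i)) = n"
begin

lemma offset_mono: "i \<le> j \<Longrightarrow> offset g i \<le> offset g j"
  unfolding offset_def by (intro sum_mono2) auto

lemma offset_Suc: "1 \<le> i \<Longrightarrow> offset g (Suc i) = offset g i + g i"
  by (simp add: offset_def)

lemma offset_add: "offset g (u + v + 1) = offset g (u + 1) + (\<Sum>i=1..v. g (u + i))"
  by (induction v) (auto simp: offset_Suc)

lemma offsets: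
  "offset gam (p' + 1) = p" "offset gam (p' + q' + 1) = p + q"
  "offset gam (p' + q' + m' + 1) = p + q + m" "offset gam (p' + q' + m' + n' + 1) = p + q + m + n"
proof -
  show 1: "offset gam (p' + 1) = p"
    using p by (simp add: offset_def flip: atLeastLessThanSuc_atLeastAtMost)
  show 2: "offset gam (p' + q' + 1) = p + q"
    using offset_add[of gam p' q'] q 1 by simp
  show 3: "offset gam (p' + q' + m' + 1) = p + q + m"
    using offset_add[of gam "p' + q'" m'] m 2 by simp
  show "offset gam (p' + q' + m' + n' + 1) = p + q + m + n"
    using offset_add[of gam "p' + q' + m'" n'] n 3 by simp
qed

lemma block:
  assumes i: "i \<in> {1..p'+q'+m'+n'}" and r: "offset gam i < r" "r \<le> offset gam (i + 1)"
  shows "r \<le> p + q \<longleftrightarrow> i \<le> p' + q'"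
    and "ipar p q m r \<longleftrightarrow> \<not> (i \<le> p' \<or> p' + q' < i \<and> i \<le> p' + q' + m')"
    and "r \<in> {1..p+q+m+n}"
proof -
  have up: "offset gam (i + 1) \<le> offset gam (j + 1)" if "i \<le> j" for j
    using offset_mono[of "i + 1" "j + 1"] that by simp
  have lo: "offset gam (j + 1) \<le> offset gam i" if "\<not> i \<le> j" for j
    using offset_mono[of "j + 1" i] that by simp
  note o = up[of p'] up[of "p'+q'"] up[of "p'+q'+m'"] up[of "p'+q'+m'+n'"]
    lo[of p'] lo[of "p'+q'"] lo[of "p'+q'+m'"]
  note o' = o[unfolded offsets]
  show "r \<le> p + q \<longleftrightarrow> i \<le> p' + q'" using o' r by linarith
  show "ipar p q m r \<longleftrightarrow> \<not> (i \<le> p' \<or> p' + q' < i \<and> i \<le> p' + q' + m')"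
    unfolding ipar_def using o' r by auto
  show "r \<in> {1..p+q+m+n}" using o' r i by auto
qed

private abbreviation (input) "l \<equiv> p' + q' + m' + n'"
private abbreviation (input) "Phi \<equiv> phi_gen d p q m p' q' l gam"
private abbreviation (input) "UU \<equiv> VU p q m"
private abbreviation (input) "VVV \<equiv> VV p q m"
private abbreviation (input) "PP \<equiv> ipar p q m"

definition "phi_sum i k a b =
  (\<Sum>r\<in>{offset gam i + 1 .. offset gam (i + 1) - k}. gen (UU b r) * gen (VVV a (r + k)))"

definition "block_sign i \<longleftrightarrow> i \<le> p' + q' \<or> \<not> (i \<le> p' \<or> p' + q' < i \<and> i \<le> p' + q' + m')"

lemma phi_gen_eq:
  assumes "gl_range d l gam (Gl i k a b)"
  shows "Phi (Gl i k a b) = sg (block_sign i) * phi_sum i k a b"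
proof -
  have i: "i \<in> {1..l}" and k: "k < gam i" using assms by auto
  have off: "offset gam (i + 1) = offset gam i + gam i" using i by (simp add: offset_Suc)
  show ?thesis
  proof (cases "i \<le> p' + q'")
    case True
    have "dY p b r * dPY p a (r + k) = gen (UU b r) * gen (VVV a (r + k))"
      if "r \<in> {offset gam i + 1 .. offset gam (i + 1) - k}" for r
      using block(1)[OF i range_le(1,2)[OF that]] block(1)[OF i range_le(3,4)[OF that]] True
      by (auto simp: dY_def dPY_def VU_def VV_def)
    with True assms show ?thesis
      by (simp add: block_sign_def phi_sum_def)
  next
    case False
    have lo: "p + q \<le> offset gam i"
      using offset_mono[of "p' + q' + 1" i gam] False offsets(2) by simp
    have "(\<Sum>r\<in>{offset gam i + 1 .. offset gam (i + 1) - k}. gen (UU b r) * gen (VVV a (r + k))) =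
        (\<Sum>r\<in>{offset gam i + 1 - (p + q) .. offset gam (i + 1) - k - (p + q)}.
           gen (UU b (p + q + r)) * gen (VVV a (p + q + r + k)))"
      using lo k off
      by (intro sum.reindex_bij_witness[where i = "\<lambda>r. p + q + r" and j = "\<lambda>r. r - (p + q)"]) auto
    then have L: "sg (block_sign i) * phi_sum i k a b =
        (\<Sum>r\<in>{offset gam i + 1 - (p + q) .. offset gam (i + 1) - k - (p + q)}.
           sg (block_sign i) * (gen (UU b (p + q + r)) * gen (VVV a (p + q + r + k))))"
      by (simp add: phi_sum_def sum_distrib_left)
    have T: "sg (PP (p + q + r)) * (dPX m b r * dX m a (r + k)) =
        sg (block_sign i) * (gen (UU b (p + q + r)) * gen (VVV a (p + q + r + k)))"
      if "r \<in> {offset gam i + 1 - (p + q) .. offset gam (i + 1) - k - (p + q)}" for r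
    proof -
      have r: "offset gam i < p + q + r" "p + q + r + k \<le> offset gam (i + 1)"
        using that lo k off by auto
      have e: "PP (p + q + r) = block_sign i"
        using block(2)[OF i, of "p + q + r"] r False by (simp add: block_sign_def)
      have "0 < r" using block(1)[OF i, of "p + q + r"] r False by simp
      then show ?thesis unfolding e by (simp add: dPX_def dX_def VU_def VV_def)
    qed
    have "Phi (Gl i k a b) =
        (\<Sum>r\<in>{offset gam i + 1 - (p + q) .. offset gam (i + 1) - k - (p + q)}.
           sg (PP (p + q + r)) * (dPX m b r * dX m a (r + k)))"
      using False assms by simp
    also have "\<dots> = sg (block_sign i) * phi_sum i k a b"
      unfolding L by (rule sum.cong[OF refl T])
    finally show ?thesis .
  qed
qed

lemma phi_sum_homog: "i \<in> {1..l} \<Longrightarrow> phi_sum i k a b \<in> homog False"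
  unfolding phi_sum_def
proof (rule homog_sum)
  fix r assume i: "i \<in> {1..l}" and r: "r \<in> {offset gam i + 1 .. offset gam (i + 1) - k}"
  have "PP r = PP (r + k)"
    using block(2)[OF i range_le(1,2)[OF r]] block(2)[OF i range_le(3,4)[OF r]] by simp
  then show "gen (UU b r) * gen (VVV a (r + k)) \<in> homog False"
    using homog_mult[OF homog_gen homog_gen, of "UU b r" "VVV a (r + k)"] r by (simp add: podd_UV)
qed

lemma phi_gen_homog: "Phi x \<in> homog (podd x)"
proof (cases x)
  case (Gl i k a b)
  show ?thesis
  proof (cases "gl_range d l gam x")
    case True
    then show ?thesis
      using phi_sum_homog[of i k a b] unfolding Gl by (simp only: phi_gen_eq) (auto simp: homog_sg)
  next
    case False
    then show ?thesis by (simp add: Gl homog.zero del: gl_range.simps)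
  qed
qed

lemmas Phi = salg_hom[where f = Phi, OF phi_gen_homog]

lemma Phi_elem:
  assumes "i \<in> {1..l}" "a \<in> {1..d}" "b \<in> {1..d}"
  shows "salg_hom Phi (gl_elem gam i k a b) = sg (block_sign i) * phi_sum i k a b"
proof (cases "k < gam i")
  case True
  with assms show ?thesis
    by (simp add: gl_elem_def Phi(1) phi_gen_eq del: phi_gen.simps)
next
  case False
  then have "phi_sum i k a b = 0"
    using assms by (auto simp: phi_sum_def offset_Suc)
  with False show ?thesis using Phi(4)[of 0 0] by (simp add: gl_elem_def)
qed

lemma pb_phi_sum:
  assumes i: "i \<in> {1..l}"
  shows "pb (phi_sum i k a b) (phi_sum i k' a' b') =
    sg (\<not> block_sign i) * ((if a = b' then phi_sum i (k + k') a' b else 0) -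
      (if b = a' then phi_sum i (k + k') a b' else 0))"
proof -
  let ?R = "\<lambda>k. {offset gam i + 1 .. offset gam (i + 1) - k}"
  let ?T = "\<lambda>a b r k. gen (UU b r) * gen (VVV a (r + k))"
  have "pb (?T a b r k) (?T a' b' s k') =
      (if r + k = s then if a = b' then sg (\<not> block_sign i) * ?T a' b r (k + k') else 0 else 0) -
      (if r = s + k' then if b = a' then sg (\<not> block_sign i) * ?T a b' s (k + k') else 0 else 0)"
    if r: "r \<in> ?R k" and s: "s \<in> ?R k'" for r s
  proof -
    have kap: "kap p q m r = (\<not> block_sign i)" "kap p q m (r + k) = (\<not> block_sign i)"
      using block(1,2)[OF i range_le(1,2)[OF r]] block(1,2)[OF i range_le(3,4)[OF r]]
      by (auto simp: kap_def block_sign_def)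
    have par: "PP (r + k) = PP r" "PP (s + k') = PP s"
      using block(2)[OF i range_le(1,2)[OF r]] block(2)[OF i range_le(3,4)[OF r]]
        block(2)[OF i range_le(1,2)[OF s]] block(2)[OF i range_le(3,4)[OF s]] by simp_all
    have "1 \<le> r" "1 \<le> s" using r s by auto
    from pb_phi_term[where p = p and q = q and m = m, OF this par, of b a b' a'] show ?thesis
      unfolding kap add.commute[of k' k] add.assoc by simp
  qed
  then have "pb (phi_sum i k a b) (phi_sum i k' a' b') =
      (\<Sum>r\<in>?R k. \<Sum>s\<in>?R k'.
        (if r + k = s then if a = b' then sg (\<not> block_sign i) * ?T a' b r (k + k') else 0 else 0) -
        (if r = s + k' then if b = a' then sg (\<not> block_sign i) * ?T a b' s (k + k') else 0 else 0))"
    unfolding phi_sum_def pb_sum_left unfolding pb_sum_right by (intro sum.cong refl) auto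
  then show ?thesis
    unfolding sum_subtractf sum_shift sum_shift'
    by (simp add: phi_sum_def sum_distrib_left right_diff_distrib)
qed

lemma pb_phi_sum_disjoint:
  assumes i: "i \<in> {1..l}" and j: "j \<in> {1..l}" and ij: "i \<noteq> j"
  shows "pb (phi_sum i k a b) (phi_sum j k' a' b') = 0"
proof -
  let ?R = "\<lambda>i k. {offset gam i + 1 .. offset gam (i + 1) - k}"
  have "pb (gen (UU b r) * gen (VVV a (r + k))) (gen (UU b' s) * gen (VVV a' (s + k'))) = 0"
    if r: "r \<in> ?R i k" and s: "s \<in> ?R j k'" for r s
  proof -
    have dis: "u \<noteq> v" if "offset gam i < u" "u \<le> offset gam (i + 1)"
      "offset gam j < v" "v \<le> offset gam (j + 1)" for u v
    proof (cases "i < j")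
      case True
      then show ?thesis using offset_mono[of "i + 1" j gam] that by auto
    next
      case False
      then show ?thesis using offset_mono[of "j + 1" i gam] that ij by auto
    qed
    have "r + k \<noteq> s" "r \<noteq> s + k'"
      by (rule dis[OF range_le(3,4)[OF r] range_le(1,2)[OF s]],
          rule dis[OF range_le(1,2)[OF r] range_le(3,4)[OF s]])
    then show ?thesis using r s
      by (auto simp: pb_quad c_UU c_VU c_UV)
  qed
  then show ?thesis
    unfolding phi_sum_def pb_sum_left unfolding pb_sum_right by (intro sum.neutral ballI) auto
qed

lemma phi_poisson:
  "salg_hom Phi (poisson (gl_bracket d l gam) x y) =
   poisson d_bracket (salg_hom Phi x) (salg_hom Phi y)"
proof (rule salg_hom_poisson[OF gl_generator_bracket d_generator_bracket phi_gen_homog])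
  fix u v :: gl_label
  obtain i k a b where u: "u = Gl i k a b" by (cases u)
  obtain i' k' a' b' where v: "v = Gl i' k' a' b'" by (cases v)
  have Phi0: "salg_hom Phi 0 = 0" using Phi(4)[of 0 0] by simp
  have Phi_diff: "salg_hom Phi (x - y) = salg_hom Phi x - salg_hom Phi y" for x y
    using Phi(3)[of x "- y"] Phi(4)[of "-1" y] by simp
  show "poisson d_bracket (Phi u) (Phi v) = salg_hom Phi (gl_bracket d l gam u v)"
  proof (cases "gl_range d l gam u \<and> gl_range d l gam v")
    case False
    then have "Phi u = 0 \<or> Phi v = 0" by (auto simp: u v)
    with False show ?thesis by (auto simp: gl_bracket_def dpb.poisson_eq pb_0 Phi0)
  next
    case True
    then have R: "i \<in> {1..l}" "a \<in> {1..d}" "b \<in> {1..d}" "i' \<in> {1..l}" "a' \<in> {1..d}" "b' \<in> {1..d}"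
      by (auto simp: u v)
    have 1: "poisson d_bracket (Phi u) (Phi v) =
        sg (block_sign i') * (sg (block_sign i) * pb (phi_sum i k a b) (phi_sum i' k' a' b'))"
      using True unfolding u v by (simp only: phi_gen_eq dpb.poisson_eq pb_sg)
    show ?thesis
    proof (cases "i = i'")
      case False
      with True show ?thesis
        unfolding 1 by (simp add: pb_phi_sum_disjoint R Phi0 gl_bracket_def u v)
    next
      case eq: True
      have 2: "salg_hom Phi (gl_bracket d l gam u v) =
          (if b = a' then sg (block_sign i) * phi_sum i (k + k') a b' else 0) -
          (if a = b' then sg (block_sign i) * phi_sum i (k + k') a' b else 0)"
        using True R eq unfolding gl_bracket_def u v by (simp add: Phi_diff Phi0 Phi_elem)
      show ?thesis
        unfolding 1 2 eq[symmetric] pb_phi_sum[OF R(1)]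
        by (cases "block_sign i") auto
    qed
  qed
qed

lemma gaudin_phi_gen: "gaudin_phi d p q m p' q' l gam (gen x) = Phi x"
  by (simp add: gaudin_phi_def Phi(1))

lemma gaudin_phi_poisson_hom:
  "poisson_superalgebra_hom (gl_bracket d l gam) d_bracket (gaudin_phi d p q m p' q' l gam)"
  unfolding poisson_superalgebra_hom_def gaudin_phi_def
  by (intro conjI allI ballI; (rule Phi(2-5) phi_poisson | erule Phi(6)))

end

context
  fixes p q m n d' :: nat and xi :: "nat \<Rightarrow> nat"
begin

private abbreviation (input) "VPhi \<equiv> varphi_gen p q m n d' xi"
private abbreviation (input) "WU \<equiv> VU p q m"
private abbreviation (input) "WV \<equiv> VV p q m"
private abbreviation (input) "WP \<equiv> ipar p q m"
private abbreviation (input) "N \<equiv> p + q + m + n"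

definition "column_sign j \<longleftrightarrow> j \<le> p + q \<and> \<not> WP j"

definition "varphi_sum a k i j =
  (\<Sum>\<alpha>\<in>{offset xi a + 1 .. offset xi (a + 1) - k}. gen (WV (\<alpha> + k) i) * gen (WU \<alpha> j))"

lemma varphi_gen_eq:
  assumes "gls_range p q m n d' xi (Gls e a k i j)"
  shows "VPhi (Gls e a k i j) = sg (column_sign j) * varphi_sum a k i j"
proof -
  have "(if i \<le> p + q then
            if j \<le> p + q then sg (\<not> WP j) * (dPY p (\<alpha> + k) i * dY p \<alpha> j)
            else dPY p (\<alpha> + k) i * dPX m \<alpha> (j - (p + q))
          else
            if j \<le> p + q then sg (\<not> WP j) * (dX m (\<alpha> + k) (i - (p + q)) * dY p \<alpha> j)
            else dX m (\<alpha> + k) (i - (p + q)) * dPX m \<alpha> (j - (p + q))) =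
      sg (column_sign j) * (gen (WV (\<alpha> + k) i) * gen (WU \<alpha> j))" for \<alpha>
    by (simp add: column_sign_def VU_def VV_def dX_def dPX_def dY_def dPY_def)
  with assms show ?thesis by (simp add: varphi_sum_def sum_distrib_left)
qed

lemma varphi_sum_homog: "1 \<le> i \<Longrightarrow> 1 \<le> j \<Longrightarrow> varphi_sum a k i j \<in> homog (WP i \<noteq> WP j)"
  unfolding varphi_sum_def
  using homog_mult[OF homog_gen homog_gen, of "WV (x + k) i" "WU x j" for x]
  by (intro homog_sum) (simp add: podd_UV)

lemma varphi_gen_homog: "VPhi x \<in> homog (podd x)"
proof (cases x)
  case (Gls e a k i j)
  show ?thesis
  proof (cases "gls_range p q m n d' xi x")
    case True
    then have "1 \<le> i" "1 \<le> j" "e = (WP i \<noteq> WP j)" by (auto simp: Gls)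
    with True varphi_sum_homog[of i j a k] show ?thesis
      unfolding Gls by (simp only: varphi_gen_eq podd_gls_label.simps homog_sg)
  next
    case False
    then show ?thesis by (simp add: Gls homog.zero del: gls_range.simps)
  qed
qed

lemmas VPhi = salg_hom[where f = VPhi, OF varphi_gen_homog]

lemma VPhi_elem:
  assumes "a \<in> {1..d'}" "i \<in> {1..N}" "j \<in> {1..N}"
  shows "salg_hom VPhi (gls_elem p q m xi a k i j) = sg (column_sign j) * varphi_sum a k i j"
proof (cases "k < xi a")
  case True
  with assms have "gls_range p q m n d' xi (Gls (WP i \<noteq> WP j) a k i j)" by simp
  from varphi_gen_eq[OF this] True show ?thesis
    by (simp add: gls_elem_def VPhi(1) del: varphi_gen.simps)
next
  case False
  then have "varphi_sum a k i j = 0"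
    using assms by (auto simp: varphi_sum_def offset_def)
  with False show ?thesis using VPhi(4)[of 0 0] by (simp add: gls_elem_def)
qed

lemma pb_varphi_sum:
  assumes "1 \<le> i" "1 \<le> j" "1 \<le> i'" "1 \<le> j'"
  shows "pb (varphi_sum a k i j) (varphi_sum a k' i' j') =
    (if j = i' then sg (column_sign j) * varphi_sum a (k + k') i j' else 0) -
    (if i = j' then sg (((WP i \<noteq> WP j) \<and> (WP i' \<noteq> WP j')) \<noteq> column_sign i) * varphi_sum a (k + k') i' j else 0)"
proof -
  let ?R = "\<lambda>k. {offset xi a + 1 .. offset xi (a + 1) - k}"
  let ?T = "\<lambda>k i j \<alpha>. gen (WV (\<alpha> + k) i) * gen (WU \<alpha> j)"
  have th: "(- sg (kap p q m j \<noteq> WP j) :: d_label ssym) = sg (column_sign j)"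
    using assms by (cases "WP j") (auto simp: kap_def column_sign_def)
  have th': "(sg ((((WP i \<noteq> WP j) \<and> WP i') \<noteq> (WP j \<and> WP i)) \<noteq> kap p q m i) :: d_label ssym) =
      - sg (((WP i \<noteq> WP j) \<and> (WP i' \<noteq> WP i)) \<noteq> column_sign i)"
    using assms by (cases "WP i"; cases "WP j"; cases "WP i'") (auto simp: kap_def column_sign_def)
  have "pb (?T k i j \<alpha>) (?T k' i' j' \<beta>) =
      (if \<alpha> = \<beta> + k' then if j = i' then sg (column_sign j) * ?T (k + k') i j' \<beta> else 0 else 0) -
      (if \<alpha> + k = \<beta> then if i = j' then
         sg (((WP i \<noteq> WP j) \<and> (WP i' \<noteq> WP i)) \<noteq> column_sign i) * ?T (k + k') i' j \<alpha> else 0 else 0)" for \<alpha> \<beta>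
    unfolding pb_varphi_term[OF assms] th th' by (auto simp: add_ac)
  then have "pb (varphi_sum a k i j) (varphi_sum a k' i' j') =
      (\<Sum>\<alpha>\<in>?R k. \<Sum>\<beta>\<in>?R k'.
      (if \<alpha> = \<beta> + k' then if j = i' then sg (column_sign j) * ?T (k + k') i j' \<beta> else 0 else 0) -
      (if \<alpha> + k = \<beta> then if i = j' then
         sg (((WP i \<noteq> WP j) \<and> (WP i' \<noteq> WP i)) \<noteq> column_sign i) * ?T (k + k') i' j \<alpha> else 0 else 0))"
    unfolding varphi_sum_def pb_sum_left unfolding pb_sum_right by simp
  then show ?thesis
    unfolding sum_subtractf sum_shift sum_shift'
    by (simp add: varphi_sum_def sum_distrib_left)
qed

lemma pb_varphi_sum_disjoint:
  assumes "1 \<le> i" "1 \<le> j" "1 \<le> i'" "1 \<le> j'" "a \<noteq> a'"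
  shows "pb (varphi_sum a k i j) (varphi_sum a' k' i' j') = 0"
proof -
  have mono: "u \<le> v \<Longrightarrow> offset xi u \<le> offset xi v" for u v
    unfolding offset_def by (intro sum_mono2) auto
  let ?R = "\<lambda>a k. {offset xi a + 1 .. offset xi (a + 1) - k}"
  have "pb (gen (WV (\<alpha> + k) i) * gen (WU \<alpha> j)) (gen (WV (\<beta> + k') i') * gen (WU \<beta> j')) = 0"
    if r: "\<alpha> \<in> ?R a k" and s: "\<beta> \<in> ?R a' k'" for \<alpha> \<beta>
  proof -
    have dis: "u \<noteq> v" if "offset xi a < u" "u \<le> offset xi (a + 1)"
      "offset xi a' < v" "v \<le> offset xi (a' + 1)" for u v
    proof (cases "a < a'")
      case True
      then show ?thesis using mono[of "a + 1" a'] that by auto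
    next
      case False
      then show ?thesis using mono[of "a' + 1" a] that assms(5) by auto
    qed
    have "\<alpha> + k \<noteq> \<beta>" "\<alpha> \<noteq> \<beta> + k'"
      by (rule dis[OF range_le(3,4)[OF r] range_le(1,2)[OF s]],
          rule dis[OF range_le(1,2)[OF r] range_le(3,4)[OF s]])
    then show ?thesis unfolding pb_varphi_term[OF assms(1-4)] by simp
  qed
  then show ?thesis
    unfolding varphi_sum_def pb_sum_left unfolding pb_sum_right by (intro sum.neutral ballI) auto
qed

lemma varphi_poisson:
  "salg_hom VPhi (poisson (gls_bracket p q m n d' xi) x y) =
   poisson d_bracket (salg_hom VPhi x) (salg_hom VPhi y)"
proof (rule salg_hom_poisson[OF gls_generator_bracket d_generator_bracket varphi_gen_homog])
  fix u v :: gls_label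
  obtain e a k i j where u: "u = Gls e a k i j" by (cases u)
  obtain e' a' k' r s where v: "v = Gls e' a' k' r s" by (cases v)
  have VPhi0: "salg_hom VPhi 0 = 0" using VPhi(4)[of 0 0] by simp
  have VPhi_diff: "salg_hom VPhi (x - y) = salg_hom VPhi x - salg_hom VPhi y" for x y
    using VPhi(3)[of x "- y"] VPhi(4)[of "-1" y] by simp
  have VPhi_sg: "salg_hom VPhi (sg b * x) = sg b * salg_hom VPhi x" for b x
    using VPhi(4)[of "-1" x] by (cases b) simp_all
  show "poisson d_bracket (VPhi u) (VPhi v) = salg_hom VPhi (gls_bracket p q m n d' xi u v)"
  proof (cases "gls_range p q m n d' xi u \<and> gls_range p q m n d' xi v")
    case False
    then have "VPhi u = 0 \<or> VPhi v = 0" by (auto simp: u v)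
    with False show ?thesis by (auto simp: gls_bracket_def dpb.poisson_eq pb_0 VPhi0)
  next
    case True
    then have R: "a \<in> {1..d'}" "i \<in> {1..N}" "j \<in> {1..N}"
      "a' \<in> {1..d'}" "r \<in> {1..N}" "s \<in> {1..N}"
      by (auto simp: u v)
    then have R1: "1 \<le> i" "1 \<le> j" "1 \<le> r" "1 \<le> s" by auto
    have 1: "poisson d_bracket (VPhi u) (VPhi v) =
        sg (column_sign s) * (sg (column_sign j) * pb (varphi_sum a k i j) (varphi_sum a' k' r s))"
      using True unfolding u v by (simp only: varphi_gen_eq dpb.poisson_eq pb_sg)
    show ?thesis
    proof (cases "a = a'")
      case False
      with True show ?thesis
        unfolding 1 by (simp add: pb_varphi_sum_disjoint R1 VPhi0 gls_bracket_def u v)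
    next
      case eq: True
      have 2: "salg_hom VPhi (gls_bracket p q m n d' xi u v) =
          (if j = r then sg (column_sign s) * varphi_sum a (k + k') i s else 0) -
          sg ((WP i \<noteq> WP j) \<and> (WP r \<noteq> WP s)) *
            (if i = s then sg (column_sign j) * varphi_sum a (k + k') r j else 0)"
        using True R eq unfolding gls_bracket_def u v
        by (auto simp: VPhi_diff VPhi0 VPhi_sg VPhi_elem simp del: sg_sg)
      define X where "X \<longleftrightarrow> (WP i \<noteq> WP j) \<and> (WP r \<noteq> WP s)"
      show ?thesis
        unfolding 1 2 eq[symmetric] pb_varphi_sum[OF R1] X_def[symmetric]
        by (cases "j = r"; cases "i = s"; cases "column_sign j"; cases "column_sign s"; cases X) simp_all
    qed
  qed
qed

lemma gaudin_varphi_gen: "gaudin_varphi p q m n d' xi (gen x) = VPhi x"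
  by (simp add: gaudin_varphi_def VPhi(1))

lemma gaudin_varphi_poisson_hom:
  "poisson_superalgebra_hom (gls_bracket p q m n d' xi) d_bracket (gaudin_varphi p q m n d' xi)"
  unfolding poisson_superalgebra_hom_def gaudin_varphi_def
  by (intro conjI allI ballI; (rule VPhi(2-5) varphi_poisson | erule VPhi(6)))

end

end

theory Submission
  imports Defs
begin

text \<open>Let \<open>Z = z - J\<^sub>\<gamma>(z)\<close> and \<open>W = w - J\<^sub>\<xi>(w)\<close>. Up to a transposition, the images of the two Gaudin matrices
  are the two Schur complements \<open>Z - B W\<^sup>-\<^sup>1 C\<close> and \<open>W - C Z\<^sup>-\<^sup>1 B\<close> of one supermatrix whose off-diagonal blocks
  contain the generators of the Poisson superalgebra, so that
  \<open>Ber(Z - B W\<^sup>-\<^sup>1 C) det W = Ber Z det(W - C Z\<^sup>-\<^sup>1 B)\<close>.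
  Since \<open>Z\<close> is upper triangular, this can be shown one index at a time: the \<open>k\<close>-th factor of the Berezinian
  is \<open>Z\<^sub>k\<^sub>k (1 - b \<Gamma>\<^sup>-\<^sup>1 c)\<close>, where \<open>\<Gamma>\<close> is the second Schur complement for the first \<open>k - 1\<close> indices, and passing
  to \<open>k\<close> indices replaces \<open>\<Gamma>\<close> by \<open>\<Gamma> - c b\<close>. This multiplies \<open>det \<Gamma>\<close> by \<open>1 - b \<Gamma>\<^sup>-\<^sup>1 c\<close> if the index \<open>k\<close> is even, and by its
  inverse if it is odd in the sense of \<open>ipar\<close>, because \<open>b\<close> and \<open>c\<close> then have anticommuting entries.
  The factors \<open>det W\<close> and \<open>Ber Z\<close> are invertible series with scalar coefficients, hence the coefficients of
  either side generate the same algebra.\<close>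


section \<open>Berezinians and ring homomorphisms\<close>

text \<open>The ambient series ring is not commutative, while determinants exist only over
  commutative rings. Hence \<open>b\<close>, \<open>c\<close> and the Berezinian stay in the ambient
  ring, and whatever enters a determinant is even and is moved to a commutative type; the products
  \<open>c b\<close> are even whatever the parity of the index. The Berezinian is shown to be
  defined before any homomorphism is applied: there the matrix is \<open>z - K\<close> with
  \<open>K\<close> free of \<open>z\<close>, so its upper left blocks are inverted by geometric
  series in z^-1. Homomorphisms then transport these inverses. The transposition comes from
  \<open>phi\<close>: the image of \<open>e_ab\<close> consists of products of a generator with
  superscript \<open>b\<close> and one with superscript \<open>a\<close>, in this order. The two
  lists of generators omit some coefficients: that of w^d in the determinant, and those of powers of
  z above p + m - q - n in the Berezinian. A monic characteristic polynomial and an order bound in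
  z^-1 account for them.\<close>

lemma ring_inv_eq:
  fixes x :: "'a::ring_1"
  assumes "x * y = 1" "y * x = 1"
  shows "ring_inv x = y"
  unfolding ring_inv_def
proof (rule the_equality)
  fix y' assume "x * y' = 1 \<and> y' * x = 1"
  then have "y' = (y * x) * y'" using assms by simp
  also have "\<dots> = y * (x * y')" by (simp only: mult.assoc)
  finally show "y' = y" using \<open>x * y' = 1 \<and> y' * x = 1\<close> by simp
qed (use assms in simp)

lemma (in ring_hom) hom_ring_inv:
  assumes "x * y = 1" "y * x = 1"
  shows "hom (ring_inv x) = ring_inv (hom x)"
proof -
  have "hom x * hom y = 1" "hom y * hom x = 1"
    using assms by (metis hom_mult hom_one)+
  then show ?thesis using assms by (simp add: ring_inv_eq)
qed

lemma matrix_inv_eq: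
  fixes A :: "'a::ring_1 mat"
  assumes "A \<in> carrier_mat n n" "B \<in> carrier_mat n n" "A * B = 1\<^sub>m n" "B * A = 1\<^sub>m n"
  shows "matrix_inv A = B"
  unfolding matrix_inv_def
proof (rule the_equality)
  show "B \<in> carrier_mat (dim_row A) (dim_row A) \<and> inverts_mat A B \<and> inverts_mat B A"
    using assms by (auto simp: inverts_mat_def)
  fix B' assume *: "B' \<in> carrier_mat (dim_row A) (dim_row A) \<and> inverts_mat A B' \<and> inverts_mat B' A"
  then have B': "B' \<in> carrier_mat n n" "A * B' = 1\<^sub>m n" using assms by (auto simp: inverts_mat_def)
  have "B' = (B * A) * B'" using assms B' by simp
  also have "\<dots> = B * (A * B')" using assms B' by (intro assoc_mult_mat)
  finally show "B' = B" using assms B' by simp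
qed

text \<open>Outside this predicate the definite descriptions in \<open>ber_factor\<close> have junk values, which need not be
  preserved by homomorphisms.\<close>

definition berezinian_defined :: "'a::ring_1 mat \<Rightarrow> bool" where
  "berezinian_defined A \<longleftrightarrow> (\<forall>i\<in>{1..dim_row A}. \<exists>B x.
     B \<in> carrier_mat i i \<and> upper_left A i * B = 1\<^sub>m i \<and> B * upper_left A i = 1\<^sub>m i \<and>
     B $$ (i - 1, i - 1) * x = 1 \<and> x * B $$ (i - 1, i - 1) = 1)"

lemma upper_left_carrier: "upper_left A i \<in> carrier_mat i i"
  by (simp add: upper_left_def)

lemma ber_factor_eq:
  assumes "B \<in> carrier_mat i i" "upper_left A i * B = 1\<^sub>m i" "B * upper_left A i = 1\<^sub>m i"
    and "B $$ (i - 1, i - 1) * x = 1" "x * B $$ (i - 1, i - 1) = 1"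
  shows "ber_factor A i = x"
  unfolding ber_factor_def matrix_inv_eq[OF upper_left_carrier assms(1-3)]
  by (rule ring_inv_eq[OF assms(4,5)])

context ring_hom
begin

lemma map_mat_mult:
  assumes "A \<in> carrier_mat n m" "B \<in> carrier_mat m k"
  shows "map_mat hom (A * B) = map_mat hom A * map_mat hom B"
  using assms by (intro eq_matI) (auto simp: scalar_prod_def hom_sum hom_mult)

lemma map_mat_one: "map_mat hom (1\<^sub>m n) = 1\<^sub>m n"
  by (intro eq_matI) auto

lemma upper_left_map:
  "i \<le> dim_row A \<Longrightarrow> i \<le> dim_col A \<Longrightarrow> upper_left (map_mat hom A) i = map_mat hom (upper_left A i)"
  by (intro eq_matI) (auto simp: upper_left_def)

lemma map_upper_left_inverse:
  assumes "i \<le> dim_row A" "i \<le> dim_col A"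
    and "B \<in> carrier_mat i i" "upper_left A i * B = 1\<^sub>m i" "B * upper_left A i = 1\<^sub>m i"
  shows "upper_left (map_mat hom A) i * map_mat hom B = 1\<^sub>m i"
    and "map_mat hom B * upper_left (map_mat hom A) i = 1\<^sub>m i"
  using assms(3-5) map_mat_mult[OF upper_left_carrier, of B i i A] map_mat_mult[OF _ upper_left_carrier, of B i i A]
  by (simp_all add: upper_left_map[OF assms(1,2)] map_mat_one)

text \<open>The witnesses \<open>B\<close> and \<open>x\<close> determine both definite descriptions
  in a factor, and a ring homomorphism sends witnesses to witnesses. Both exponents are covered,
  since the inverse of \<open>x\<close> is the corner entry of \<open>B\<close>.\<close>

lemma hom_berezinian:
  assumes A: "A \<in> carrier_mat n n" and def: "berezinian_defined A"
  shows "hom (berezinian s A) = berezinian s (map_mat hom A)"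
proof -
  have *: "hom (ber_factor A i) = ber_factor (map_mat hom A) i \<and>
      hom (ring_inv (ber_factor A i)) = ring_inv (ber_factor (map_mat hom A) i)"
    if i: "i \<in> {1..n}" for i
  proof -
    from def i A obtain B x where B: "B \<in> carrier_mat i i" "upper_left A i * B = 1\<^sub>m i"
      "B * upper_left A i = 1\<^sub>m i" "B $$ (i - 1, i - 1) * x = 1" "x * B $$ (i - 1, i - 1) = 1"
      unfolding berezinian_defined_def by (metis carrier_matD(1))
    have dims: "i \<le> dim_row A" "i \<le> dim_col A" using A i by auto
    note u = map_upper_left_inverse[OF dims B(1-3)]
    have "map_mat hom B $$ (i - 1, i - 1) * hom x = 1" "hom x * map_mat hom B $$ (i - 1, i - 1) = 1"
      using B i by (auto simp flip: hom_mult)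
    with ber_factor_eq[OF _ u this] B(1) have 1: "ber_factor (map_mat hom A) i = hom x" by simp
    have 2: "ber_factor A i = x" by (rule ber_factor_eq[OF B])
    show ?thesis unfolding 1 2 using hom_ring_inv[OF B(5,4)] by simp
  qed
  show ?thesis
    unfolding berezinian_def hom_prod_list map_map using A
    by (intro arg_cong[of _ _ prod_list] map_cong) (auto simp: *)
qed

end

section \<open>Laurent series: coefficientwise maps, sign rule, geometric series\<close>

definition map_fls :: "('a::zero \<Rightarrow> 'b::zero) \<Rightarrow> 'a fls \<Rightarrow> 'b fls" where
  "map_fls h f = Abs_fls (\<lambda>n. h (fls_nth f n))"

text \<open>\<open>h 0 = 0\<close> keeps the coefficients zero below the subdegree of
  \<open>f\<close>, so \<open>Abs_fls\<close> receives an admissible function.\<close>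

lemma map_fls_nth [simp]: "h 0 = 0 \<Longrightarrow> fls_nth (map_fls h f) n = h (fls_nth f n)"
  unfolding map_fls_def
  by (rule nth_Abs_fls_lower_bound[of "fls_subdegree f"]) simp

text \<open>A coefficientwise homomorphism may raise the subdegree; the convolution is therefore
  wanted over a range given by arbitrary lower bounds, such as the subdegrees before the
  map.\<close>

lemma fls_times_nth_lower_bound:
  fixes f g :: "'a::semiring_0 fls"
  assumes "\<And>i. i < M \<Longrightarrow> fls_nth f i = 0" "\<And>i. i < N \<Longrightarrow> fls_nth g i = 0"
  shows "fls_nth (f * g) n = (\<Sum>i=M..n - N. fls_nth f i * fls_nth g (n - i))"
proof -
  have z: "fls_nth f i * fls_nth g (n - i) = 0" if "i < fls_subdegree f \<or> n - fls_subdegree g < i \<or> i < M \<or> n - N < i" for i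
    using that assms by (auto intro: fls_eq0_below_subdegree)
  let ?S = "{fls_subdegree f..n - fls_subdegree g} \<union> {M..n - N}"
  have "fls_nth (f * g) n = (\<Sum>i\<in>?S. fls_nth f i * fls_nth g (n - i))"
    unfolding fls_times_nth(2) by (intro sum.mono_neutral_left) (auto intro!: z)
  also have "\<dots> = (\<Sum>i=M..n - N. fls_nth f i * fls_nth g (n - i))"
    by (intro sum.mono_neutral_right) (auto intro!: z)
  finally show ?thesis .
qed

lemma map_fls_ring_hom:
  fixes h :: "'a::ring_1 \<Rightarrow> 'b::ring_1"
  assumes "Ring_Hom.ring_hom h"
  shows "Ring_Hom.ring_hom (map_fls h)"
proof -
  interpret ring_hom h by fact
  show ?thesis
  proof
    fix f g :: "'a fls"
    show "map_fls h (f + g) = map_fls h f + map_fls h g"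
      by (intro fls_eqI) (simp add: hom_add)
    show "map_fls h (f * g) = map_fls h f * map_fls h g"
    proof (intro fls_eqI)
      fix n
      have "fls_nth (map_fls h f * map_fls h g) n =
          (\<Sum>i=fls_subdegree f..n - fls_subdegree g. fls_nth (map_fls h f) i * fls_nth (map_fls h g) (n - i))"
        by (rule fls_times_nth_lower_bound) simp_all
      then show "fls_nth (map_fls h (f * g)) n = fls_nth (map_fls h f * map_fls h g) n"
        by (simp add: fls_times_nth(2)[of f g] hom_sum hom_mult)
    qed
  qed (auto intro!: fls_eqI simp: fls_one_nth)
qed

text \<open>The substitution i -> n - i reverses the convolution. Hypothesis and conclusion have the
  same shape, so the lemma can be applied once for each of the two variables.\<close>

lemma fls_mult_sign_commute:
  fixes f g :: "'a::ring_1 fls"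
  assumes "\<And>i j. fls_nth f i * fls_nth g j = sg b * (fls_nth g j * fls_nth f i)"
  shows "f * g = sg b * (g * f)"
proof (intro fls_eqI)
  fix n
  let ?l = "fls_subdegree f" and ?m = "fls_subdegree g"
  have "fls_nth (f * g) n = (\<Sum>i=?l..n - ?m. sg b * (fls_nth g (n - i) * fls_nth f i))"
    by (simp add: fls_times_nth(2) assms)
  also have "\<dots> = (\<Sum>i=?m..n - ?l. sg b * (fls_nth g i * fls_nth f (n - i)))"
    by (intro sum.reindex_bij_witness[where i = "\<lambda>i. n - i" and j = "\<lambda>i. n - i"]) auto
  also have "\<dots> = fls_nth (sg b * (g * f)) n"
    by (cases b) (simp_all add: fls_times_nth(2) sum_negf)
  finally show "fls_nth (f * g) n = fls_nth (sg b * (g * f)) n" .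
qed

text \<open>The expansion of 1/(z - a) in z^-1. Only powers of \<open>a\<close> occur in it, so it
  is a two-sided inverse over noncommutative coefficients as well.\<close>

definition fls_geom :: "'a::ring_1 \<Rightarrow> 'a fls" where
  "fls_geom a = Abs_fls (\<lambda>n. if n \<ge> 1 then a ^ nat (n - 1) else 0)"

lemma fls_geom_nth [simp]: "fls_nth (fls_geom a) n = (if n \<ge> 1 then a ^ nat (n - 1) else 0)"
  unfolding fls_geom_def by (rule nth_Abs_fls_lower_bound[of 1]) simp

lemma fls_geom_inverse:
  "(fls_X_inv - fls_const a) * fls_geom a = 1" "fls_geom a * (fls_X_inv - fls_const a) = 1"
proof -
  have nat_Suc_eq: "nat n = Suc (nat (n - 1))" if "1 \<le> n" for n using that by simp
  show "(fls_X_inv - fls_const a) * fls_geom a = 1"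
    by (rule fls_eqI) (auto simp: left_diff_distrib fls_X_inv_times_conv_shift nat_Suc_eq)
  show "fls_geom a * (fls_X_inv - fls_const a) = 1"
    by (rule fls_eqI) (auto simp: right_diff_distrib fls_X_inv_times_conv_shift nat_Suc_eq power_commutes)
qed

lemma ring_inv_linear_power: "ring_inv ((fls_X_inv - fls_const a) ^ k) = fls_geom a ^ k"
proof (rule ring_inv_eq)
  show "(fls_X_inv - fls_const a) ^ k * fls_geom a ^ k = 1"
    "fls_geom a ^ k * (fls_X_inv - fls_const a) ^ k = 1"
    by (rule left_right_inverse_power[OF fls_geom_inverse(1)], rule left_right_inverse_power[OF fls_geom_inverse(2)])
qed

lemma map_fls_geom:
  assumes "Ring_Hom.ring_hom h"
  shows "map_fls h (fls_geom a) = fls_geom (h a)"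
proof -
  interpret ring_hom h by fact
  show ?thesis by (intro fls_eqI) (simp add: hom_power)
qed

text \<open>The inverse of \<open>z - K\<close> is the geometric series in \<open>z\<^sup>-\<^sup>1\<close>, and the corner entry of each upper left
  inverse is \<open>z\<^sup>-\<^sup>1 (1 + O(z\<^sup>-\<^sup>1))\<close>.\<close>

lemma berezinian_defined_linear:
  fixes K :: "'a::ring_1 mat"
  assumes K: "K \<in> carrier_mat n n"
    and A: "A = mat n n (\<lambda>(i, j). (if i = j then fls_X_inv else 0) - fls_const (K $$ (i, j)))"
  shows "berezinian_defined A"
  unfolding berezinian_defined_def
proof
  fix i assume "i \<in> {1..dim_row A}"
  then have i: "1 \<le> i" "i \<le> n" by (auto simp: A)
  define L where "L = mat i i (\<lambda>(r, c). K $$ (r, c))"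
  have L: "L \<in> carrier_mat i i" by (simp add: L_def)
  define B where "B = mat i i (\<lambda>(r, c). Abs_fls (\<lambda>k. if k \<ge> 1 then (L ^\<^sub>m nat (k - 1)) $$ (r, c) else 0))"
  have B_nth: "fls_nth (B $$ (r, c)) k = (if k \<ge> 1 then (L ^\<^sub>m nat (k - 1)) $$ (r, c) else 0)"
    if "r < i" "c < i" for r c k
    using that by (simp add: B_def)
  have B: "B \<in> carrier_mat i i" by (simp add: B_def)
  have Lp: "L ^\<^sub>m k \<in> carrier_mat i i" for k using L by simp
  have U: "upper_left A i = mat i i (\<lambda>(r, c). (if r = c then fls_X_inv else 0) - fls_const (L $$ (r, c)))"
    using i by (intro eq_matI) (auto simp: upper_left_def A L_def)
  \<comment> \<open>\<open>pow_mat\<close> puts the new factor on the right; the product of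
    \<open>z - L\<close> with \<open>B\<close> needs it on the left.\<close>
  have LB: "L * L ^\<^sub>m k = L ^\<^sub>m Suc k" for k
    using L by (induction k) (simp_all flip: assoc_mult_mat[OF L Lp L])
  have nat_Suc_eq: "nat n = Suc (nat (n - 1))" if "1 \<le> n" for n using that by simp
  have L0: "(L ^\<^sub>m 0) $$ (r, c) = (if r = c then 1 else 0)" if "r < i" "c < i" for r c
    using L that by simp
  have 1: "(\<Sum>t<i. L $$ (r, t) * (L ^\<^sub>m k) $$ (t, c)) = (L ^\<^sub>m Suc k) $$ (r, c)"
    if "r < i" "c < i" for r c k
    unfolding LB[symmetric] using that L Lp[of k]
    by (auto simp: scalar_prod_def lessThan_atLeast0 intro!: sum.cong)
  have 2: "(\<Sum>t<i. (L ^\<^sub>m k) $$ (r, t) * L $$ (t, c)) = (L ^\<^sub>m Suc k) $$ (r, c)"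
    if "r < i" "c < i" for r c k
    using that L Lp[of k] by (auto simp: scalar_prod_def lessThan_atLeast0 intro!: sum.cong)
  have *: "fls_X_inv * B $$ (r, c) - (\<Sum>t<i. fls_const (L $$ (r, t)) * B $$ (t, c)) = (if r = c then 1 else 0)"
    "B $$ (r, c) * fls_X_inv - (\<Sum>t<i. B $$ (r, t) * fls_const (L $$ (t, c))) = (if r = c then 1 else 0)"
    if rc: "r < i" "c < i" for r c
  proof -
    show "fls_X_inv * B $$ (r, c) - (\<Sum>t<i. fls_const (L $$ (r, t)) * B $$ (t, c)) = (if r = c then 1 else 0)"
      using rc by (intro fls_eqI)
        (auto simp: fls_X_inv_times_conv_shift B_nth fls_nth_sum nat_Suc_eq 1 L0 not_le simp del: pow_mat.simps)
    show "B $$ (r, c) * fls_X_inv - (\<Sum>t<i. B $$ (r, t) * fls_const (L $$ (t, c))) = (if r = c then 1 else 0)"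
      using rc by (intro fls_eqI)
        (auto simp: fls_X_inv_times_conv_shift B_nth fls_nth_sum nat_Suc_eq 2 L0 not_le simp del: pow_mat.simps)
  qed
  have UB: "upper_left A i * B = 1\<^sub>m i"
  proof (rule eq_matI)
    fix r c assume "r < dim_row (1\<^sub>m i :: 'a fls mat)" "c < dim_col (1\<^sub>m i :: 'a fls mat)"
    then have rc: "r < i" "c < i" by auto
    have "(upper_left A i * B) $$ (r, c) =
        (\<Sum>t<i. (if r = t then fls_X_inv * B $$ (t, c) else 0) - fls_const (L $$ (r, t)) * B $$ (t, c))"
      using rc B by (auto simp: scalar_prod_def U left_diff_distrib lessThan_atLeast0 intro!: sum.cong)
    then show "(upper_left A i * B) $$ (r, c) = 1\<^sub>m i $$ (r, c)"
      using rc *(1) by (simp add: sum_subtractf)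
  qed (use B in \<open>simp_all add: U\<close>)
  have BU: "B * upper_left A i = 1\<^sub>m i"
  proof (rule eq_matI)
    fix r c assume "r < dim_row (1\<^sub>m i :: 'a fls mat)" "c < dim_col (1\<^sub>m i :: 'a fls mat)"
    then have rc: "r < i" "c < i" by auto
    have "(B * upper_left A i) $$ (r, c) =
        (\<Sum>t<i. (if t = c then B $$ (r, t) * fls_X_inv else 0) - B $$ (r, t) * fls_const (L $$ (t, c)))"
      using rc B by (auto simp: scalar_prod_def U right_diff_distrib lessThan_atLeast0 intro!: sum.cong)
    then show "(B * upper_left A i) $$ (r, c) = 1\<^sub>m i $$ (r, c)"
      using rc *(2) by (simp add: sum_subtractf)
  qed (use B in \<open>simp_all add: U\<close>)
  let ?f = "B $$ (i - 1, i - 1)"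
  have f: "fls_nth ?f k = 0" if "k < 1" for k using that i by (simp add: B_nth)
  have f1: "fls_nth ?f 1 = 1" using i L0[of "i - 1" "i - 1"] by (simp add: B_nth)
  have "fls_subdegree ?f = 1" by (rule fls_subdegree_eqI) (use f f1 in auto)
  with f1 have "1 * fls_nth ?f (fls_subdegree ?f) = 1" "fls_nth ?f (fls_subdegree ?f) * 1 = 1" by simp_all
  note inv = fls_right_inverse[OF this(2)] fls_left_inverse'[OF this]
  show "\<exists>B x.
     B \<in> carrier_mat i i \<and> upper_left A i * B = 1\<^sub>m i \<and> B * upper_left A i = 1\<^sub>m i \<and>
     B $$ (i - 1, i - 1) * x = 1 \<and> x * B $$ (i - 1, i - 1) = 1"
    using B UB BU inv by blast
qed


section \<open>Rank one perturbations and Schur complements\<close>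

lemma det_four_block_mat_lower_left_zero_row:
  fixes A :: "'a::comm_ring_1 mat"
  assumes "A \<in> carrier_mat n n" "B \<in> carrier_mat n 1" "D \<in> carrier_mat 1 1"
  shows "det (four_block_mat A B (0\<^sub>m 1 n) D) = det A * det D"
proof -
  have "det (four_block_mat A B (0\<^sub>m 1 n) D) = det ((four_block_mat A B (0\<^sub>m 1 n) D)\<^sup>T)"
    by (rule det_transpose[OF four_block_carrier_mat[OF assms(1,3)], symmetric])
  also have "(four_block_mat A B (0\<^sub>m 1 n) D)\<^sup>T = four_block_mat A\<^sup>T (0\<^sub>m n 1) B\<^sup>T D\<^sup>T"
    using assms by (subst transpose_four_block_mat[of _ n n _ 1 _ 1]) auto
  also have "det \<dots> = det A\<^sup>T * det D\<^sup>T"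
    using assms by (intro det_four_block_mat_upper_right_zero_col[of _ n]) auto
  also have "\<dots> = det A * det D"
    using assms by (simp add: det_transpose[of _ n] det_transpose[of _ 1])
  finally show ?thesis .
qed

text \<open>The bordered matrix with block rows \<open>(1, c)\<close> and \<open>(b, 1)\<close>
  equals both \<open>?U * ?L\<close> and \<open>?L * ?V\<close>. Comparing determinants gives the
  formula without any inverse.\<close>

lemma det_one_minus_rank_one:
  fixes b c :: "nat \<Rightarrow> 'a::comm_ring_1"
  shows "det (mat n n (\<lambda>(i, j). (if i = j then 1 else 0) - c i * b j)) = 1 - (\<Sum>i<n. b i * c i)"
proof -
  let ?P = "mat n n (\<lambda>(i, j). (if i = j then 1 else 0) - c i * b j)"
  let ?c = "mat n 1 (\<lambda>(i, j). c i)" and ?b = "mat 1 n (\<lambda>(i, j). b j)"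
  let ?t = "mat 1 1 (\<lambda>_. 1 - (\<Sum>i<n. b i * c i))"
  let ?L = "four_block_mat (1\<^sub>m n) (0\<^sub>m n 1) ?b (1\<^sub>m 1)"
  let ?U = "four_block_mat ?P ?c (0\<^sub>m 1 n) (1\<^sub>m 1)"
  let ?V = "four_block_mat (1\<^sub>m n) ?c (0\<^sub>m 1 n) ?t"
  have "?U * ?L = four_block_mat (1\<^sub>m n) ?c ?b (1\<^sub>m 1)"
    by (subst mult_four_block_mat[of _ n n _ 1 _ 1])
      (auto intro!: cong_four_block_mat eq_matI simp: scalar_prod_def)
  moreover have "?L * ?V = four_block_mat (1\<^sub>m n) ?c ?b (1\<^sub>m 1)"
    by (subst mult_four_block_mat[of _ n n _ 1 _ 1])
      (auto intro!: cong_four_block_mat eq_matI simp: scalar_prod_def lessThan_atLeast0)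
  ultimately have "det (?U * ?L) = det (?L * ?V)" by simp
  moreover have "det ?L = 1"
    by (subst det_four_block_mat_upper_right_zero_col[of _ n]) auto
  moreover have "det ?U = det ?P"
    by (subst det_four_block_mat_lower_left_zero_row) auto
  moreover have "det ?V = 1 - (\<Sum>i<n. b i * c i)"
    by (subst det_four_block_mat_lower_left_zero_row) (auto simp: det_single)
  moreover have "det (?U * ?L) = det ?U * det ?L" "det (?L * ?V) = det ?L * det ?V"
    by (rule det_mult[of _ "n + 1"]; rule four_block_carrier_mat; simp)+
  ultimately show ?thesis by simp
qed

text \<open>The hypothesis holds for \<open>X = c b\<close> with a column \<open>c\<close> and a row \<open>b\<close> of odd elements, and
  \<open>b c = - tr X\<close>.\<close>

lemma det_one_minus_odd_rank_one:
  fixes X :: "nat \<Rightarrow> nat \<Rightarrow> 'a::comm_ring_1"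
  assumes "\<And>i j k l. i < n \<Longrightarrow> j < n \<Longrightarrow> k < n \<Longrightarrow> l < n \<Longrightarrow> X i j * X k l = - (X i l * X k j)"
    and "\<And>i. i < n \<Longrightarrow> X i i * X i i = 0"
  shows "det (mat n n (\<lambda>(i, j). (if i = j then 1 else 0) - X i j)) * (1 + (\<Sum>i<n. X i i)) = 1"
  using assms
proof (induction n arbitrary: X)
  case 0
  then show ?case by simp
next
  case (Suc n)
  let ?t = "X n n"
  \<comment> \<open>Schur complement of the last diagonal entry \<open>1 - ?t\<close>, whose inverse
    is \<open>1 + ?t\<close> because \<open>?t * ?t = 0\<close>: since
    \<open>X i n * X n j = - (?t * X i j)\<close>, the entry
    \<open>X i j + X i n * (1 + ?t) * X n j\<close> becomes \<open>(1 - ?t) * X i j\<close>.\<close>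
  let ?Y = "\<lambda>i j. (1 - ?t) * X i j"
  let ?M = "mat (Suc n) (Suc n) (\<lambda>(i, j). (if i = j then 1 else 0) - X i j)"
  let ?P = "mat n n (\<lambda>(i, j). (if i = j then 1 else 0) - ?Y i j)"
  let ?x = "mat n 1 (\<lambda>(i, j). - X i n)" and ?y = "mat 1 n (\<lambda>(i, j). - (1 + ?t) * X n j)"
  let ?T = "mat 1 1 (\<lambda>_. 1 - ?t)"
  let ?U = "four_block_mat ?P ?x (0\<^sub>m 1 n) ?T"
  let ?L = "four_block_mat (1\<^sub>m n) (0\<^sub>m n 1) ?y (1\<^sub>m 1)"
  have tt: "?t * ?t = 0" using Suc.prems(2)[of n] by simp
  have tt': "?t * (?t * u) = 0" for u using tt by (metis mult.assoc mult_zero_left)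
  have xy: "X i n * X n j = - (?t * X i j)" if "i < n" "j < n" for i j
    using Suc.prems(1)[of i n n j] that by (simp add: mult.commute)
  have "?Y i j * ?Y k l = - (?Y i l * ?Y k j)" if "i < n" "j < n" "k < n" "l < n" for i j k l
  proof -
    have "?Y i j * ?Y k l = (1 - ?t) * (1 - ?t) * (X i j * X k l)" by (simp add: algebra_simps)
    also have "\<dots> = - ((1 - ?t) * (1 - ?t) * (X i l * X k j))"
      using Suc.prems(1)[of i j k l] that by simp
    finally show ?thesis by (simp add: algebra_simps)
  qed
  moreover have "?Y i i * ?Y i i = 0" if "i < n" for i
  proof -
    have "?Y i i * ?Y i i = (1 - ?t) * (1 - ?t) * (X i i * X i i)" by (simp add: algebra_simps)
    then show ?thesis using Suc.prems(2)[of i] that by simp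
  qed
  ultimately have IH: "det ?P * (1 + (\<Sum>i<n. ?Y i i)) = 1" by (rule Suc.IH)
  have "?U * ?L = four_block_mat
     (mat n n (\<lambda>(i, j). (if i = j then 1 else 0) - X i j)) ?x (mat 1 n (\<lambda>(i, j). - X n j)) ?T"
  proof (subst mult_four_block_mat[of _ n n _ 1 _ 1 _ _ n _ 1]; (simp; fail)?)
    have "X i n * ((1 + ?t) * X n j) = - (?t * X i j)" if "i < n" "j < n" for i j
    proof -
      have "X i n * ((1 + ?t) * X n j) = (1 + ?t) * (X i n * X n j)" by (simp only: ac_simps)
      also have "\<dots> = - (?t * X i j) - ?t * (?t * X i j)"
        unfolding xy[OF that] by (simp add: algebra_simps)
      finally show ?thesis by (simp add: tt')
    qed
    then have 1: "?P * 1\<^sub>m n + ?x * ?y = mat n n (\<lambda>(i, j). (if i = j then 1 else 0) - X i j)"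
      by (intro eq_matI) (auto simp: scalar_prod_def algebra_simps)
    have 2: "0\<^sub>m 1 n * 1\<^sub>m n + ?T * ?y = mat 1 n (\<lambda>(i, j). - X n j)"
      by (intro eq_matI) (auto simp: scalar_prod_def algebra_simps tt tt')
    show "four_block_mat (?P * 1\<^sub>m n + ?x * ?y) (?P * 0\<^sub>m n 1 + ?x * 1\<^sub>m 1)
       (0\<^sub>m 1 n * 1\<^sub>m n + ?T * ?y) (0\<^sub>m 1 n * 0\<^sub>m n 1 + ?T * 1\<^sub>m 1) =
      four_block_mat (mat n n (\<lambda>(i, j). (if i = j then 1 else 0) - X i j)) ?x (mat 1 n (\<lambda>(i, j). - X n j)) ?T"
      unfolding 1 2 by (intro cong_four_block_mat refl) (auto intro!: eq_matI)
  qed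
  also have "\<dots> = ?M"
    by (intro eq_matI) (auto simp: less_Suc_eq)
  finally have "det ?M = det (?U * ?L)" by simp
  also have "\<dots> = det ?U * det ?L"
    by (rule det_mult[of _ "n + 1"]; rule four_block_carrier_mat; simp)
  also have "det ?L = 1"
    by (subst det_four_block_mat_upper_right_zero_col[of _ n]) auto
  also have "det ?U = det ?P * (1 - ?t)"
    by (subst det_four_block_mat_lower_left_zero_row) (auto simp: det_single)
  finally have M: "det ?M = det ?P * (1 - ?t)" by simp
  have "(1 - ?t) * (1 + (\<Sum>i<Suc n. X i i)) = 1 + (\<Sum>i<n. ?Y i i)"
    unfolding sum_distrib_left[symmetric] by (simp add: algebra_simps tt)
  with IH show ?case unfolding M mult.assoc by simp
qed


text \<open>A column \<open>x\<close> with \<open>H x = e\<^sub>r\<close> solves \<open>\<Gamma> u = c (1 + b u)\<close> for \<open>u = W\<^sup>-\<^sup>1 C x\<close>, where \<open>c\<close> and \<open>b\<close> are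
  the last column and row of \<open>C Z\<^sup>-\<^sup>1\<close> and \<open>B\<close>.\<close>

lemma schur_complement_corner:
  fixes Z :: "'a::ring_1 mat"
  assumes Z: "Z \<in> carrier_mat k k" and Zi: "Zi \<in> carrier_mat k k" and W: "W \<in> carrier_mat d d"
    and Wi: "Wi \<in> carrier_mat d d" and B: "B \<in> carrier_mat k d" and C: "C \<in> carrier_mat d k"
    and X: "X \<in> carrier_mat k k" and G: "G \<in> carrier_mat d d" and Gi: "Gi \<in> carrier_mat d d"
    and ZiZ: "Zi * Z = 1\<^sub>m k" and WWi: "W * Wi = 1\<^sub>m d"
    and HX: "(Z - B * Wi * C) * X = 1\<^sub>m k" and GiG: "Gi * G = 1\<^sub>m d"
    and r: "r < k" and row: "\<And>j. j < k \<Longrightarrow> j \<noteq> r \<Longrightarrow> Zi $$ (r, j) = 0"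
    and z: "z * Zi $$ (r, r) = 1"
    and c: "\<And>i. i < d \<Longrightarrow> c i = (\<Sum>j<k. C $$ (i, j) * Zi $$ (j, r))"
    and G_eq: "\<And>i j. i < d \<Longrightarrow> j < d \<Longrightarrow>
      G $$ (i, j) = (W - C * Zi * B) $$ (i, j) + c i * B $$ (r, j)"
  shows "(1 - (\<Sum>i<d. \<Sum>j<d. B $$ (r, i) * Gi $$ (i, j) * c j)) * (z * X $$ (r, r)) = 1"
proof -
  define U where "U = Wi * (C * X)"
  have U: "U \<in> carrier_mat d k" using Wi C X by (auto simp: U_def)
  have WU: "W * U = C * X"
    using assoc_mult_mat[OF W Wi mult_carrier_mat[OF C X]] WWi C X by (simp add: U_def)
  have "(Z - B * Wi * C) * X = Z * X - B * U"
  proof -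
    have BWi: "B * Wi \<in> carrier_mat k d" using B Wi by simp
    have "B * Wi * C * X = B * U"
      unfolding U_def assoc_mult_mat[OF BWi C X]
      by (rule assoc_mult_mat[OF B Wi mult_carrier_mat[OF C X]])
    then show ?thesis
      using minus_mult_distrib_mat[OF Z mult_carrier_mat[OF BWi C] X] by simp
  qed
  with HX have *: "Z * X - B * U = 1\<^sub>m k" by simp
  have ZX: "Z * X = 1\<^sub>m k + B * U"
  proof (rule eq_matI)
    fix i j assume "i < dim_row (1\<^sub>m k + B * U)" "j < dim_col (1\<^sub>m k + B * U)"
    then have ij: "i < k" "j < k" using B U by auto
    have "(Z * X - B * U) $$ (i, j) = (Z * X) $$ (i, j) - (B * U) $$ (i, j)"
      by (rule index_minus_mat) (use ij B U in auto)
    moreover have "(1\<^sub>m k + B * U) $$ (i, j) = 1\<^sub>m k $$ (i, j) + (B * U) $$ (i, j)"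
      by (rule index_add_mat) (use ij B U in auto)
    ultimately show "(Z * X) $$ (i, j) = (1\<^sub>m k + B * U) $$ (i, j)"
      unfolding * by simp
  qed (use Z X B U in auto)
  have BU: "B * U \<in> carrier_mat k k" using B U by simp
  have "X = Zi * Z * X" using ZiZ X by simp
  also have "\<dots> = Zi * (1\<^sub>m k + B * U)"
    unfolding assoc_mult_mat[OF Zi Z X] ZX ..
  finally have X_eq: "X = Zi * (1\<^sub>m k + B * U)" .
  define s where "s = (B * U) $$ (r, r)"
  have s_eq: "s = (\<Sum>i<d. B $$ (r, i) * U $$ (i, r))"
    using r B U by (simp add: s_def scalar_prod_def lessThan_atLeast0)
  have "X $$ (r, r) = (\<Sum>j<k. Zi $$ (r, j) * (1\<^sub>m k + B * U) $$ (j, r))"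
    using r Zi B U by (subst X_eq) (simp add: scalar_prod_def lessThan_atLeast0)
  \<comment> \<open>Row \<open>r\<close> of \<open>Zi\<close> vanishes off the diagonal, so one term
    survives.\<close>
  also have "\<dots> = (\<Sum>j<k. if j = r then Zi $$ (r, r) * (1 + s) else 0)"
    using r row B U by (intro sum.cong) (auto simp: s_def)
  finally have X_rr: "X $$ (r, r) = Zi $$ (r, r) * (1 + s)" using r by simp
  have CZi: "C * Zi \<in> carrier_mat d k" using C Zi by simp
  define Q where "Q = C * Zi * B"
  have CZiB: "Q \<in> carrier_mat d d" using CZi B by (simp add: Q_def)
  have G_eq': "G $$ (i, j) = (W - Q) $$ (i, j) + c i * B $$ (r, j)" if "i < d" "j < d" for i j
    unfolding Q_def by (rule G_eq[OF that])
  have "W * U = C * Zi * (1\<^sub>m k + B * U)"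
    unfolding WU using assoc_mult_mat[OF C Zi, of "1\<^sub>m k + B * U" k] BU X_eq by simp
  also have "\<dots> = C * Zi + Q * U"
    unfolding mult_add_distrib_mat[OF CZi one_carrier_mat BU] right_mult_one_mat[OF CZi] assoc_mult_mat[OF CZi B U] Q_def ..
  finally have WU': "W * U = C * Zi + Q * U" .
  have GU: "(G * U) $$ (i, r) = c i * (1 + s)" if i: "i < d" for i
  proof -
    have "(G * U) $$ (i, r) = (\<Sum>j<d. ((W - Q) $$ (i, j) + c i * B $$ (r, j)) * U $$ (j, r))"
      using i r G U by (auto simp: scalar_prod_def lessThan_atLeast0 G_eq' intro!: sum.cong)
    also have "\<dots> = (\<Sum>j<d. (W $$ (i, j) - (Q) $$ (i, j) + c i * B $$ (r, j)) * U $$ (j, r))"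
    proof (intro sum.cong refl)
      fix j assume "j \<in> {..<d}"
      then have "(W - Q) $$ (i, j) = W $$ (i, j) - (Q) $$ (i, j)"
        by (intro index_minus_mat) (use i CZiB in auto)
      then show "((W - Q) $$ (i, j) + c i * B $$ (r, j)) * U $$ (j, r) =
          (W $$ (i, j) - (Q) $$ (i, j) + c i * B $$ (r, j)) * U $$ (j, r)" by simp
    qed
    also have "\<dots> = (\<Sum>j<d. W $$ (i, j) * U $$ (j, r)) - (\<Sum>j<d. (Q) $$ (i, j) * U $$ (j, r)) +
        c i * s"
      by (simp add: s_eq distrib_right left_diff_distrib mult.assoc sum.distrib sum_subtractf sum_distrib_left
          del: index_mult_mat)
    also have "(\<Sum>j<d. W $$ (i, j) * U $$ (j, r)) = (W * U) $$ (i, r)"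
      using i r W U by (simp add: scalar_prod_def lessThan_atLeast0)
    also have "(\<Sum>j<d. (Q) $$ (i, j) * U $$ (j, r)) = (Q * U) $$ (i, r)"
      using i r CZiB U by (subst index_mult_mat) (auto simp: scalar_prod_def lessThan_atLeast0 intro!: sum.cong)
    also have "(W * U) $$ (i, r) = (C * Zi) $$ (i, r) + (Q * U) $$ (i, r)"
      unfolding WU' by (rule index_add_mat) (use i r CZiB U in auto)
    also have "(C * Zi) $$ (i, r) = c i"
      using i r C Zi c by (simp add: scalar_prod_def lessThan_atLeast0)
    finally show ?thesis by (simp add: algebra_simps)
  qed
  have U_ir: "U $$ (i, r) = (\<Sum>j<d. Gi $$ (i, j) * c j * (1 + s))" if i: "i < d" for i
  proof -
    have "U = Gi * (G * U)" using GiG U assoc_mult_mat[OF Gi G U] by simp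
    then have "U $$ (i, r) = (Gi * (G * U)) $$ (i, r)" by simp
    also have "\<dots> = (\<Sum>j<d. Gi $$ (i, j) * (G * U) $$ (j, r))"
      using i r Gi G U by (subst index_mult_mat) (auto simp: scalar_prod_def lessThan_atLeast0 intro!: sum.cong)
    finally show ?thesis by (simp add: GU mult.assoc)
  qed
  define q where "q = (\<Sum>i<d. \<Sum>j<d. B $$ (r, i) * Gi $$ (i, j) * c j)"
  \<comment> \<open>\<open>s\<close> is the scalar \<open>b u\<close>: multiplying u = Gamma^-1 c (1
    + b u) by the row \<open>b\<close> gives this equation, and \<open>(1 - q) * (1 + s) = 1\<close>
    follows without commutativity.\<close>
  have "s = q * (1 + s)"
    unfolding q_def by (subst s_eq) (simp add: U_ir sum_distrib_left sum_distrib_right mult.assoc)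
  then have "(1 - q) * (1 + s) = 1"
    by (simp add: left_diff_distrib)
  moreover have "z * X $$ (r, r) = 1 + s"
    unfolding X_rr using z by (metis mult.assoc mult_1)
  ultimately show ?thesis unfolding q_def by simp
qed


section \<open>Homogeneous double Laurent series\<close>

definition series_homog :: "bool \<Rightarrow> 'g::parity ssym fls fls set" where
  "series_homog e = {f. \<forall>i j. fls_nth (fls_nth f i) j \<in> homog e}"

lemma series_homogI: "(\<And>i j. fls_nth (fls_nth f i) j \<in> homog e) \<Longrightarrow> f \<in> series_homog e"
  by (simp add: series_homog_def)

lemma series_homogD: "f \<in> series_homog e \<Longrightarrow> fls_nth (fls_nth f i) j \<in> homog e"
  by (simp add: series_homog_def)

lemma series_homog_0: "0 \<in> series_homog e"
  by (simp add: series_homog_def homog.zero)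

lemma series_homog_add: "f \<in> series_homog e \<Longrightarrow> g \<in> series_homog e \<Longrightarrow> f + g \<in> series_homog e"
  by (auto intro!: series_homogI homog_add dest: series_homogD)

lemma series_homog_uminus: "f \<in> series_homog e \<Longrightarrow> - f \<in> series_homog e"
  by (auto intro!: series_homogI homog_uminus dest: series_homogD)

lemma series_homog_sg: "f \<in> series_homog e \<Longrightarrow> sg b * f \<in> series_homog e"
  by (cases b) (auto intro!: series_homog_uminus)

lemma series_homog_diff: "f \<in> series_homog e \<Longrightarrow> g \<in> series_homog e \<Longrightarrow> f - g \<in> series_homog e"
  by (auto intro!: series_homogI homog_diff dest: series_homogD)

lemma series_homog_sum: "(\<And>i. i \<in> A \<Longrightarrow> f i \<in> series_homog e) \<Longrightarrow> sum f A \<in> series_homog e"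
  by (induction A rule: infinite_finite_induct) (auto simp: series_homog_0 series_homog_add)

lemma series_homog_mult:
  assumes "f \<in> series_homog e" "g \<in> series_homog e'"
  shows "f * g \<in> series_homog (e \<noteq> e')"
proof (rule series_homogI)
  fix i j
  show "fls_nth (fls_nth (f * g) i) j \<in> homog (e \<noteq> e')"
    unfolding fls_times_nth(2) fls_nth_sum
    by (intro homog_sum homog_mult series_homogD assms)
qed

lemma series_homog_const: "x \<in> homog e \<Longrightarrow> fls_const (fls_const x) \<in> series_homog e"
  by (auto intro!: series_homogI homog.zero)

lemma series_homog_one: "1 \<in> series_homog False"
  using series_homog_const[OF homog_one] by simp

lemma series_homog_X_inv: "fls_X_inv \<in> series_homog False" "fls_const fls_X_inv \<in> series_homog False"
  by (auto intro!: series_homogI homog.zero homog_one)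

lemma series_homog_geom:
  "fls_const (fls_geom (scal k :: 'g::parity ssym)) \<in> series_homog False"
  "fls_geom (fls_const (scal k :: 'g::parity ssym)) \<in> series_homog False"
proof -
  have *: "(scal k :: 'g ssym) ^ n = scal (k ^ n)" for k n by (induction n) auto
  have "(scal k :: 'g ssym) \<in> homog False" for k using homog_mon[of "[]" False k] by simp
  then show "fls_const (fls_geom (scal k :: 'g ssym)) \<in> series_homog False"
    "fls_geom (fls_const (scal k :: 'g ssym)) \<in> series_homog False"
    by (auto intro!: series_homogI homog.zero simp: * simp flip: fls_const_power)
qed

lemma series_homog_commute:
  assumes "f \<in> series_homog e" "g \<in> series_homog e'"
  shows "f * g = sg (e \<and> e') * (g * f)"
proof (rule fls_mult_sign_commute)
  fix i j
  show "fls_nth f i * fls_nth g j = sg (e \<and> e') * (fls_nth g j * fls_nth f i)"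
    by (rule fls_mult_sign_commute) (intro homog_commute series_homogD assms)
qed

text \<open>Division by 2 through \<open>scal (1/2)\<close>. It is needed for squares of odd series,
  where the sign rule only yields \<open>f * f = - (f * f)\<close>.\<close>

lemma ssym_double_eq_0:
  fixes x :: "'g::parity ssym"
  assumes "x + x = 0" shows "x = 0"
proof -
  have "x = scal (1/2 + 1/2) * x" by simp
  also have "\<dots> = scal (1/2) * (x + x)"
    by (simp only: scal_simps distrib_right distrib_left)
  finally show ?thesis using assms by simp
qed

lemma series_odd_square:
  assumes f: "f \<in> series_homog True"
  shows "f * f = 0"
proof -
  have 0: "f * f + f * f = 0"
    using series_homog_commute[OF f f] by (simp add: eq_neg_iff_add_eq_0)
  have "fls_nth (fls_nth (f * f) i) j + fls_nth (fls_nth (f * f) i) j = fls_nth (fls_nth (f * f + f * f) i) j"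
    for i j by simp
  then show ?thesis unfolding 0 by (intro fls_eqI) (auto dest: ssym_double_eq_0)
qed

section \<open>Parity projections and the commutative ring of even series\<close>

definition series_part :: "bool \<Rightarrow> 'g::parity ssym fls fls \<Rightarrow> 'g ssym fls fls" where
  "series_part e = map_fls (map_fls (parity_part e))"

lemma series_part_nth: "fls_nth (fls_nth (series_part e f) i) j = parity_part e (fls_nth (fls_nth f i) j)"
proof -
  have "map_fls (parity_part e) 0 = (0 :: 'a ssym fls)"
    by (intro fls_eqI) (simp add: parity_part_0)
  then show ?thesis by (simp add: series_part_def parity_part_0)
qed

lemma series_part_homog: "series_part e f \<in> series_homog e"
  by (auto intro!: series_homogI simp: series_part_nth parity_part_homog)

lemma series_part_add: "series_part e (f + g) = series_part e f + series_part e g"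
  by (intro fls_eqI) (simp add: series_part_nth parity_part_add)

lemma series_part_of_homog: "f \<in> series_homog e \<Longrightarrow> series_part e' f = (if e' = e then f else 0)"
  by (auto intro!: fls_eqI simp: series_part_nth series_homogD[THEN parity_part_of_homog])

lemma series_part_decomp: "series_part False f + series_part True f = f"
  by (intro fls_eqI) (simp add: series_part_nth parity_part_decomp)

text \<open>Comparing even parts in \<open>f y = 1\<close> shows that the inverse of an even element is even.\<close>

lemma series_homog_inverse:
  assumes f: "f \<in> series_homog False" and y: "f * y = 1" "y * f = 1"
  shows "y \<in> series_homog False"
proof -
  let ?P = "series_part False"
  have "1 = ?P (f * (?P y + series_part True y))"
    by (simp add: series_part_decomp y series_part_of_homog[OF series_homog_one])
  also have "\<dots> = f * ?P y"
    using series_homog_mult[OF f series_part_homog, of False y] series_homog_mult[OF f series_part_homog, of True y]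
    by (simp add: distrib_left series_part_add series_part_of_homog[where e = False] series_part_of_homog[where e = True])
  finally have "y * 1 = y * (f * ?P y)" by simp
  also have "\<dots> = ?P y" unfolding mult.assoc[symmetric] y by simp
  finally show ?thesis using series_part_homog[of False y] by simp
qed

text \<open>The even series form a commutative ring type, so that \<open>det\<close> is available; odd entries are kept as
  elements of the ambient series ring.\<close>

typedef (overloaded) 'g even_series = "series_homog False :: 'g::parity ssym fls fls set"
  by (rule exI[of _ 0]) (rule series_homog_0)

abbreviation (input) "rep \<equiv> Rep_even_series"

setup_lifting type_definition_even_series

instantiation even_series :: (parity) comm_ring_1
begin
lift_definition zero_even_series :: "'a even_series" is 0 by (rule series_homog_0)
lift_definition one_even_series :: "'a even_series" is 1 by (rule series_homog_one)
lift_definition plus_even_series :: "'a even_series \<Rightarrow> 'a even_series \<Rightarrow> 'a even_series" is "(+)"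
  by (rule series_homog_add)
lift_definition minus_even_series :: "'a even_series \<Rightarrow> 'a even_series \<Rightarrow> 'a even_series" is "(-)"
  by (rule series_homog_diff)
lift_definition uminus_even_series :: "'a even_series \<Rightarrow> 'a even_series" is uminus
  by (rule series_homog_uminus)
lift_definition times_even_series :: "'a even_series \<Rightarrow> 'a even_series \<Rightarrow> 'a even_series" is "(*)"
  using series_homog_mult[of _ False _ False] by simp
instance
proof
  fix a b c :: "'a even_series"
  show "a * b = b * a"
    by transfer (use series_homog_commute[of _ False _ False] in simp)
qed (transfer; simp add: algebra_simps; fail)+
end

interpretation Rep: ring_hom "Rep_even_series :: 'g::parity even_series \<Rightarrow> _"
  by standard (transfer; simp; fail)+

lemma Rep_even_series_homog: "Rep_even_series x \<in> series_homog False"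
  by (rule Rep_even_series)

lemma Rep_Abs_even_series: "f \<in> series_homog False \<Longrightarrow> Rep_even_series (Abs_even_series f) = f"
  by (rule Abs_even_series_inverse)


section \<open>Jordan matrices\<close>

lemma block_jordan_Suc:
  "block_jordan (Suc l) g v = four_block_mat (block_jordan l g v)
     (0\<^sub>m (offset g (l + 1)) (g (Suc l))) (0\<^sub>m (g (Suc l)) (offset g (l + 1)))
     (jordan_block (g (Suc l)) (v (Suc l)))"
  and block_jordan_carrier: "block_jordan l g v \<in> carrier_mat (offset g (l + 1)) (offset g (l + 1))"
proof -
  have s: "sum_list (map fst (map (\<lambda>i. (g i, v i)) [1..<l + 1])) = offset g (l + 1)" for l
    by (induction l) (auto simp: offset_def)
  show c: "block_jordan l g v \<in> carrier_mat (offset g (l + 1)) (offset g (l + 1))" for l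
    unfolding block_jordan_def by (metis jordan_matrix_carrier s)
  show "block_jordan (Suc l) g v = four_block_mat (block_jordan l g v)
     (0\<^sub>m (offset g (l + 1)) (g (Suc l))) (0\<^sub>m (g (Suc l)) (offset g (l + 1)))
     (jordan_block (g (Suc l)) (v (Suc l)))"
    using c[of l] by (simp add: block_jordan_def jordan_matrix_def diag_block_mat_last Let_def)
qed

lemma offset_le: "i \<le> j \<Longrightarrow> offset g i \<le> offset g j"
  unfolding offset_def by (intro sum_mono2) auto

lemma offset_Suc': "1 \<le> i \<Longrightarrow> offset g (Suc i) = offset g i + g i"
  by (simp add: offset_def)

lemma offset_1 [simp]: "offset g (Suc 0) = 0"
  by (simp add: offset_def)

lemma offset_block_exists:
  assumes "r < offset g (Suc l)"
  obtains i where "i \<in> {1..l}" "offset g i \<le> r" "r < offset g (Suc i)"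
  using assms
proof (induction l arbitrary: thesis)
  case (Suc l)
  show ?case
  proof (cases "r < offset g (Suc l)")
    case True
    then obtain i where "i \<in> {1..l}" "offset g i \<le> r" "r < offset g (Suc i)"
      using Suc.IH by blast
    then show ?thesis by (intro Suc.prems(1)[of i]) auto
  next
    case False
    then show ?thesis using Suc.prems(2) by (intro Suc.prems(1)[of "Suc l"]) auto
  qed
qed simp

lemma offset_block_unique:
  assumes "offset g i \<le> r" "r < offset g (Suc i)" "offset g j \<le> r" "r < offset g (Suc j)"
  shows "i = j"
  using offset_le[of "Suc i" j g] offset_le[of "Suc j" i g] assms by (cases i j rule: linorder_cases) auto

lemma block_jordan_nth:
  assumes "i \<in> {1..l}" "offset g i \<le> r" "r < offset g (Suc i)" "s < offset g (Suc l)"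
  shows "block_jordan l g v $$ (r, s) =
    (if r = s then v i else if s = Suc r \<and> s < offset g (Suc i) then 1 else 0)"
  using assms
proof (induction l)
  case (Suc l)
  have off: "offset g (Suc (Suc l)) = offset g (Suc l) + g (Suc l)" by (simp add: offset_Suc')
  have d: "dim_row (block_jordan l g v) = offset g (Suc l)" "dim_col (block_jordan l g v) = offset g (Suc l)"
    using block_jordan_carrier[of l g v] by auto
  show ?case
  proof (cases "i = Suc l")
    case True
    with Suc.prems show ?thesis
      unfolding block_jordan_Suc by (auto simp: d off jordan_block_def)
  next
    case False
    then have i: "i \<in> {1..l}" using Suc.prems by auto
    have le: "offset g (Suc i) \<le> offset g (Suc l)" using i by (intro offset_le) auto
    show ?thesis
    proof (cases "s < offset g (Suc l)")
      case True
      then show ?thesis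
        using Suc.IH[OF i Suc.prems(2,3) True] Suc.prems le
        unfolding block_jordan_Suc by (simp add: d off)
    next
      case False
      then show ?thesis
        using Suc.prems le unfolding block_jordan_Suc by (auto simp: d off)
    qed
  qed
qed simp

text \<open>Entries of the inverse of \<open>x\<close> minus a block Jordan matrix, where
  \<open>y i\<close> inverts \<open>x\<close> minus the \<open>i\<close>-th eigenvalue: on a block
  with nilpotent part \<open>n\<close> the inverse is the sum of all \<open>n^k * y^(k + 1)\<close>.
  As a polynomial in the \<open>y i\<close> it commutes with ring homomorphisms.\<close>

definition jordan_inv :: "nat \<Rightarrow> (nat \<Rightarrow> nat) \<Rightarrow> (nat \<Rightarrow> 'a::semiring_1) \<Rightarrow> nat \<Rightarrow> nat \<Rightarrow> 'a" where
  "jordan_inv l g y r s =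
     (\<Sum>i=1..l. if offset g i \<le> r \<and> r \<le> s \<and> s < offset g (Suc i) then y i ^ (s - r + 1) else 0)"

lemma jordan_inv_eq:
  assumes "i \<in> {1..l}" "offset g i \<le> r" "r < offset g (Suc i)"
  shows "jordan_inv l g y r s = (if r \<le> s \<and> s < offset g (Suc i) then y i ^ (s - r + 1) else 0)"
proof -
  have "jordan_inv l g y r s =
      (\<Sum>j=1..l. if j = i then if r \<le> s \<and> s < offset g (Suc i) then y i ^ (s - r + 1) else 0 else 0)"
    unfolding jordan_inv_def
  proof (rule sum.cong[OF refl])
    fix j
    show "(if offset g j \<le> r \<and> r \<le> s \<and> s < offset g (Suc j) then y j ^ (s - r + 1) else 0) =
        (if j = i then if r \<le> s \<and> s < offset g (Suc i) then y i ^ (s - r + 1) else 0 else 0)"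
    proof (cases "j = i")
      case True
      then show ?thesis using assms(2) by simp
    next
      case False
      then have "\<not> (offset g j \<le> r \<and> r < offset g (Suc j))"
        using offset_block_unique[OF assms(2,3)] by blast
      then have "\<not> (offset g j \<le> r \<and> r \<le> s \<and> s < offset g (Suc j))"
        using le_less_trans by blast
      then show ?thesis using False by auto
    qed
  qed
  then show ?thesis using assms(1) by (simp add: sum.delta)
qed

lemma jordan_inv_nonzero_block:
  assumes "jordan_inv l g y r s \<noteq> 0"
  obtains i where "i \<in> {1..l}" "offset g i \<le> r" "r \<le> s" "s < offset g (Suc i)"
proof -
  obtain i where "i \<in> {1..l}"
    "(if offset g i \<le> r \<and> r \<le> s \<and> s < offset g (Suc i) then y i ^ (s - r + 1) else 0) \<noteq> 0"
    using sum.not_neutral_contains_not_neutral[OF assms[unfolded jordan_inv_def]] by blast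
  with that show ?thesis by (auto split: if_splits)
qed

lemma (in ring_hom) hom_jordan_inv: "hom (jordan_inv l g y r s) = jordan_inv l g (\<lambda>i. hom (y i)) r s"
  unfolding jordan_inv_def hom_sum by (intro sum.cong refl) (simp add: hom_mult hom_power)

text \<open>For fixed \<open>i\<close>, the pairs \<open>(k, r)\<close> run through the
  \<open>k\<close>-th superdiagonals of block \<open>i\<close>, with \<open>r\<close> counted from 1
  and matrix indices from 0. So a sum over Takiff degrees, as in the images of the Gaudin matrices,
  is a full double sum against the inverse of a Jordan matrix.\<close>

lemma sum_blocks_jordan_inv:
  fixes F :: "nat \<Rightarrow> nat \<Rightarrow> 'a::ring_1"
  shows "(\<Sum>i=1..l. \<Sum>k<g i. \<Sum>r\<in>{offset g i + 1..offset g (i + 1) - k}. F r (r + k) * y i ^ (k + 1)) =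
    (\<Sum>r<offset g (Suc l). \<Sum>s<offset g (Suc l). F (r + 1) (s + 1) * jordan_inv l g y r s)"
proof -
  let ?N = "offset g (Suc l)"
  let ?P = "\<lambda>i r s. offset g i \<le> r \<and> r \<le> s \<and> s < offset g (Suc i)"
  have block: "(\<Sum>k<g i. \<Sum>r\<in>{offset g i + 1..offset g (i + 1) - k}. F r (r + k) * y i ^ (k + 1)) =
      (\<Sum>r<?N. \<Sum>s<?N. if ?P i r s then F (r + 1) (s + 1) * y i ^ (s - r + 1) else 0)"
    if i: "i \<in> {1..l}" for i
  proof -
    have le: "offset g (Suc i) \<le> ?N" using i by (intro offset_le) auto
    have off: "offset g (Suc i) = offset g i + g i" using i by (simp add: offset_Suc')
    have "(\<Sum>k<g i. \<Sum>r\<in>{offset g i + 1..offset g (i + 1) - k}. F r (r + k) * y i ^ (k + 1)) =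
        (\<Sum>(k, r)\<in>Sigma {..<g i} (\<lambda>k. {offset g i + 1..offset g (i + 1) - k}). F r (r + k) * y i ^ (k + 1))"
      by (rule sum.Sigma) auto
    also have "\<dots> = (\<Sum>(r, s)\<in>{(r, s). ?P i r s}. F (r + 1) (s + 1) * y i ^ (s - r + 1))"
      by (rule sum.reindex_bij_witness[where i = "\<lambda>(r, s). (s - r, r + 1)" and j = "\<lambda>(k, r). (r - 1, r + k - 1)"])
        (auto simp: off)
    also have "\<dots> = (\<Sum>(r, s)\<in>{..<?N} \<times> {..<?N}. if ?P i r s then F (r + 1) (s + 1) * y i ^ (s - r + 1) else 0)"
      by (intro sum.mono_neutral_cong_left) (use le in \<open>auto split: if_splits\<close>)
    finally show ?thesis by (simp add: sum.cartesian_product)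
  qed
  have "(\<Sum>r<?N. \<Sum>s<?N. F (r + 1) (s + 1) * jordan_inv l g y r s) =
      (\<Sum>r<?N. \<Sum>s<?N. \<Sum>i=1..l. if ?P i r s then F (r + 1) (s + 1) * y i ^ (s - r + 1) else 0)"
    unfolding jordan_inv_def sum_distrib_left by (intro sum.cong refl) auto
  also have "\<dots> = (\<Sum>r<?N. \<Sum>i=1..l. \<Sum>s<?N. if ?P i r s then F (r + 1) (s + 1) * y i ^ (s - r + 1) else 0)"
    by (intro sum.cong refl sum.swap)
  also have "\<dots> = (\<Sum>i=1..l. \<Sum>r<?N. \<Sum>s<?N. if ?P i r s then F (r + 1) (s + 1) * y i ^ (s - r + 1) else 0)"
    by (rule sum.swap)
  finally show ?thesis using block by simp
qed

section \<open>Inverses of characteristic matrices of Jordan matrices\<close>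

definition jordan_char ::
  "(complex \<Rightarrow> 'a::comm_ring_1) \<Rightarrow> 'a \<Rightarrow> nat \<Rightarrow> (nat \<Rightarrow> nat) \<Rightarrow> (nat \<Rightarrow> complex) \<Rightarrow> nat \<Rightarrow> 'a mat" where
  "jordan_char h x l g v N =
     mat N N (\<lambda>(r, s). (if r = s then x else 0) - h (block_jordan l g v $$ (r, s)))"

definition jordan_char_inv :: "nat \<Rightarrow> (nat \<Rightarrow> nat) \<Rightarrow> (nat \<Rightarrow> 'a::comm_ring_1) \<Rightarrow> nat \<Rightarrow> 'a mat" where
  "jordan_char_inv l g y N = mat N N (\<lambda>(r, s). jordan_inv l g y r s)"

lemma jordan_char_carrier: "jordan_char h x l g v N \<in> carrier_mat N N"
  and jordan_char_inv_carrier: "jordan_char_inv l g y N \<in> carrier_mat N N"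
  by (simp_all add: jordan_char_def jordan_char_inv_def)

lemma jordan_char_inv_lower: "s < r \<Longrightarrow> r < N \<Longrightarrow> jordan_char_inv l g y N $$ (r, s) = 0"
  by (simp add: jordan_char_inv_def jordan_inv_def)

context
  fixes h :: "complex \<Rightarrow> 'a::comm_ring_1" and x :: 'a and l :: nat and g :: "nat \<Rightarrow> nat"
    and v :: "nat \<Rightarrow> complex" and y :: "nat \<Rightarrow> 'a" and N :: nat
  assumes h: "h 0 = 0" "h 1 = 1" and y: "\<And>i. i \<in> {1..l} \<Longrightarrow> (x - h (v i)) * y i = 1"
    and N: "N = offset g (Suc l)"
begin

private abbreviation (input) "J \<equiv> jordan_char h x l g v N"
private abbreviation (input) "K \<equiv> jordan_char_inv l g y N"

lemma jordan_char_nth: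
  assumes "i \<in> {1..l}" "offset g i \<le> r" "r < offset g (Suc i)" "s < N"
  shows "J $$ (r, s) =
    (if r = s then x - h (v i) else 0) - (if s = Suc r \<and> s < offset g (Suc i) then 1 else 0)"
proof -
  have "r < N" using offset_le[of "Suc i" "Suc l" g] assms N by auto
  with assms(4) show ?thesis
    unfolding jordan_char_def by (simp add: block_jordan_nth[OF assms(1-3) assms(4)[unfolded N]] h)
qed

lemma jordan_char_lower:
  assumes "s < r" "r < N" shows "J $$ (r, s) = 0"
proof -
  obtain i where "i \<in> {1..l}" "offset g i \<le> r" "r < offset g (Suc i)"
    using offset_block_exists assms(2) N by blast
  with assms show ?thesis by (simp add: jordan_char_nth[of i])
qed

text \<open>A row of \<open>J\<close> has no nonzero entries besides \<open>x - h (v i)\<close> on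
  the diagonal and possibly \<open>- 1\<close> next to it, so the product telescopes by
  \<open>(x - h (v i)) * y i ^ (k + 1) = y i ^ k\<close>.\<close>

lemma jordan_char_mult_inv: "J * K = 1\<^sub>m N"
proof (rule eq_matI)
  fix r s assume "r < dim_row (1\<^sub>m N :: 'a mat)" "s < dim_col (1\<^sub>m N :: 'a mat)"
  then have rs: "r < N" "s < N" by auto
  obtain i where i: "i \<in> {1..l}" "offset g i \<le> r" "r < offset g (Suc i)"
    using offset_block_exists rs(1) N by blast
  have iN: "offset g (Suc i) \<le> N" unfolding N using i by (intro offset_le) auto
  have "(J * K) $$ (r, s) = (\<Sum>t<N. J $$ (r, t) * jordan_inv l g y t s)"
    using rs by (simp add: jordan_char_def jordan_char_inv_def scalar_prod_def lessThan_atLeast0)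
  also have "\<dots> = (\<Sum>t<N. (if t = r then (x - h (v i)) * jordan_inv l g y t s else 0) -
      (if t = Suc r then if t < offset g (Suc i) then jordan_inv l g y t s else 0 else 0))"
    by (intro sum.cong refl) (auto simp: jordan_char_nth[OF i])
  also have "\<dots> = (x - h (v i)) * jordan_inv l g y r s -
      (if Suc r < offset g (Suc i) then jordan_inv l g y (Suc r) s else 0)"
    using rs iN by (simp add: sum_subtractf)
  also have "\<dots> = (if r = s then 1 else 0)"
  proof (cases "r \<le> s \<and> s < offset g (Suc i)")
    case True
    have "(x - h (v i)) * y i ^ (s - r + 1) = y i ^ (s - r)"
      using y[OF i(1)] by (simp flip: mult.assoc)
    moreover have "r < s \<Longrightarrow> y i ^ (s - Suc r + 1) = y i ^ (s - r)" by (simp add: Suc_diff_Suc flip: power_Suc)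
    ultimately show ?thesis
      using True i jordan_inv_eq[OF i, of y s] jordan_inv_eq[OF i(1), of g "Suc r" y s] by (auto simp del: power_Suc)
  next
    case False
    then show ?thesis
      using i jordan_inv_eq[OF i, of y s] jordan_inv_eq[OF i(1), of g "Suc r" y s] by auto
  qed
  finally show "(J * K) $$ (r, s) = 1\<^sub>m N $$ (r, s)" using rs by simp
qed (simp_all add: jordan_char_def jordan_char_inv_def)

end

lemma adj_inverse:
  fixes A :: "'a::comm_ring_1 mat"
  assumes A: "A \<in> carrier_mat n n" and y: "det A * y = 1"
  shows "y \<cdot>\<^sub>m adj_mat A \<in> carrier_mat n n"
    and "A * (y \<cdot>\<^sub>m adj_mat A) = 1\<^sub>m n" and "(y \<cdot>\<^sub>m adj_mat A) * A = 1\<^sub>m n"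
proof -
  have *: "y \<cdot>\<^sub>m (det A \<cdot>\<^sub>m 1\<^sub>m n) = 1\<^sub>m n"
    using y by (intro eq_matI) (auto simp: ac_simps)
  show "y \<cdot>\<^sub>m adj_mat A \<in> carrier_mat n n" using adj_mat(1)[OF A] by simp
  show "A * (y \<cdot>\<^sub>m adj_mat A) = 1\<^sub>m n"
    using mult_smult_distrib[OF A adj_mat(1)[OF A]] adj_mat(2)[OF A] * by simp
  show "(y \<cdot>\<^sub>m adj_mat A) * A = 1\<^sub>m n"
    using mult_smult_assoc_mat[OF adj_mat(1)[OF A] A] adj_mat(3)[OF A] * by simp
qed

text \<open>\<open>det B\<close> inverts \<open>det A\<close>, so the adjugate yields a two-sided
  inverse of \<open>A\<close>, and this must be \<open>B\<close>.\<close>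

lemma right_inverse_imp_left_inverse_mat:
  fixes A :: "'a::comm_ring_1 mat"
  assumes A: "A \<in> carrier_mat n n" and B: "B \<in> carrier_mat n n" and AB: "A * B = 1\<^sub>m n"
  shows "B * A = 1\<^sub>m n"
proof -
  have "det A * det B = 1" using det_mult[OF A B] AB by simp
  note Q = adj_inverse[OF A this]
  have "B = det B \<cdot>\<^sub>m adj_mat A * A * B" unfolding Q(3) using B by simp
  also have "\<dots> = det B \<cdot>\<^sub>m adj_mat A"
    unfolding assoc_mult_mat[OF Q(1) A B] AB by (rule right_mult_one_mat[OF Q(1)])
  finally show ?thesis using Q(3) by simp
qed


text \<open>An even series commutes with both parity parts of \<open>x\<close>, hence it is central
  in the ambient ring.\<close>

lemma rep_commute: "Rep_even_series u * x = x * Rep_even_series u"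
proof -
  have "series_part e x * Rep_even_series u = Rep_even_series u * series_part e x" for e
    using series_homog_commute[OF Rep_even_series_homog[of u] series_part_homog[of e x]] by simp
  then show ?thesis
    by (metis distrib_left distrib_right series_part_decomp)
qed

section \<open>The Berezinian of a Schur complement\<close>

text \<open>The two Schur complements \<open>Z - B W\<^sup>-\<^sup>1 C\<close> and \<open>W - C Z\<^sup>-\<^sup>1 B\<close> of the supermatrix with blocks \<open>Z, B, C, W\<close>,
  the latter with \<open>Z\<close> truncated to its upper left \<open>k \<times> k\<close> block. The products \<open>C a r * B s b\<close> are even
  whenever they are multiplied by a nonzero entry of \<open>Z\<^sup>-\<^sup>1\<close>; otherwise the value of \<open>Abs_even_series\<close> is
  irrelevant.\<close>

definition schur_left ::
  "nat \<Rightarrow> nat \<Rightarrow> 'g::parity even_series mat \<Rightarrow> 'g even_series mat \<Rightarrow> (nat \<Rightarrow> nat \<Rightarrow> 'g ssym fls fls) \<Rightarrow>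
   (nat \<Rightarrow> nat \<Rightarrow> 'g ssym fls fls) \<Rightarrow> 'g ssym fls fls mat" where
  "schur_left N d Z Wi B C = mat N N (\<lambda>(i, j). Rep_even_series (Z $$ (i, j)) -
     (\<Sum>a<d. \<Sum>b<d. B i a * Rep_even_series (Wi $$ (a, b)) * C b j))"

definition schur_right ::
  "nat \<Rightarrow> 'g::parity even_series mat \<Rightarrow> 'g even_series mat \<Rightarrow> (nat \<Rightarrow> nat \<Rightarrow> 'g ssym fls fls) \<Rightarrow>
   (nat \<Rightarrow> nat \<Rightarrow> 'g ssym fls fls) \<Rightarrow> nat \<Rightarrow> 'g even_series mat" where
  "schur_right d Zi W B C k = mat d d (\<lambda>(a, b). W $$ (a, b) -
     (\<Sum>r<k. \<Sum>s<k. Abs_even_series (C a r * B s b) * Zi $$ (r, s)))"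

text \<open>The Berezinian of the upper left \<open>k x k\<close> block of a triangular
  \<open>Z\<close>. The diagonal of \<open>Zi\<close> supplies the inverses of the diagonal entries
  at odd indices.\<close>

definition diag_factor ::
  "'a::comm_monoid_mult mat \<Rightarrow> 'a mat \<Rightarrow> (nat \<Rightarrow> bool) \<Rightarrow> nat \<Rightarrow> 'a" where
  "diag_factor Z Zi par k = (\<Prod>i<k. if par i then Zi $$ (i, i) else Z $$ (i, i))"

text \<open>The column \<open>c\<close> of the rank one update, that is, column \<open>k\<close> of
  \<open>C * Zi\<close>; the sum stops at \<open>k\<close> because \<open>Zi\<close> is upper
  triangular.\<close>

definition last_col ::
  "'g::parity even_series mat \<Rightarrow> (nat \<Rightarrow> nat \<Rightarrow> 'g ssym fls fls) \<Rightarrow> nat \<Rightarrow> nat \<Rightarrow> 'g ssym fls fls" where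
  "last_col Zi C k a = (\<Sum>r<Suc k. C a r * Rep_even_series (Zi $$ (r, k)))"

lemma schur_right_carrier: "schur_right d Zi W B C k \<in> carrier_mat d d"
  by (simp add: schur_right_def)

context
  fixes N d :: nat and Z Zi W Wi :: "'g::parity even_series mat"
    and B C :: "nat \<Rightarrow> nat \<Rightarrow> 'g ssym fls fls" and par :: "nat \<Rightarrow> bool"
  assumes Z: "Z \<in> carrier_mat N N" and Zi: "Zi \<in> carrier_mat N N"
    and W: "W \<in> carrier_mat d d" and Wi: "Wi \<in> carrier_mat d d"
    and ZiZ: "Zi * Z = 1\<^sub>m N" and WWi: "W * Wi = 1\<^sub>m d"
    and Z_lower: "\<And>r s. s < r \<Longrightarrow> r < N \<Longrightarrow> Z $$ (r, s) = 0"
    and Zi_lower: "\<And>r s. s < r \<Longrightarrow> r < N \<Longrightarrow> Zi $$ (r, s) = 0"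
    and Zi_par: "\<And>r s. r < N \<Longrightarrow> s < N \<Longrightarrow> Zi $$ (r, s) \<noteq> 0 \<Longrightarrow> par r = par s"
    and B: "\<And>i a. i < N \<Longrightarrow> a < d \<Longrightarrow> B i a \<in> series_homog (par i)"
    and C: "\<And>a j. a < d \<Longrightarrow> j < N \<Longrightarrow> C a j \<in> series_homog (par j)"
begin

private abbreviation (input) "HH \<equiv> schur_left N d Z Wi B C"
private abbreviation (input) "GG k \<equiv> schur_right d Zi W B C k"
private abbreviation (input) "cc k a \<equiv> last_col Zi C k a"

lemma rep_schur_term:
  assumes "a < d" "b < d" "r < N" "s < N"
  shows "rep (Abs_even_series (C a r * B s b) * Zi $$ (r, s)) = C a r * rep (Zi $$ (r, s)) * B s b"
proof (cases "Zi $$ (r, s) = 0")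
  case False
  then have "C a r * B s b \<in> series_homog False"
    using series_homog_mult[OF C B, of a r s b] Zi_par[of r s] assms by auto
  then show ?thesis
    by (simp add: Rep.hom_mult Rep_Abs_even_series mult.assoc rep_commute[of _ "B s b"])
qed simp

lemma rep_schur_right:
  assumes "a < d" "b < d" "k \<le> N"
  shows "rep (GG k $$ (a, b)) =
    rep (W $$ (a, b)) - (\<Sum>r<k. \<Sum>s<k. C a r * rep (Zi $$ (r, s)) * B s b)"
  using assms by (auto simp: schur_right_def Rep.hom_minus Rep.hom_sum rep_schur_term intro!: sum.cong)

lemma last_col_homog:
  assumes "k < N" "a < d" shows "cc k a \<in> series_homog (par k)"
  unfolding last_col_def
proof (rule series_homog_sum)
  fix r assume "r \<in> {..<Suc k}"
  then have r: "r < N" using assms by auto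
  show "C a r * rep (Zi $$ (r, k)) \<in> series_homog (par k)"
  proof (cases "Zi $$ (r, k) = 0")
    case True
    then show ?thesis by (simp add: series_homog_0)
  next
    case False
    then show ?thesis
      using series_homog_mult[OF C Rep_even_series_homog, of a r "Zi $$ (r, k)"] Zi_par[of r k] assms r by auto
  qed
qed

text \<open>Among the new terms of the double sum, those with \<open>r = k\<close> and
  \<open>s < k\<close> vanish since \<open>Zi\<close> is upper triangular, and those with
  \<open>s = k\<close> form the rank one matrix \<open>c b\<close>.\<close>

lemma rep_schur_right_Suc:
  assumes "a < d" "b < d" "k < N"
  shows "rep (GG k $$ (a, b)) = rep (GG (Suc k) $$ (a, b)) + cc k a * B k b"
proof -
  let ?f = "\<lambda>r s. C a r * rep (Zi $$ (r, s)) * B s b"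
  have "(\<Sum>r<Suc k. \<Sum>s<Suc k. ?f r s) = (\<Sum>r<Suc k. \<Sum>s<k. ?f r s) + cc k a * B k b"
    by (simp only: sum.lessThan_Suc sum.distrib last_col_def distrib_right sum_distrib_right)
  also have "(\<Sum>r<Suc k. \<Sum>s<k. ?f r s) = (\<Sum>r<k. \<Sum>s<k. ?f r s)"
    using Zi_lower[of _ k] assms by simp
  finally show ?thesis using assms by (simp add: rep_schur_right)
qed

text \<open>Truncation cuts only the rows of \<open>B\<close> and the columns of \<open>C\<close>,
  while \<open>Wi\<close> keeps its full size. Thus an upper left block of a Schur complement is
  again one, to which \<open>schur_complement_corner\<close> applies.\<close>

lemma schur_left_upper_left:
  assumes "k \<le> N"
  shows "upper_left HH k = map_mat rep (upper_left Z k) -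
    mat k d (\<lambda>(i, a). B i a) * map_mat rep Wi * mat d k (\<lambda>(a, j). C a j)"
  (is "_ = ?R")
proof (rule eq_matI)
  fix i j assume "i < dim_row ?R" "j < dim_col ?R"
  then have ij: "i < k" "j < k" by auto
  have "(mat k d (\<lambda>(i, a). B i a) * map_mat rep Wi * mat d k (\<lambda>(a, j). C a j)) $$ (i, j) =
      (\<Sum>b<d. (\<Sum>a<d. B i a * rep (Wi $$ (a, b))) * C b j)"
    using ij Wi by (simp add: scalar_prod_def lessThan_atLeast0)
  also have "\<dots> = (\<Sum>a<d. \<Sum>b<d. B i a * rep (Wi $$ (a, b)) * C b j)"
    unfolding sum_distrib_right by (rule sum.swap)
  finally show "upper_left HH k $$ (i, j) = (map_mat rep (upper_left Z k) -
    mat k d (\<lambda>(i, a). B i a) * map_mat rep Wi * mat d k (\<lambda>(a, j). C a j)) $$ (i, j)"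
    using ij assms Wi by (simp add: upper_left_def schur_left_def)
qed (simp_all add: upper_left_def)

lemma Z_diag: "i < N \<Longrightarrow> Z $$ (i, i) * Zi $$ (i, i) = 1"
proof -
  assume i: "i < N"
  have "(Zi * Z) $$ (i, i) = (\<Sum>j<N. Zi $$ (i, j) * Z $$ (j, i))"
    using i Z Zi by (simp add: scalar_prod_def lessThan_atLeast0)
  also have "\<dots> = (\<Sum>j<N. if j = i then Zi $$ (i, i) * Z $$ (i, i) else 0)"
    using i Z_lower Zi_lower by (intro sum.cong refl) (metis lessThan_iff linorder_neqE_nat mult_zero_left mult_zero_right)
  finally show ?thesis using i ZiZ by (simp add: mult.commute)
qed

text \<open>Truncation respects products of upper triangular matrices: the terms with
  \<open>t \<ge> k\<close> contain an entry of \<open>Z\<close> below the diagonal.\<close>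

lemma upper_left_Zi_Z:
  assumes "k \<le> N" shows "upper_left Zi k * upper_left Z k = 1\<^sub>m k"
proof (rule eq_matI)
  fix i j assume "i < dim_row (1\<^sub>m k :: 'g even_series mat)" "j < dim_col (1\<^sub>m k :: 'g even_series mat)"
  then have ij: "i < k" "j < k" by auto
  have "(Zi * Z) $$ (i, j) = (\<Sum>t<N. Zi $$ (i, t) * Z $$ (t, j))"
    using ij assms Z Zi by (simp add: scalar_prod_def lessThan_atLeast0)
  also have "\<dots> = (\<Sum>t<k. Zi $$ (i, t) * Z $$ (t, j))"
    using ij assms Z_lower by (intro sum.mono_neutral_right) auto
  also have "\<dots> = (upper_left Zi k * upper_left Z k) $$ (i, j)"
    using ij by (simp add: upper_left_def scalar_prod_def lessThan_atLeast0)
  finally show "(upper_left Zi k * upper_left Z k) $$ (i, j) = 1\<^sub>m k $$ (i, j)"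
    using ZiZ ij assms by simp
qed (simp_all add: upper_left_def)

text \<open>\<open>f\<close> is the even series 1 - b Gamma^-1 c with Gamma = \<open>GG k\<close>,
  and \<open>f'\<close> is \<open>Z $$ (k, k)\<close> times the corner entry of the inverse of the
  upper left block of \<open>HH\<close> of size \<open>Suc k\<close>.\<close>

lemma schur_step:
  assumes k: "k < N" and def: "berezinian_defined HH"
    and u: "det (GG k) * u = 1"
  obtains f f' where "f * f' = 1"
    "ber_factor HH (Suc k) = rep (Z $$ (k, k) * f)"
    "ring_inv (ber_factor HH (Suc k)) = rep (Zi $$ (k, k) * f')"
    "det (GG (Suc k)) = det (GG k) * (if par k then f' else f)"
proof -
  let ?B = "mat (Suc k) d (\<lambda>(i, a). B i a)" and ?C = "mat d (Suc k) (\<lambda>(a, j). C a j)"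
  let ?z = "rep (Z $$ (k, k))" and ?zi = "rep (Zi $$ (k, k))"
  define Gi where "Gi = u \<cdot>\<^sub>m adj_mat (GG k)"
  note Gi = adj_inverse[OF schur_right_carrier u, folded Gi_def]
  have "Suc k \<in> {1..dim_row HH}" using k by (simp add: schur_left_def)
  with def obtain X x where X: "X \<in> carrier_mat (Suc k) (Suc k)"
    "upper_left HH (Suc k) * X = 1\<^sub>m (Suc k)" "X * upper_left HH (Suc k) = 1\<^sub>m (Suc k)"
    "X $$ (k, k) * x = 1" "x * X $$ (k, k) = 1"
    unfolding berezinian_defined_def by (metis diff_Suc_1)
  have bf: "ber_factor HH (Suc k) = x"
    using ber_factor_eq[OF X(1-3)] X(4,5) by simp
  have rbf: "ring_inv (ber_factor HH (Suc k)) = X $$ (k, k)"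
    unfolding bf by (rule ring_inv_eq[OF X(5,4)])
  have zzi: "?z * ?zi = 1" "?zi * ?z = 1"
    using Z_diag[OF k] by (simp_all add: mult.commute flip: Rep.hom_mult)
  \<comment> \<open>The column Gamma^-1 c. Its parity is that of the index \<open>k\<close>, since
    \<open>Gi\<close> has even entries.\<close>
  define c' where "c' i = (\<Sum>j<d. rep (Gi $$ (i, j)) * cc k j)" for i
  have c': "c' i \<in> series_homog (par k)" if "i < d" for i
    unfolding c'_def
    using series_homog_mult[OF Rep_even_series_homog last_col_homog, of k] k by (intro series_homog_sum) auto
  have Bk: "B k i \<in> series_homog (par k)" if "i < d" for i using B k that by simp
  define F where "F = 1 - (\<Sum>i<d. B k i * c' i)"
  have F: "F \<in> series_homog False"
    unfolding F_def
    using series_homog_mult[OF Bk c'] by (intro series_homog_diff series_homog_one series_homog_sum) auto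
  have "(1 - (\<Sum>i<d. \<Sum>j<d. ?B $$ (k, i) * map_mat rep Gi $$ (i, j) * cc k j)) * (?z * X $$ (k, k)) = 1"
  proof (rule schur_complement_corner[where Z = "map_mat rep (upper_left Z (Suc k))" and k = "Suc k"
        and Zi = "map_mat rep (upper_left Zi (Suc k))" and W = "map_mat rep W" and Wi = "map_mat rep Wi"
        and C = ?C and G = "map_mat rep (GG k)"])
    show "map_mat rep (upper_left Zi (Suc k)) * map_mat rep (upper_left Z (Suc k)) = 1\<^sub>m (Suc k)"
      using upper_left_Zi_Z[of "Suc k"] k
      by (simp flip: Rep.map_mat_mult[OF upper_left_carrier upper_left_carrier] add: Rep.map_mat_one)
    show "map_mat rep W * map_mat rep Wi = 1\<^sub>m d"
      using WWi by (simp flip: Rep.map_mat_mult[OF W Wi] add: Rep.map_mat_one)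
    show "map_mat rep Gi * map_mat rep (GG k) = 1\<^sub>m d"
      using Gi(3) by (simp flip: Rep.map_mat_mult[OF Gi(1) schur_right_carrier] add: Rep.map_mat_one)
    show "(map_mat rep (upper_left Z (Suc k)) - ?B * map_mat rep Wi * ?C) * X = 1\<^sub>m (Suc k)"
      using X(2) k by (simp flip: schur_left_upper_left)
    show "map_mat rep (upper_left Zi (Suc k)) $$ (k, j) = 0" if "j < Suc k" "j \<noteq> k" for j
      using that k Zi_lower[of j k] by (simp add: upper_left_def)
    show "?z * map_mat rep (upper_left Zi (Suc k)) $$ (k, k) = 1"
      using zzi by (simp add: upper_left_def)
    show "cc k i = (\<Sum>j<Suc k. ?C $$ (i, j) * map_mat rep (upper_left Zi (Suc k)) $$ (j, k))"
      if "i < d" for i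
      using that by (simp add: last_col_def upper_left_def)
    fix i j assume ij: "i < d" "j < d"
    have "(?C * map_mat rep (upper_left Zi (Suc k)) * ?B) $$ (i, j) =
        (\<Sum>s<Suc k. (\<Sum>r<Suc k. C i r * rep (Zi $$ (r, s))) * B s j)"
      using ij by (simp add: scalar_prod_def upper_left_def lessThan_atLeast0 del: sum.op_ivl_Suc)
    also have "\<dots> = (\<Sum>r<Suc k. \<Sum>s<Suc k. C i r * rep (Zi $$ (r, s)) * B s j)"
      unfolding sum_distrib_right by (rule sum.swap)
    finally have "(map_mat rep W - ?C * map_mat rep (upper_left Zi (Suc k)) * ?B) $$ (i, j) =
        rep (GG (Suc k) $$ (i, j))"
      using ij k W by (simp add: rep_schur_right del: sum.lessThan_Suc)
    then show "map_mat rep (GG k) $$ (i, j) =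
        (map_mat rep W - ?C * map_mat rep (upper_left Zi (Suc k)) * ?B) $$ (i, j) +
        cc k i * ?B $$ (k, j)"
      using ij k schur_right_carrier[of d Zi W B C k] by (simp add: rep_schur_right_Suc)
  qed (use X W Wi Gi schur_right_carrier in \<open>auto simp: upper_left_carrier\<close>)
  moreover have "(\<Sum>i<d. \<Sum>j<d. ?B $$ (k, i) * map_mat rep Gi $$ (i, j) * cc k j) = (\<Sum>i<d. B k i * c' i)"
    using Gi(1) by (auto simp: c'_def sum_distrib_left mult.assoc intro!: sum.cong)
  ultimately have FX: "F * (?z * X $$ (k, k)) = 1" unfolding F_def by simp
  have x: "x = F * ?z"
  proof -
    have "F * (?z * X $$ (k, k)) * x = F * ?z * (X $$ (k, k) * x)" by (simp only: mult.assoc)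
    with FX X(4) show ?thesis by simp
  qed
  \<comment> \<open>The corner formula gives an inverse on one side only, and the parity of the
    corner entry is not yet known. The two-sided inverse \<open>x\<close> of that entry supplies the
    other side, after which \<open>series_homog_inverse\<close> shows evenness.\<close>
  have XF: "?z * X $$ (k, k) * F = 1"
  proof -
    have "?z * X $$ (k, k) * F = ?z * (X $$ (k, k) * (F * ?z)) * ?zi"
      using zzi by (simp add: mult.assoc)
    then show ?thesis using X(4) zzi unfolding x by simp
  qed
  define f where "f = Abs_even_series F"
  define f' where "f' = Abs_even_series (?z * X $$ (k, k))"
  have f: "rep f = F" unfolding f_def by (rule Rep_Abs_even_series[OF F])
  have f': "rep f' = ?z * X $$ (k, k)"
    unfolding f'_def by (rule Rep_Abs_even_series[OF series_homog_inverse[OF F FX XF]])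
  have ff': "f * f' = 1"
    using FX by (simp flip: Rep_even_series_inject add: Rep.hom_mult f f')
  \<comment> \<open>The factors may be odd, but their product is even, so the determinant of
    \<open>?M\<close> makes sense.\<close>
  define M where "M i j = Abs_even_series (c' i * B k j)" for i j
  have M: "rep (M i j) = c' i * B k j" if "i < d" "j < d" for i j
    unfolding M_def using series_homog_mult[OF c' Bk] that by (intro Rep_Abs_even_series) auto
  let ?M = "mat d d (\<lambda>(i, j). (if i = j then 1 else 0) - M i j)"
  \<comment> \<open>The update Gamma - c b is factored as Gamma (1 - c' b), which leaves only
    \<open>det ?M\<close> to compute.\<close>
  have "GG (Suc k) = GG k * ?M"
  proof (rule eq_matI)
    fix i j assume "i < dim_row (GG k * ?M)" "j < dim_col (GG k * ?M)"
    then have ij: "i < d" "j < d" using schur_right_carrier[of d Zi W B C k] by auto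
    have "(\<Sum>t<d. rep (GG k $$ (i, t)) * c' t) =
        (\<Sum>t<d. \<Sum>s<d. rep (GG k $$ (i, t) * Gi $$ (t, s)) * cc k s)"
      by (simp add: c'_def sum_distrib_left mult.assoc Rep.hom_mult)
    also have "\<dots> = (\<Sum>s<d. rep ((GG k * Gi) $$ (i, s)) * cc k s)"
      using ij schur_right_carrier[of d Zi W B C k] Gi(1)
      by (subst sum.swap) (simp add: scalar_prod_def lessThan_atLeast0 Rep.hom_sum sum_distrib_right)
    also have "\<dots> = (\<Sum>s<d. if s = i then cc k s else 0)"
      using ij unfolding Gi(2) by (intro sum.cong) auto
    finally have c: "(\<Sum>t<d. rep (GG k $$ (i, t)) * c' t) = cc k i" using ij by simp
    have "rep ((GG k * ?M) $$ (i, j)) =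
        (\<Sum>t<d. (if t = j then rep (GG k $$ (i, t)) else 0) - rep (GG k $$ (i, t)) * c' t * B k j)"
      using ij schur_right_carrier[of d Zi W B C k]
      by (auto simp: scalar_prod_def lessThan_atLeast0 Rep.hom_sum Rep.hom_mult Rep.hom_minus M
          right_diff_distrib mult.assoc intro!: sum.cong)
    also have "\<dots> = rep (GG k $$ (i, j)) - cc k i * B k j"
      using ij by (simp add: sum_subtractf c flip: sum_distrib_right)
    also have "\<dots> = rep (GG (Suc k) $$ (i, j))"
      using ij k by (simp add: rep_schur_right_Suc)
    finally show "GG (Suc k) $$ (i, j) = (GG k * ?M) $$ (i, j)"
      by (simp add: Rep_even_series_inject)
  qed (simp_all add: schur_right_def)
  then have det: "det (GG (Suc k)) = det (GG k) * det ?M"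
    using det_mult[OF schur_right_carrier, of ?M] by simp
  have "det ?M = (if par k then f' else f)"
  proof (cases "par k")
    case False
    define b where "b i = Abs_even_series (B k i)" for i
    define e where "e i = Abs_even_series (c' i)" for i
    have b: "rep (b i) = B k i" if "i < d" for i
      unfolding b_def using Bk[OF that] False by (intro Rep_Abs_even_series) auto
    have e: "rep (e i) = c' i" if "i < d" for i
      unfolding e_def using c'[OF that] False by (intro Rep_Abs_even_series) auto
    have "M i j = e i * b j" if "i < d" "j < d" for i j
      using that by (simp add: M b e Rep.hom_mult flip: Rep_even_series_inject)
    then have "?M = mat d d (\<lambda>(i, j). (if i = j then 1 else 0) - e i * b j)"
      by (intro eq_matI) auto
    then have "det ?M = 1 - (\<Sum>i<d. b i * e i)" by (simp only: det_one_minus_rank_one)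
    also have "\<dots> = f"
      by (simp add: Rep.hom_mult Rep.hom_minus Rep.hom_sum b e f F_def flip: Rep_even_series_inject)
    finally show ?thesis using False by simp
  next
    case True
    have anti: "u * v = - (v * u)" if "u \<in> series_homog True" "v \<in> series_homog True"
      for u v :: "'g ssym fls fls"
      using series_homog_commute[OF that] by simp
    have c'o: "c' i \<in> series_homog True" and Bo: "B k i \<in> series_homog True" if "i < d" for i
      using c'[OF that] Bk[OF that] True by simp_all
    have MM: "M i j * M s t = - (M i t * M s j)" if "i < d" "j < d" "s < d" "t < d" for i j s t
    proof -
      have "c' i * B k j * (c' s * B k t) = c' i * (B k j * c' s) * B k t" by (simp only: mult.assoc)
      also have "\<dots> = - (c' i * c' s * (B k j * B k t))"
        unfolding anti[OF Bo[OF that(2)] c'o[OF that(3)]] by (simp add: mult.assoc)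
      also have "\<dots> = c' i * c' s * (B k t * B k j)"
        unfolding anti[OF Bo[OF that(2)] Bo[OF that(4)]] by simp
      also have "\<dots> = - (c' i * (B k t * c' s) * B k j)"
        unfolding anti[OF Bo[OF that(4)] c'o[OF that(3)]] by (simp add: mult.assoc)
      finally have "c' i * B k j * (c' s * B k t) = - (c' i * B k t * (c' s * B k j))"
        by (simp only: mult.assoc)
      then show ?thesis
        using that by (simp add: Rep.hom_mult Rep.hom_uminus M flip: Rep_even_series_inject)
    qed
    have sq: "M i i * M i i = 0" if "i < d" for i
    proof -
      have "c' i * B k i * (c' i * B k i) = c' i * (B k i * c' i) * B k i" by (simp only: mult.assoc)
      also have "\<dots> = - (c' i * c' i * (B k i * B k i))"
        unfolding anti[OF Bo[OF that] c'o[OF that]] by (simp add: mult.assoc)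
      finally have "c' i * B k i * (c' i * B k i) = 0"
        using series_odd_square[OF c'o[OF that]] by simp
      then show ?thesis
        using that by (simp add: Rep.hom_mult M flip: Rep_even_series_inject)
    qed
    \<comment> \<open>Exchanging two odd factors turns 1 - b c' into 1 plus the trace of
      \<open>M\<close>, which \<open>det_one_minus_odd_rank_one\<close> shows to be the inverse of
      \<open>det ?M\<close>.\<close>
    have "(\<Sum>i<d. B k i * c' i) = (\<Sum>i<d. - (c' i * B k i))"
      by (intro sum.cong refl anti Bo c'o) auto
    then have "1 + (\<Sum>i<d. M i i) = f"
      by (simp add: Rep.hom_add Rep.hom_sum M f F_def sum_negf flip: Rep_even_series_inject)
    with det_one_minus_odd_rank_one[of d M, OF MM sq] have 1: "det ?M * f = 1" by simp
    have "det ?M = det ?M * f * f'" unfolding mult.assoc ff' by simp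
    also have "\<dots> = f'" unfolding 1 by simp
    finally show ?thesis using True by simp
  qed
  with det have "det (GG (Suc k)) = det (GG k) * (if par k then f' else f)" by simp
  moreover have "ber_factor HH (Suc k) = rep (Z $$ (k, k) * f)"
    unfolding bf x by (simp add: Rep.hom_mult f rep_commute)
  moreover have "ring_inv (ber_factor HH (Suc k)) = rep (Zi $$ (k, k) * f')"
    unfolding rbf using zzi by (simp add: Rep.hom_mult f' flip: mult.assoc)
  ultimately show ?thesis using ff' that by blast
qed

text \<open>The induction on \<open>k\<close> carries the invertibility of \<open>det (GG k)\<close>
  along with the product formula, because \<open>schur_step\<close> needs it. At
  \<open>k = 0\<close> it comes from \<open>Wi\<close>, as \<open>GG 0 = W\<close>.\<close>

theorem berezinian_schur:
  assumes def: "berezinian_defined HH" and s: "\<And>i. i < N \<Longrightarrow> s ! i = 0 \<longleftrightarrow> \<not> par i"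
  shows "berezinian s HH * rep (det W) = rep (diag_factor Z Zi par N * det (GG N))"
proof -
  define fac where
    "fac i = (if s ! (i - 1) = 0 then ber_factor HH i else ring_inv (ber_factor HH i))" for i
  have "(\<exists>u. det (GG k) * u = 1) \<and>
    prod_list (map fac [1..<k + 1]) * rep (det W) = rep (diag_factor Z Zi par k * det (GG k))" if "k \<le> N" for k
    using that
  proof (induction k)
    case 0
    have "GG 0 = W" using W by (intro eq_matI) (auto simp: schur_right_def)
    moreover have "det W * det Wi = 1" using det_mult[OF W Wi] WWi by simp
    ultimately show ?case by (auto simp: diag_factor_def)
  next
    case (Suc k)
    then have k: "k < N" by simp
    from Suc.IH[OF less_imp_le[OF k]] obtain u where u: "det (GG k) * u = 1"
      and IH: "prod_list (map fac [1..<k + 1]) * rep (det W) = rep (diag_factor Z Zi par k * det (GG k))"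
      by blast
    obtain f f' where f: "f * f' = 1"
      "ber_factor HH (Suc k) = rep (Z $$ (k, k) * f)"
      "ring_inv (ber_factor HH (Suc k)) = rep (Zi $$ (k, k) * f')"
      "det (GG (Suc k)) = det (GG k) * (if par k then f' else f)"
      by (rule schur_step[OF k def u])
    define g where "g = (if par k then f' else f)"
    define g' where "g' = (if par k then f else f')"
    define z where "z = (if par k then Zi $$ (k, k) else Z $$ (k, k))"
    have gg: "g * g' = 1" using f(1) by (simp add: g_def g'_def mult.commute)
    have det: "det (GG (Suc k)) = det (GG k) * g" unfolding g_def by (rule f(4))
    have "det (GG (Suc k)) * (u * g') = (det (GG k) * u) * (g * g')"
      unfolding det by (simp only: ac_simps)
    then have ex: "\<exists>u. det (GG (Suc k)) * u = 1" unfolding u gg by auto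
    have fac: "fac (Suc k) = rep (z * g)"
      using s[OF k] f(2,3) by (simp add: fac_def z_def g_def)
    have "[1..<Suc k + 1] = [1..<k + 1] @ [Suc k]" by simp
    then have "prod_list (map fac [1..<Suc k + 1]) * rep (det W) =
        prod_list (map fac [1..<k + 1]) * (fac (Suc k) * rep (det W))"
      by (simp only: map_append prod_list.append) (simp add: mult.assoc)
    also have "\<dots> = prod_list (map fac [1..<k + 1]) * rep (det W) * fac (Suc k)"
      unfolding mult.assoc rep_commute[of "det W" "fac (Suc k)"] ..
    also have "\<dots> = rep (diag_factor Z Zi par k * det (GG k) * (z * g))"
      unfolding IH fac Rep.hom_mult ..
    also have "diag_factor Z Zi par k * det (GG k) * (z * g) = diag_factor Z Zi par (Suc k) * det (GG (Suc k))"
      unfolding det by (simp add: diag_factor_def z_def ac_simps)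
    finally show ?case using ex by blast
  qed
  moreover have "dim_row HH = N" by (simp add: schur_left_def)
  ultimately show ?thesis unfolding berezinian_def fac_def by simp
qed

end


section \<open>Series with coefficients in a subalgebra\<close>

lemma fls_const_ring_hom: "Ring_Hom.ring_hom (fls_const :: 'a::ring_1 \<Rightarrow> 'a fls)"
  by standard (auto intro!: fls_eqI)

interpretation const_hom: ring_hom "fls_const :: 'a::ring_1 \<Rightarrow> 'a fls"
  by (rule fls_const_ring_hom)

lemma ring_hom_comp: "Ring_Hom.ring_hom f \<Longrightarrow> Ring_Hom.ring_hom g \<Longrightarrow> Ring_Hom.ring_hom (\<lambda>x. f (g x))"
  by (simp add: Ring_Hom.ring_hom_def semiring_hom_def comm_monoid_add_hom_def monoid_add_hom_def
      zero_hom_def semigroup_add_hom_def plus_hom_def monoid_mult_hom_def one_hom_def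
      semigroup_mult_hom_def times_hom_def)

lemma map_fls_const: "h 0 = 0 \<Longrightarrow> map_fls h (fls_const c) = fls_const (h c)"
  by (intro fls_eqI) simp

lemma map_fls_X_inv: "h 0 = 0 \<Longrightarrow> h 1 = 1 \<Longrightarrow> map_fls h fls_X_inv = fls_X_inv"
  by (intro fls_eqI) simp

lemma (in ring_hom) hom_berezinian_defined:
  assumes A: "A \<in> carrier_mat n n" and def: "berezinian_defined A"
  shows "berezinian_defined (map_mat hom A)"
  unfolding berezinian_defined_def
proof
  fix i assume "i \<in> {1..dim_row (map_mat hom A)}"
  then have i: "i \<in> {1..n}" using A by auto
  with def A obtain B x where B: "B \<in> carrier_mat i i" "upper_left A i * B = 1\<^sub>m i"
    "B * upper_left A i = 1\<^sub>m i" "B $$ (i - 1, i - 1) * x = 1" "x * B $$ (i - 1, i - 1) = 1"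
    unfolding berezinian_defined_def by (metis carrier_matD(1))
  have dims: "i \<le> dim_row A" "i \<le> dim_col A" using A i by auto
  have "map_mat hom B $$ (i - 1, i - 1) * hom x = 1" "hom x * map_mat hom B $$ (i - 1, i - 1) = 1"
    using B i by (auto simp flip: hom_mult)
  moreover note map_upper_left_inverse[OF dims B(1-3)]
  moreover have "map_mat hom B \<in> carrier_mat i i" using B(1) by simp
  ultimately show "\<exists>B x. B \<in> carrier_mat i i \<and> upper_left (map_mat hom A) i * B = 1\<^sub>m i \<and>
     B * upper_left (map_mat hom A) i = 1\<^sub>m i \<and> B $$ (i - 1, i - 1) * x = 1 \<and> x * B $$ (i - 1, i - 1) = 1"
    by blast
qed

text \<open>Leibniz formula. \<open>R\<close> is a bare set, so that the lemma serves for scalar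
  coefficients and for order bounds alike.\<close>

lemma det_in_subring:
  fixes A :: "'a::comm_ring_1 mat"
  assumes A: "A \<in> carrier_mat n n" and entries: "\<And>i j. i < n \<Longrightarrow> j < n \<Longrightarrow> A $$ (i, j) \<in> R"
    and R: "1 \<in> R" "\<And>x y. x \<in> R \<Longrightarrow> y \<in> R \<Longrightarrow> x + y \<in> R"
      "\<And>x y. x \<in> R \<Longrightarrow> y \<in> R \<Longrightarrow> x * y \<in> R" "\<And>x. x \<in> R \<Longrightarrow> - x \<in> R"
  shows "det A \<in> R"
proof -
  have zero: "0 \<in> R" using R(2)[OF R(1) R(4)[OF R(1)]] by simp
  have sum: "sum f S \<in> R" if "\<And>s. s \<in> S \<Longrightarrow> f s \<in> R" for f :: "(nat \<Rightarrow> nat) \<Rightarrow> 'a" and S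
    using that by (induction S rule: infinite_finite_induct) (auto simp: zero R)
  have prod: "prod f S \<in> R" if "\<And>s. s \<in> S \<Longrightarrow> f s \<in> R" for f :: "nat \<Rightarrow> 'a" and S
    using that by (induction S rule: infinite_finite_induct) (auto simp: R)
  show ?thesis
    unfolding det_def'[OF A]
  proof (rule sum)
    fix p assume "p \<in> {p. p permutes {0..<n}}"
    then have p: "p permutes {0..<n}" by simp
    have "(\<Prod>i = 0..<n. A $$ (i, p i)) \<in> R"
      using p permutes_in_image[OF p] by (intro prod entries) auto
    then show "signof p * (\<Prod>i = 0..<n. A $$ (i, p i)) \<in> R"
      by (auto simp: sign_def R)
  qed
qed

lemma poisson_superalgebra_hom_ring_hom:
  assumes "poisson_superalgebra_hom c c' F"
  shows "Ring_Hom.ring_hom F" and "F (scal k) = scal k" and "x \<in> homog e \<Longrightarrow> F x \<in> homog e"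
proof -
  have F: "F 1 = 1" "F (x + y) = F x + F y" "F (scal k * x) = scal k * F x" "F (x * y) = F x * F y"
      "x \<in> homog e \<Longrightarrow> F x \<in> homog e" for x y k e
    using assms unfolding poisson_superalgebra_hom_def by blast+
  show "F (scal k) = scal k" for k using F(3)[of k 1] F(1) by simp
  from this[of 0] show "Ring_Hom.ring_hom F"
    by unfold_locales (simp_all add: F)
  show "x \<in> homog e \<Longrightarrow> F x \<in> homog e" by (rule F(5))
qed

lemma (in ring_hom) hom_sg: "hom (sg b) = sg b"
  by (cases b) (simp_all add: hom_uminus)

lemma image_subalgebra_gen:
  assumes "Ring_Hom.ring_hom F" and scal: "\<And>k. F (scal k) = scal k"
  shows "F ` subalgebra_gen S = subalgebra_gen (F ` S)"
proof -
  interpret ring_hom F by fact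
  have "F x \<in> subalgebra_gen (F ` S)" if "x \<in> subalgebra_gen S" for x
    using that by induction (auto simp: scal hom_add hom_mult intro: subalgebra_gen.intros)
  moreover have "y \<in> F ` subalgebra_gen S" if "y \<in> subalgebra_gen (F ` S)" for y
    using that
  proof induction
    case (scal k)
    then show ?case using scal[of k] assms(2)[of k] by (metis imageI subalgebra_gen.scal)
  next
    case (gen x)
    then show ?case by (auto intro: subalgebra_gen.gen)
  next
    case (add x y)
    then show ?case by (auto simp flip: hom_add intro!: imageI subalgebra_gen.add)
  next
    case (mult x y)
    then show ?case by (auto simp flip: hom_mult intro!: imageI subalgebra_gen.mult)
  qed
  ultimately show ?thesis by blast
qed

lemma subalgebra_gen_0: "0 \<in> subalgebra_gen S"
  using subalgebra_gen.scal[of 0 S] by simp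

lemma subalgebra_gen_sum: "(\<And>i. i \<in> A \<Longrightarrow> f i \<in> subalgebra_gen S) \<Longrightarrow> sum f A \<in> subalgebra_gen S"
  by (induction A rule: infinite_finite_induct) (auto intro: subalgebra_gen_0 subalgebra_gen.add)

lemma subalgebra_gen_subset:
  assumes "S \<subseteq> subalgebra_gen S'" shows "subalgebra_gen S \<subseteq> subalgebra_gen S'"
proof
  fix x assume "x \<in> subalgebra_gen S"
  then show "x \<in> subalgebra_gen S'"
    by induction (use assms in \<open>auto intro: subalgebra_gen.intros\<close>)
qed

section \<open>Coefficient algebras, scalar series and order bounds\<close>

definition series_over :: "'g::parity ssym set \<Rightarrow> 'g even_series set" where
  "series_over S = {f. \<forall>i j. fls_nth (fls_nth (Rep_even_series f) i) j \<in> subalgebra_gen S}"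

lemma series_over_mult: "f \<in> series_over S \<Longrightarrow> g \<in> series_over S \<Longrightarrow> f * g \<in> series_over S"
  by (auto simp: series_over_def Rep.hom_mult fls_times_nth(2) fls_nth_sum
      intro!: subalgebra_gen_sum subalgebra_gen.mult)

definition scalar_series :: "'g::parity even_series set" where
  "scalar_series = {f. \<forall>i j. fls_nth (fls_nth (Rep_even_series f) i) j \<in> range scal}"

text \<open>Every subalgebra contains the scalars. So multiplication by a scalar series keeps the
  coefficients inside a given subalgebra.\<close>

lemma scalar_series_subset: "scalar_series \<subseteq> series_over S"
  by (auto simp: scalar_series_def series_over_def) (metis rangeE subalgebra_gen.scal)

lemma range_scal:
  fixes x y :: "'g::parity ssym"
  shows "(0 :: 'g ssym) \<in> range scal" "(1 :: 'g ssym) \<in> range scal"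
    and "x \<in> range scal \<Longrightarrow> - x \<in> range scal"
    and "x \<in> range scal \<Longrightarrow> y \<in> range scal \<Longrightarrow> x + y \<in> range scal"
    and "x \<in> range scal \<Longrightarrow> y \<in> range scal \<Longrightarrow> x * y \<in> range scal"
proof -
  show "(0 :: 'g ssym) \<in> range scal" using rangeI[of scal 0] by simp
  show "(1 :: 'g ssym) \<in> range scal" using rangeI[of scal 1] by simp
  show "x \<in> range scal \<Longrightarrow> - x \<in> range scal" by (auto simp flip: scal_simps(4))
  show "x \<in> range scal \<Longrightarrow> y \<in> range scal \<Longrightarrow> x + y \<in> range scal" by (auto simp flip: scal_simps(3))
  show "x \<in> range scal \<Longrightarrow> y \<in> range scal \<Longrightarrow> x * y \<in> range scal" by (auto simp flip: scal_simps(6))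
qed

lemma range_scal_sum: "(\<And>i. i \<in> A \<Longrightarrow> f i \<in> range scal) \<Longrightarrow> sum f A \<in> range scal"
  by (induction A rule: infinite_finite_induct) (simp_all add: range_scal)

lemma range_scal_power: "scal k ^ i \<in> range scal"
  by (induction i) (simp_all add: range_scal)

lemma scalar_series_intros:
  "1 \<in> scalar_series"
  "f \<in> scalar_series \<Longrightarrow> g \<in> scalar_series \<Longrightarrow> f + g \<in> scalar_series"
  "f \<in> scalar_series \<Longrightarrow> g \<in> scalar_series \<Longrightarrow> f * g \<in> scalar_series"
  "f \<in> scalar_series \<Longrightarrow> - f \<in> scalar_series"
  by (simp_all add: scalar_series_def Rep.hom_add Rep.hom_uminus Rep.hom_mult fls_times_nth(2)
      fls_nth_sum range_scal range_scal_sum)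

lemma scalar_series_prod: "(\<And>i. i \<in> A \<Longrightarrow> f i \<in> scalar_series) \<Longrightarrow> prod f A \<in> scalar_series"
  by (induction A rule: infinite_finite_induct) (auto intro: scalar_series_intros)

lemma scalar_series_det:
  assumes "A \<in> carrier_mat n n" "\<And>i j. i < n \<Longrightarrow> j < n \<Longrightarrow> A $$ (i, j) \<in> scalar_series"
  shows "det A \<in> scalar_series"
  by (rule det_in_subring[OF assms]) (auto intro: scalar_series_intros)

text \<open>An upper bound for the powers of z, as the outer variable is z^-1. A bound, unlike the
  exact subdegree, passes to sums and products without case distinctions on zero.\<close>

definition vanishes_below :: "int \<Rightarrow> 'a::zero fls \<Rightarrow> bool" where
  "vanishes_below M f \<longleftrightarrow> (\<forall>i<M. fls_nth f i = 0)"

lemma vanishes_below_mult: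
  fixes f g :: "'a::semiring_0 fls"
  assumes "vanishes_below M f" "vanishes_below L g"
  shows "vanishes_below (M + L) (f * g)"
  using assms fls_times_nth_lower_bound[of M f L g] by (simp add: vanishes_below_def)

lemma vanishes_below_prod:
  fixes f :: "'i \<Rightarrow> 'g::parity even_series"
  assumes "finite A" "\<And>i. i \<in> A \<Longrightarrow> vanishes_below (M i) (Rep_even_series (f i))"
  shows "vanishes_below (\<Sum>i\<in>A. M i) (Rep_even_series (\<Prod>i\<in>A. f i))"
  using assms
  by (induction A rule: finite_induct) (auto simp: Rep.hom_mult vanishes_below_mult, auto simp: vanishes_below_def)

lemma vanishes_below_det:
  fixes A :: "'g::parity even_series mat"
  assumes "A \<in> carrier_mat n n" "\<And>i j. i < n \<Longrightarrow> j < n \<Longrightarrow> vanishes_below 0 (Rep_even_series (A $$ (i, j)))"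
  shows "vanishes_below 0 (Rep_even_series (det A))"
proof -
  have "det A \<in> {f. vanishes_below 0 (Rep_even_series f)}"
  proof (rule det_in_subring[OF assms(1)])
    show "x * y \<in> {f. vanishes_below 0 (Rep_even_series f)}"
      if "x \<in> {f. vanishes_below 0 (Rep_even_series f)}" "y \<in> {f. vanishes_below 0 (Rep_even_series f)}"
      for x y :: "'g even_series"
      using that vanishes_below_mult[of 0 "Rep_even_series x" 0 "Rep_even_series y"] by (simp add: Rep.hom_mult)
  qed (use assms(2) in \<open>auto simp: Rep.hom_add Rep.hom_uminus vanishes_below_def\<close>)
  then show ?thesis by simp
qed

lemma series_homog_scal: "fls_const (fls_const (scal k)) \<in> series_homog False"
  using homog_mon[of "[]" False k] by (intro series_homog_const) simp

section \<open>Scalars, variables and geometric series as even series\<close>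

definition even_scal :: "complex \<Rightarrow> 'g::parity even_series" where
  "even_scal k = Abs_even_series (fls_const (fls_const (scal k)))"

lemma Rep_even_scal: "Rep_even_series (even_scal k) = fls_const (fls_const (scal k))"
  by (simp add: even_scal_def Rep_Abs_even_series series_homog_scal)

lemma even_scal_0_1: "even_scal 0 = 0" "even_scal 1 = 1"
  by (simp_all add: Rep_even_scal flip: Rep_even_series_inject)

definition even_z :: "'g::parity even_series" where "even_z = Abs_even_series fls_X_inv"
definition even_w :: "'g::parity even_series" where "even_w = Abs_even_series (fls_const fls_X_inv)"

lemma Rep_even_zw: "Rep_even_series even_z = fls_X_inv" "Rep_even_series even_w = fls_const fls_X_inv"
  by (simp_all add: even_z_def even_w_def Rep_Abs_even_series series_homog_X_inv)

definition even_geom_z :: "complex \<Rightarrow> 'g::parity even_series" where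
  "even_geom_z k = Abs_even_series (fls_geom (fls_const (scal k)))"
definition even_geom_w :: "complex \<Rightarrow> 'g::parity even_series" where
  "even_geom_w k = Abs_even_series (fls_const (fls_geom (scal k)))"

lemma Rep_even_geom:
  "Rep_even_series (even_geom_z k) = fls_geom (fls_const (scal k))"
  "Rep_even_series (even_geom_w k) = fls_const (fls_geom (scal k))"
  by (simp_all add: even_geom_z_def even_geom_w_def Rep_Abs_even_series series_homog_geom)

lemma even_geom_inverse:
  "(even_z - even_scal k) * even_geom_z k = 1" "(even_w - even_scal k) * even_geom_w k = 1"
  by (simp_all add: Rep.hom_mult Rep.hom_minus Rep_even_scal Rep_even_zw Rep_even_geom fls_geom_inverse
      flip: Rep_even_series_inject const_hom.hom_minus const_hom.hom_mult)

lemma scalar_series_basic: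
  "even_scal k \<in> scalar_series" "even_z \<in> scalar_series" "even_w \<in> scalar_series"
  "even_geom_z k \<in> scalar_series" "even_geom_w k \<in> scalar_series"
  by (auto simp: scalar_series_def Rep_even_scal Rep_even_zw Rep_even_geom range_scal range_scal_power
      simp flip: fls_const_power)

context
  fixes F :: "gl_label ssym \<Rightarrow> 'g::parity ssym"
  assumes F_hom: "Ring_Hom.ring_hom F" and F_even: "\<And>x. F x \<in> homog False"
begin

definition series_hom :: "gl_label ssym fls \<Rightarrow> 'g even_series" where
  "series_hom f = Abs_even_series (map_fls (\<lambda>x. fls_const (F x)) f)"

text \<open>Substituting \<open>even_w\<close> for the polynomial variable brings the determinant, a
  polynomial in w, into the ring of series in z^-1 and w^-1 that contains the image of the
  Berezinian.\<close>

definition poly_series_hom :: "gl_label ssym fls poly \<Rightarrow> 'g even_series" where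
  "poly_series_hom P = poly (map_poly series_hom P) even_w"

lemma const_F_hom: "Ring_Hom.ring_hom (\<lambda>x. fls_const (F x))"
  by (rule ring_hom_comp[OF fls_const_ring_hom F_hom])

lemma const_F_0: "fls_const (F 0) = 0"
proof -
  interpret ring_hom F by (rule F_hom)
  show ?thesis by simp
qed

lemma Rep_series_hom: "Rep_even_series (series_hom f) = map_fls (\<lambda>x. fls_const (F x)) f"
  unfolding series_hom_def
  by (rule Rep_Abs_even_series, rule series_homogI) (simp add: const_F_0 F_even homog.zero)

lemma series_hom: "comm_ring_hom series_hom"
proof -
  interpret H: ring_hom "map_fls (\<lambda>x. fls_const (F x))"
    by (rule map_fls_ring_hom[OF const_F_hom])
  show ?thesis
    by unfold_locales
      (simp_all add: Rep_series_hom H.hom_add H.hom_mult Rep.hom_add Rep.hom_mult flip: Rep_even_series_inject)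
qed

lemma poly_series_hom: "comm_ring_hom poly_series_hom"
proof -
  interpret comm_ring_hom series_hom by (rule series_hom)
  interpret M: map_poly_comm_ring_hom series_hom ..
  show ?thesis
    by unfold_locales (simp_all add: poly_series_hom_def M.hom_add M.hom_mult)
qed

lemma poly_series_hom_const: "poly_series_hom [:f:] = series_hom f"
proof -
  interpret comm_ring_hom series_hom by (rule series_hom)
  show ?thesis by (simp add: poly_series_hom_def hom_distribs)
qed

lemma poly_series_hom_X: "poly_series_hom [:0, 1:] = even_w"
proof -
  interpret comm_ring_hom series_hom by (rule series_hom)
  show ?thesis by (simp add: poly_series_hom_def hom_distribs)
qed

text \<open>\<open>even_w\<close> is the inverse of the inner variable, so degree \<open>i\<close>
  lands at index \<open>- i\<close> and different degrees do not mix. The images of the generators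
  can therefore be read off the image of the determinant.\<close>

lemma poly_series_hom_nth:
  "fls_nth (fls_nth (Rep_even_series (poly_series_hom P)) s) j =
    (if j \<le> 0 then F (fls_nth (coeff P (nat (- j))) s) else 0)"
proof -
  interpret comm_ring_hom series_hom by (rule series_hom)
  interpret F: ring_hom F by (rule F_hom)
  have pw: "fls_nth (fls_X_inv ^ i :: 'g ssym fls) j = (if j = - int i then 1 else 0)" for i
    by (simp add: fls_X_inv_power_nth)
  have "poly_series_hom P = (\<Sum>i\<le>degree P. series_hom (coeff P i) * even_w ^ i)"
    unfolding poly_series_hom_def poly_map_poly_eval_poly
    by (subst eval_poly_as_sum) (simp_all add: mult.commute)
  then have "fls_nth (fls_nth (Rep_even_series (poly_series_hom P)) s) j =
      (\<Sum>i\<le>degree P. F (fls_nth (coeff P i) s) * (if j = - int i then 1 else 0))"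
    by (simp add: Rep.hom_sum Rep.hom_mult Rep.hom_power Rep_even_zw Rep_series_hom fls_nth_sum pw const_F_0
        flip: fls_const_power)
  also have "\<dots> = (\<Sum>i\<le>degree P. if i = nat (- j) then if j \<le> 0 then F (fls_nth (coeff P i) s) else 0 else 0)"
    by (intro sum.cong) auto
  finally show ?thesis by (auto simp: coeff_eq_0)
qed

end

lemma jordan_inv_in_subring:
  assumes "\<And>i. i \<in> {1..l} \<Longrightarrow> y i \<in> R" and "0 \<in> R" "1 \<in> R"
    and "\<And>a b. a \<in> R \<Longrightarrow> b \<in> R \<Longrightarrow> a + b \<in> R" "\<And>a b. a \<in> R \<Longrightarrow> b \<in> R \<Longrightarrow> a * b \<in> R"
  shows "jordan_inv l g y r s \<in> R"
proof -
  have power: "a ^ k \<in> R" if "a \<in> R" for a k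
    using that by (induction k) (auto simp: assms)
  have sum: "sum f A \<in> R" if "\<And>i. i \<in> A \<Longrightarrow> f i \<in> R" for f :: "nat \<Rightarrow> 'a" and A
    using that by (induction A rule: infinite_finite_induct) (auto simp: assms)
  show ?thesis
    unfolding jordan_inv_def by (intro sum) (use assms power in auto)
qed

lemma scalar_series_0: "0 \<in> scalar_series"
  by (simp add: scalar_series_def range_scal)

lemma scalar_series_diff: "f \<in> scalar_series \<Longrightarrow> g \<in> scalar_series \<Longrightarrow> f - g \<in> scalar_series"
  using scalar_series_intros(2)[OF _ scalar_series_intros(4)] by (metis add_uminus_conv_diff)

lemma vanishes_below_0: "vanishes_below M 0"
  by (simp add: vanishes_below_def)

lemma vanishes_below_const: "vanishes_below 0 (fls_const c)"
  by (simp add: vanishes_below_def)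

lemma vanishes_below_sum: "(\<And>i. i \<in> A \<Longrightarrow> vanishes_below M (f i)) \<Longrightarrow> vanishes_below M (sum f A)"
  by (simp add: vanishes_below_def fls_nth_sum)

lemma vanishes_below_diff:
  fixes f g :: "'a::group_add fls"
  shows "vanishes_below M f \<Longrightarrow> vanishes_below M g \<Longrightarrow> vanishes_below M (f - g)"
  by (simp add: vanishes_below_def)

lemma vanishes_below_sg:
  fixes f :: "'a::ring_1 fls"
  shows "vanishes_below M f \<Longrightarrow> vanishes_below M (sg b * f)"
  by (cases b) (simp_all add: vanishes_below_def)

lemma vanishes_below_mult_0:
  fixes f g :: "'a::semiring_0 fls"
  shows "vanishes_below 0 f \<Longrightarrow> vanishes_below 0 g \<Longrightarrow> vanishes_below 0 (f * g)"
  using vanishes_below_mult[of 0 f 0 g] by simp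

lemma vanishes_below_jordan_inv:
  assumes "\<And>i. i \<in> {1..l} \<Longrightarrow> vanishes_below 0 (Rep_even_series (y i))"
  shows "vanishes_below 0 (Rep_even_series (jordan_inv l g y r s))"
proof -
  have "jordan_inv l g y r s \<in> {f. vanishes_below 0 (Rep_even_series f)}"
    by (rule jordan_inv_in_subring)
      (use assms in \<open>auto simp: Rep.hom_add Rep.hom_mult vanishes_below_mult_0, auto simp: vanishes_below_def\<close>)
  then show ?thesis by simp
qed

lemma sum_lessThan_add:
  fixes f :: "nat \<Rightarrow> 'a::comm_monoid_add"
  shows "(\<Sum>i<a + b. f i) = (\<Sum>i<a. f i) + (\<Sum>i<b. f (a + i))"
  by (induction b) (simp_all add: add.assoc)


section \<open>Duality\<close>

lemma sg_mult_sg: "(sg b * x) * (sg c * y) = sg (b \<noteq> c) * (x * y :: 'a::ring_1)"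
  by (cases b; cases c) simp_all

context
  fixes d p q m n d' p' q' m' n' :: nat and xi gam :: "nat \<Rightarrow> nat" and w z :: "nat \<Rightarrow> complex"
  assumes d: "(\<Sum>a=1..d'. xi a) = d"
    and p: "(\<Sum>i=1..p'. gam i) = p" and q: "(\<Sum>i=1..q'. gam (p' + i)) = q"
    and m: "(\<Sum>i=1..m'. gam (p' + q' + i)) = m" and n: "(\<Sum>i=1..n'. gam (p' + q' + m' + i)) = n"
begin

private abbreviation (input) "N \<equiv> p + q + m + n"
private abbreviation (input) "l \<equiv> p' + q' + m' + n'"
private abbreviation (input) "par i \<equiv> ipar p q m (Suc i)"
private abbreviation (input) "const2 x \<equiv> fls_const (fls_const x)"
private abbreviation (input) "phi \<equiv> gaudin_phi d p q m p' q' l gam"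
private abbreviation (input) "varphi \<equiv> gaudin_varphi p q m n d' xi"

section \<open>The blocks Z, W, B, C for the given parameters\<close>

definition gZ :: "d_label even_series mat" where
  "gZ = jordan_char even_scal even_z l gam z N"
definition gZi :: "d_label even_series mat" where
  "gZi = jordan_char_inv l gam (\<lambda>i. even_geom_z (z i)) N"
definition gW :: "d_label even_series mat" where
  "gW = jordan_char even_scal even_w d' xi w d"
definition gWi :: "d_label even_series mat" where
  "gWi = jordan_char_inv d' xi (\<lambda>a. even_geom_w (w a)) d"

text \<open>With these signs \<open>gC\<^sub>a\<^sub>r gB\<^sub>s\<^sub>b\<close> carries the sign of \<open>phi\<close> on the Jordan block containing \<open>r\<close> and \<open>s\<close>, while
  \<open>gB\<^sub>i\<^sub>a gC\<^sub>b\<^sub>j\<close> carries the sign of \<open>varphi\<close> together with the factor \<open>(-1)\<^sup>|\<^sup>i\<^sup>|\<close> of the Gaudin matrix.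
  The factor \<open>W\<close> of the other side is transposed.\<close>

definition gB :: "nat \<Rightarrow> nat \<Rightarrow> d_label ssym fls fls" where
  "gB i a = sg (par i) * const2 (gen (VV p q m (Suc a) (Suc i)))"
definition gC :: "nat \<Rightarrow> nat \<Rightarrow> d_label ssym fls fls" where
  "gC a j = sg (column_sign p q m (Suc j)) * const2 (gen (VU p q m (Suc a) (Suc j)))"

lemma N_offset: "N = offset gam (Suc l)"
  using offsets(4)[OF p q m n] by simp

lemma d_offset: "d = offset xi (Suc d')"
  using d by (simp add: offset_def atLeastLessThanSuc_atLeastAtMost)

lemmas gZ_mult = jordan_char_mult_inv[where h = "even_scal :: complex \<Rightarrow> d_label even_series" and x = even_z and l = l and g = gam and v = z
      and y = "\<lambda>i. even_geom_z (z i)" and N = N,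
      OF even_scal_0_1 even_geom_inverse(1) N_offset, folded gZ_def gZi_def]
  and gZ_lower = jordan_char_lower[where h = "even_scal :: complex \<Rightarrow> d_label even_series" and x = even_z and l = l and g = gam and v = z
      and y = "\<lambda>i. even_geom_z (z i)" and N = N,
      OF even_scal_0_1 even_geom_inverse(1) N_offset, folded gZ_def]
  and gZ_nth = jordan_char_nth[where h = "even_scal :: complex \<Rightarrow> d_label even_series" and x = even_z and l = l and g = gam and v = z
      and y = "\<lambda>i. even_geom_z (z i)" and N = N,
      OF even_scal_0_1 even_geom_inverse(1) N_offset, folded gZ_def]
  and gW_mult = jordan_char_mult_inv[where h = "even_scal :: complex \<Rightarrow> d_label even_series" and x = even_w and l = d' and g = xi and v = w
      and y = "\<lambda>a. even_geom_w (w a)" and N = d,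
      OF even_scal_0_1 even_geom_inverse(2) d_offset, folded gW_def gWi_def]

lemma gZ_carrier: "gZ \<in> carrier_mat N N" and gZi_carrier: "gZi \<in> carrier_mat N N"
  and gW_carrier: "gW \<in> carrier_mat d d" and gWi_carrier: "gWi \<in> carrier_mat d d"
  unfolding gZ_def gZi_def gW_def gWi_def by (rule jordan_char_carrier jordan_char_inv_carrier)+

lemma gZi_mult: "gZi * gZ = 1\<^sub>m N"
  by (rule right_inverse_imp_left_inverse_mat[OF gZ_carrier gZi_carrier gZ_mult])

lemma gWi_mult: "gWi * gW = 1\<^sub>m d"
  by (rule right_inverse_imp_left_inverse_mat[OF gW_carrier gWi_carrier gW_mult])

lemma gW_transpose_mult: "gW\<^sup>T * gWi\<^sup>T = 1\<^sub>m d"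
  using transpose_mult[OF gWi_carrier gW_carrier] gWi_mult by simp

lemma gZi_lower: "s < r \<Longrightarrow> r < N \<Longrightarrow> gZi $$ (r, s) = 0"
  unfolding gZi_def by (rule jordan_char_inv_lower)

text \<open>A nonzero entry of \<open>gZi\<close> stays within one Jordan block, and parity is
  constant on a block because the block sizes are grouped to fill \<open>p\<close>,
  \<open>q\<close>, \<open>m\<close> and \<open>n\<close> separately.\<close>

lemma gZi_par:
  assumes "r < N" "s < N" "gZi $$ (r, s) \<noteq> 0"
  shows "par r = par s"
proof -
  have "jordan_inv l gam (\<lambda>i. even_geom_z (z i) :: d_label even_series) r s \<noteq> 0"
    using assms by (simp add: gZi_def jordan_char_inv_def)
  then obtain i where i: "i \<in> {1..l}" "offset gam i \<le> r" "r \<le> s" "s < offset gam (Suc i)"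
    by (rule jordan_inv_nonzero_block)
  show ?thesis
    using block(2)[OF p q m n i(1), of "Suc r"] block(2)[OF p q m n i(1), of "Suc s"] i by simp
qed

lemma gB_homog: "gB i a \<in> series_homog (par i)"
  unfolding gB_def using homog_gen[of "VV p q m (Suc a) (Suc i)"]
  by (intro series_homog_sg series_homog_const) (simp add: podd_UV)

lemma gC_homog: "gC a j \<in> series_homog (par j)"
  unfolding gC_def using homog_gen[of "VU p q m (Suc a) (Suc j)"]
  by (intro series_homog_sg series_homog_const) (simp add: podd_UV)

lemma gW_transpose_carrier: "gW\<^sup>T \<in> carrier_mat d d" "gWi\<^sup>T \<in> carrier_mat d d"
  using gW_carrier gWi_carrier by simp_all

lemmas schur_facts = gZ_carrier gZi_carrier gW_transpose_carrier gZi_mult gW_transpose_mult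
  gZ_lower gZi_lower gZi_par gB_homog gC_homog

section \<open>Images of the two Gaudin matrices\<close>

lemmas phi_hom = poisson_superalgebra_hom_ring_hom[OF gaudin_phi_poisson_hom[OF p q m n, of d]]
lemmas varphi_hom = poisson_superalgebra_hom_ring_hom[OF gaudin_varphi_poisson_hom[of p q m n d' xi]]

lemma phi_even: "phi x \<in> homog False"
proof (rule phi_hom(3))
  have "wpar u = False" for u :: "gl_label list" by (induction u) auto
  then show "x \<in> homog False"
    by (induction x rule: ssym_induct) (auto intro: homog_mon homog_add)
qed

text \<open>In the image of \<open>e_ab\<close> the factor with superscript \<open>b\<close> comes
  before the one with \<open>a\<close>, so entry \<open>(a, b)\<close> pairs row \<open>b\<close> of
  \<open>gC\<close> with column \<open>a\<close> of \<open>gB\<close>.\<close>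

lemma map_gl_gaudin_matrix:
  "map_mat (poly_series_hom phi) (gl_gaudin_matrix d d' xi w l gam z) = (schur_right d gZi gW\<^sup>T gB gC N)\<^sup>T"
proof (rule eq_matI)
  fix a b
  assume "a < dim_row (schur_right d gZi gW\<^sup>T gB gC N)\<^sup>T" "b < dim_col (schur_right d gZi gW\<^sup>T gB gC N)\<^sup>T"
  then have ab: "a < d" "b < d" by (simp_all add: schur_right_def)
  interpret S: comm_ring_hom "series_hom phi" by (rule series_hom[OF phi_hom(1) phi_even])
  interpret P: comm_ring_hom "poly_series_hom phi" by (rule poly_series_hom[OF phi_hom(1) phi_even])
  interpret H: ring_hom "map_fls (\<lambda>x. fls_const (phi x))"
    by (rule map_fls_ring_hom[OF const_F_hom[OF phi_hom(1) phi_even]])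
  note Rep_S = Rep_series_hom[OF phi_hom(1) phi_even]
  note P_const = poly_series_hom_const[OF phi_hom(1) phi_even]
  have c0: "fls_const (phi 0) = 0" by (rule const_F_0[OF phi_hom(1) phi_even])
  define y :: "nat \<Rightarrow> d_label ssym fls fls" where "y i = fls_geom (fls_const (scal (z i)))" for i
  define U where "U r = sg (column_sign p q m r) * const2 (gen (VU p q m (Suc b) r))" for r
  define V where "V s = sg (ipar p q m s) * const2 (gen (VV p q m (Suc a) s))" for s
  have elem: "const2 (phi (gl_elem gam i k (Suc a) (Suc b))) =
      (\<Sum>r\<in>{offset gam i + 1..offset gam (i + 1) - k}. U r * V (r + k))"
    if i: "i \<in> {1..l}" for i k
  proof -
    have "const2 (phi (gl_elem gam i k (Suc a) (Suc b))) =
        (\<Sum>r\<in>{offset gam i + 1..offset gam (i + 1) - k}. sg (block_sign p' q' m' i) *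
          (const2 (gen (VU p q m (Suc b) r)) * const2 (gen (VV p q m (Suc a) (r + k)))))"
      unfolding gaudin_phi_def using Phi_elem[OF p q m n i, of "Suc a" d "Suc b" k] ab
      by (simp add: phi_sum_def[OF p q m n] const_hom.hom_mult const_hom.hom_sg const_hom.hom_sum
          sum_distrib_left del: fls_const_mult_const)
    also have "\<dots> = (\<Sum>r\<in>{offset gam i + 1..offset gam (i + 1) - k}. U r * V (r + k))"
    proof (intro sum.cong refl)
      fix r assume r: "r \<in> {offset gam i + 1..offset gam (i + 1) - k}"
      note b1 = block(1)[OF p q m n i range_le(1,2)[OF r]]
        and b2 = block(2)[OF p q m n i range_le(1,2)[OF r]] block(2)[OF p q m n i range_le(3,4)[OF r]]
      \<comment> \<open>For \<open>r \<le> p + q\<close> exactly one of the two signs is negative,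
        which gives the minus sign of \<open>phi\<close> on these blocks. Beyond,
        \<open>column_sign\<close> is false and only the parity remains.\<close>
      have "block_sign p' q' m' i = (column_sign p q m r \<noteq> ipar p q m (r + k))"
        unfolding block_sign_def[OF p q m n] column_sign_def b1 b2 by auto
      then show "sg (block_sign p' q' m' i) *
          (const2 (gen (VU p q m (Suc b) r)) * const2 (gen (VV p q m (Suc a) (r + k)))) = U r * V (r + k)"
        unfolding U_def V_def sg_mult_sg by simp
    qed
    finally show ?thesis .
  qed
  have summand: "rep (poly_series_hom phi [:fls_const (gl_elem gam i k (Suc a) (Suc b)) *
        ring_inv ((fls_X_inv - fls_const (scal (z i))) ^ (k + 1)):]) =
      (\<Sum>r\<in>{offset gam i + 1..offset gam (i + 1) - k}. U r * V (r + k) * y i ^ (k + 1))"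
    if "i \<in> {1..l}" for i k
    unfolding P_const Rep_S ring_inv_linear_power H.hom_mult H.hom_power
      map_fls_geom[OF const_F_hom[OF phi_hom(1) phi_even]] map_fls_const[where h = "\<lambda>x. fls_const (phi x)", OF c0]
      phi_hom(2) elem[OF that] sum_distrib_right y_def ..
  have J: "rep (poly_series_hom phi [:fls_const (scal k):]) = const2 (scal k)" for k
    unfolding P_const Rep_S map_fls_const[where h = "\<lambda>x. fls_const (phi x)", OF c0] phi_hom(2) ..
  have "gl_gaudin_matrix d d' xi w l gam z $$ (a, b) =
     (if a = b then [:0, 1:] else 0) - [:fls_const (scal (block_jordan d' xi w $$ (a, b))):]
     - (\<Sum>i=1..l. \<Sum>k<gam i. [:fls_const (gl_elem gam i k (Suc a) (Suc b))
            * ring_inv ((fls_X_inv - fls_const (scal (z i))) ^ (k + 1)):])"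
    using ab by (simp add: gl_gaudin_matrix_def)
  moreover have "rep (poly_series_hom phi (\<Sum>i=1..l. \<Sum>k<gam i. [:fls_const (gl_elem gam i k (Suc a) (Suc b))
            * ring_inv ((fls_X_inv - fls_const (scal (z i))) ^ (k + 1)):])) =
      (\<Sum>i=1..l. \<Sum>k<gam i. \<Sum>r\<in>{offset gam i + 1..offset gam (i + 1) - k}. U r * V (r + k) * y i ^ (k + 1))"
    unfolding P.hom_sum Rep.hom_sum by (intro sum.cong refl summand)
  moreover have "rep (poly_series_hom phi (if a = b then [:0, 1:] else 0)) - const2 (scal (block_jordan d' xi w $$ (a, b))) =
      rep (gW $$ (a, b))"
    using ab by (simp add: gW_def jordan_char_def Rep.hom_minus Rep_even_scal poly_series_hom_X[OF phi_hom(1) phi_even])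
  ultimately have "rep (poly_series_hom phi (gl_gaudin_matrix d d' xi w l gam z $$ (a, b))) =
      rep (gW $$ (a, b)) - (\<Sum>i=1..l. \<Sum>k<gam i. \<Sum>r\<in>{offset gam i + 1..offset gam (i + 1) - k}.
        U r * V (r + k) * y i ^ (k + 1))"
    by (simp only: P.hom_minus Rep.hom_minus J)
  also have "(\<Sum>i=1..l. \<Sum>k<gam i. \<Sum>r\<in>{offset gam i + 1..offset gam (i + 1) - k}.
        U r * V (r + k) * y i ^ (k + 1)) =
      (\<Sum>r<N. \<Sum>s<N. U (r + 1) * V (s + 1) * jordan_inv l gam y r s)"
    unfolding N_offset by (rule sum_blocks_jordan_inv)
  also have "\<dots> = (\<Sum>r<N. \<Sum>s<N. gC b r * rep (gZi $$ (r, s)) * gB s a)"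
  proof (intro sum.cong refl)
    fix r s assume rs: "r \<in> {..<N}" "s \<in> {..<N}"
    have "rep (gZi $$ (r, s)) = jordan_inv l gam y r s"
      using rs by (simp add: gZi_def jordan_char_inv_def ring_hom.hom_jordan_inv[OF Rep.ring_hom_axioms] Rep_even_geom y_def[abs_def])
    then show "U (r + 1) * V (s + 1) * jordan_inv l gam y r s = gC b r * rep (gZi $$ (r, s)) * gB s a"
      unfolding mult.assoc rep_commute[of "gZi $$ (r, s)" "gB s a"] by (simp add: gB_def gC_def U_def V_def)
  qed
  also have "rep (gW $$ (a, b)) - \<dots> = rep (schur_right d gZi gW\<^sup>T gB gC N $$ (b, a))"
    using ab gW_carrier by (simp add: rep_schur_right[OF schur_facts])
  finally show "map_mat (poly_series_hom phi) (gl_gaudin_matrix d d' xi w l gam z) $$ (a, b) =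
      (schur_right d gZi gW\<^sup>T gB gC N)\<^sup>T $$ (a, b)"
    using ab by (simp add: Rep_even_series_inject gl_gaudin_matrix_def schur_right_def)
qed (simp_all add: gl_gaudin_matrix_def schur_right_def)

text \<open>The shift by \<open>k\<close> sits on the first factor in \<open>varphi\<close>, so
  \<open>gB\<close> carries the larger superscript and the upper triangular \<open>gWi\<close>
  enters transposed.\<close>

lemma map_gls_gaudin_matrix:
  "map_mat (map_fls (map_fls varphi)) (gls_gaudin_matrix p q m n d' xi w l gam z) =
    schur_left N d gZ gWi\<^sup>T gB gC"
proof (rule eq_matI)
  fix i j
  assume "i < dim_row (schur_left N d gZ gWi\<^sup>T gB gC)" "j < dim_col (schur_left N d gZ gWi\<^sup>T gB gC)"
  then have ij: "i < N" "j < N" by (simp_all add: schur_left_def)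
  interpret F: ring_hom varphi by (rule varphi_hom(1))
  interpret F1: ring_hom "map_fls varphi" by (rule map_fls_ring_hom[OF varphi_hom(1)])
  interpret F2: ring_hom "map_fls (map_fls varphi)" by (rule map_fls_ring_hom[OF F1.ring_hom_axioms])
  have F1_const: "map_fls varphi (fls_const u) = fls_const (varphi u)" for u
    by (rule map_fls_const) simp
  have F2_const: "map_fls (map_fls varphi) (fls_const u) = fls_const (map_fls varphi u)" for u
    by (rule map_fls_const) simp
  define y :: "nat \<Rightarrow> d_label ssym fls fls" where "y a = fls_const (fls_geom (scal (w a)))" for a
  define U where "U r = sg (column_sign p q m (Suc j)) * const2 (gen (VU p q m r (Suc j)))" for r
  define V where "V s = const2 (gen (VV p q m s (Suc i)))" for s
  have elem: "const2 (varphi (gls_elem p q m xi a k (Suc i) (Suc j))) =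
      (\<Sum>r\<in>{offset xi a + 1..offset xi (a + 1) - k}. V (r + k) * U r)"
    if a: "a \<in> {1..d'}" for a k
  proof -
    have "const2 (varphi (gls_elem p q m xi a k (Suc i) (Suc j))) =
        (\<Sum>r\<in>{offset xi a + 1..offset xi (a + 1) - k}. sg (column_sign p q m (Suc j)) *
          (const2 (gen (VV p q m (r + k) (Suc i))) * const2 (gen (VU p q m r (Suc j)))))"
      unfolding gaudin_varphi_def using VPhi_elem[OF a, of "Suc i" p q m n "Suc j" xi k] ij
      by (simp add: varphi_sum_def const_hom.hom_mult const_hom.hom_sg const_hom.hom_sum
          sum_distrib_left del: fls_const_mult_const)
    also have "\<dots> = (\<Sum>r\<in>{offset xi a + 1..offset xi (a + 1) - k}. V (r + k) * U r)"
      by (intro sum.cong refl) (cases "column_sign p q m (Suc j)"; simp add: U_def V_def del: fls_const_mult_const)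
    finally show ?thesis .
  qed
  have summand: "map_fls (map_fls varphi) (fls_const (fls_const (gls_elem p q m xi a k (Suc i) (Suc j)) *
        ring_inv ((fls_X_inv - fls_const (scal (w a))) ^ (k + 1)))) =
      (\<Sum>r\<in>{offset xi a + 1..offset xi (a + 1) - k}. V (r + k) * U r * y a ^ (k + 1))"
    if "a \<in> {1..d'}" for a k
  proof -
    have "map_fls varphi (fls_const (gls_elem p q m xi a k (Suc i) (Suc j)) *
          ring_inv ((fls_X_inv - fls_const (scal (w a))) ^ (k + 1))) =
        fls_const (varphi (gls_elem p q m xi a k (Suc i) (Suc j))) * fls_geom (scal (w a)) ^ (k + 1)"
      unfolding ring_inv_linear_power F1.hom_mult F1.hom_power map_fls_geom[OF varphi_hom(1)] F1_const
        varphi_hom(2) ..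
    then show ?thesis
      unfolding F2_const by (simp only: const_hom.hom_mult const_hom.hom_power elem[OF that] sum_distrib_right y_def)
  qed
  have "gls_gaudin_matrix p q m n d' xi w l gam z $$ (i, j) =
     (if i = j then fls_X_inv else 0) - fls_const (fls_const (scal (block_jordan l gam z $$ (i, j))))
     - sg (par i) * (\<Sum>a=1..d'. \<Sum>k<xi a. fls_const (fls_const (gls_elem p q m xi a k (Suc i) (Suc j))
            * ring_inv ((fls_X_inv - fls_const (scal (w a))) ^ (k + 1))))"
    using ij by (simp add: gls_gaudin_matrix_def)
  moreover have "map_fls (map_fls varphi) (\<Sum>a=1..d'. \<Sum>k<xi a.
        fls_const (fls_const (gls_elem p q m xi a k (Suc i) (Suc j))
            * ring_inv ((fls_X_inv - fls_const (scal (w a))) ^ (k + 1)))) =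
      (\<Sum>a=1..d'. \<Sum>k<xi a. \<Sum>r\<in>{offset xi a + 1..offset xi (a + 1) - k}. V (r + k) * U r * y a ^ (k + 1))"
    unfolding F2.hom_sum by (intro sum.cong refl summand)
  moreover have "map_fls (map_fls varphi) (if i = j then fls_X_inv else 0) -
      map_fls (map_fls varphi) (fls_const (fls_const (scal (block_jordan l gam z $$ (i, j))))) = rep (gZ $$ (i, j))"
    using ij map_fls_X_inv[of "map_fls varphi"]
    by (simp add: gZ_def jordan_char_def Rep.hom_minus Rep_even_scal Rep_even_zw F1_const F2_const varphi_hom(2))
  ultimately have "map_fls (map_fls varphi) (gls_gaudin_matrix p q m n d' xi w l gam z $$ (i, j)) =
      rep (gZ $$ (i, j)) - sg (par i) * (\<Sum>a=1..d'. \<Sum>k<xi a.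
        \<Sum>r\<in>{offset xi a + 1..offset xi (a + 1) - k}. V (r + k) * U r * y a ^ (k + 1))"
    by (simp only: F2.hom_minus F2.hom_mult F2.hom_sg)
  also have "(\<Sum>a=1..d'. \<Sum>k<xi a.
        \<Sum>r\<in>{offset xi a + 1..offset xi (a + 1) - k}. V (r + k) * U r * y a ^ (k + 1)) =
      (\<Sum>r<d. \<Sum>s<d. V (s + 1) * U (r + 1) * jordan_inv d' xi y r s)"
    unfolding d_offset by (rule sum_blocks_jordan_inv[where F = "\<lambda>r s. V s * U r"])
  also have "sg (par i) * \<dots> = (\<Sum>r<d. \<Sum>s<d. gB i s * rep (gWi\<^sup>T $$ (s, r)) * gC r j)"
    unfolding sum_distrib_left
  proof (intro sum.cong refl)
    fix r s assume rs: "r \<in> {..<d}" "s \<in> {..<d}"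
    have "rep (gWi\<^sup>T $$ (s, r)) = jordan_inv d' xi y r s"
      using rs by (simp add: gWi_def jordan_char_inv_def ring_hom.hom_jordan_inv[OF Rep.ring_hom_axioms]
          Rep_even_geom y_def[abs_def])
    then show "sg (par i) * (V (s + 1) * U (r + 1) * jordan_inv d' xi y r s) =
        gB i s * rep (gWi\<^sup>T $$ (s, r)) * gC r j"
      unfolding mult.assoc rep_commute[of "gWi\<^sup>T $$ (s, r)" "gC r j"] by (simp add: gB_def gC_def U_def V_def mult.assoc)
  qed
  also have "\<dots> = (\<Sum>s<d. \<Sum>r<d. gB i s * rep (gWi\<^sup>T $$ (s, r)) * gC r j)"
    by (rule sum.swap)
  finally show "map_mat (map_fls (map_fls varphi)) (gls_gaudin_matrix p q m n d' xi w l gam z) $$ (i, j) =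
      schur_left N d gZ gWi\<^sup>T gB gC $$ (i, j)"
    using ij by (simp add: schur_left_def gls_gaudin_matrix_def)
qed (simp_all add: gls_gaudin_matrix_def schur_left_def)

text \<open>Apart from z on the diagonal, the entries are constant in the outer variable, with
  coefficients in the ring of series in w^-1.\<close>

lemma gls_gaudin_matrix_berezinian_defined:
  "berezinian_defined (gls_gaudin_matrix p q m n d' xi w l gam z)"
proof (rule berezinian_defined_linear)
  let ?K = "mat N N (\<lambda>(i, j). fls_const (scal (block_jordan l gam z $$ (i, j))) +
     sg (par i) * (\<Sum>a=1..d'. \<Sum>k<xi a. fls_const (gls_elem p q m xi a k (Suc i) (Suc j))
            * ring_inv ((fls_X_inv - fls_const (scal (w a))) ^ (k + 1))))"
  show "?K \<in> carrier_mat N N" by simp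
  show "gls_gaudin_matrix p q m n d' xi w l gam z =
      mat N N (\<lambda>(i, j). (if i = j then fls_X_inv else 0) - fls_const (?K $$ (i, j)))"
    unfolding gls_gaudin_matrix_def
    by (intro eq_matI) (simp_all add: const_hom.hom_add const_hom.hom_mult const_hom.hom_sum const_hom.hom_sg
        del: fls_const_mult_const)
qed

private abbreviation (input) "parities \<equiv> replicate p 0 @ replicate q 1 @ replicate m 0 @ replicate n (1::nat)"

lemma parities_nth: "i < N \<Longrightarrow> parities ! i = 0 \<longleftrightarrow> \<not> par i"
  by (auto simp: nth_append ipar_def)

text \<open>Both transpositions disappear when determinants are taken.\<close>

lemma map_berezinian:
  "map_fls (map_fls varphi) (berezinian parities (gls_gaudin_matrix p q m n d' xi w l gam z)) * rep (det gW) =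
   rep (diag_factor gZ gZi (\<lambda>i. par i) N *
     poly_series_hom phi (det (gl_gaudin_matrix d d' xi w l gam z)))"
proof -
  interpret F2: ring_hom "map_fls (map_fls varphi)"
    by (intro map_fls_ring_hom varphi_hom(1))
  interpret P: comm_ring_hom "poly_series_hom phi" by (rule poly_series_hom[OF phi_hom(1) phi_even])
  have c: "gls_gaudin_matrix p q m n d' xi w l gam z \<in> carrier_mat N N"
    by (simp add: gls_gaudin_matrix_def)
  note def = gls_gaudin_matrix_berezinian_defined
  have def': "berezinian_defined (schur_left N d gZ gWi\<^sup>T gB gC)"
    using F2.hom_berezinian_defined[OF c def] unfolding map_gls_gaudin_matrix .
  have "poly_series_hom phi (det (gl_gaudin_matrix d d' xi w l gam z)) = det (schur_right d gZi gW\<^sup>T gB gC N)"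
    unfolding P.hom_det[symmetric] map_gl_gaudin_matrix by (rule det_transpose[OF schur_right_carrier])
  moreover have "det gW\<^sup>T = det gW" by (rule det_transpose[OF gW_carrier])
  ultimately show ?thesis
    using berezinian_schur[OF schur_facts def' parities_nth]
    unfolding F2.hom_berezinian[OF c def] map_gls_gaudin_matrix by simp
qed

section \<open>Scalar factors and the coefficients outside the generators\<close>

lemma gZ_diag:
  assumes "i < N"
  obtains k where "gZ $$ (i, i) = even_z - even_scal k" "gZi $$ (i, i) = even_geom_z k"
proof -
  obtain b where b: "b \<in> {1..l}" "offset gam b \<le> i" "i < offset gam (Suc b)"
    using offset_block_exists assms N_offset by metis
  have "gZ $$ (i, i) = even_z - even_scal (z b)" using gZ_nth[OF b assms] by simp
  moreover have "gZi $$ (i, i) = even_geom_z (z b)"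
    using assms b by (simp add: gZi_def jordan_char_inv_def jordan_inv_eq[OF b])
  ultimately show ?thesis by (rule that)
qed

lemma diag_factor_inverse: "diag_factor gZi gZ (\<lambda>i. par i) N * diag_factor gZ gZi (\<lambda>i. par i) N = 1"
proof -
  have "gZ $$ (i, i) * gZi $$ (i, i) = 1" if "i < N" for i
    using gZ_diag[OF that] by (metis even_geom_inverse(1))
  then show ?thesis
    unfolding diag_factor_def prod.distrib[symmetric] by (intro prod.neutral) (auto simp: mult.commute)
qed

lemma scalar_series_gZ_diag:
  assumes "i < N" shows "gZ $$ (i, i) \<in> scalar_series" "gZi $$ (i, i) \<in> scalar_series"
  using gZ_diag[OF assms] by (metis scalar_series_basic(1,2) scalar_series_diff, metis scalar_series_basic(4))

lemma scalar_series_diag_factor: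
  "diag_factor gZ gZi (\<lambda>i. par i) N \<in> scalar_series" "diag_factor gZi gZ (\<lambda>i. par i) N \<in> scalar_series"
  unfolding diag_factor_def by (intro scalar_series_prod; simp add: scalar_series_gZ_diag)+

lemma scalar_series_det_gW: "det gW \<in> scalar_series" "det gWi \<in> scalar_series"
proof -
  show "det gW \<in> scalar_series"
    by (rule scalar_series_det[OF gW_carrier])
      (auto simp: gW_def jordan_char_def intro!: scalar_series_diff scalar_series_intros(4) scalar_series_basic)
  have "jordan_inv d' xi (\<lambda>a. even_geom_w (w a) :: d_label even_series) r s \<in> scalar_series" for r s
    by (rule jordan_inv_in_subring) (auto intro: scalar_series_basic scalar_series_0 scalar_series_intros)
  then show "det gWi \<in> scalar_series"
    by (intro scalar_series_det[OF gWi_carrier]) (simp add: gWi_def jordan_char_inv_def)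
qed

lemma det_gW_inverse: "det gW * det gWi = 1"
  using det_mult[OF gW_carrier gWi_carrier] gW_mult by simp

text \<open>Each of the p + m even indices contributes z - k, of order -1 in z^-1, and each of the q
  + n odd ones a geometric series of order 1.\<close>

lemma vanishes_below_diag_factor:
  "vanishes_below (int q + int n - int p - int m) (rep (diag_factor gZ gZi (\<lambda>i. par i) N))"
proof -
  have "vanishes_below (\<Sum>i<N. if par i then 1 else - 1) (rep (\<Prod>i<N. if par i then gZi $$ (i, i) else gZ $$ (i, i)))"
  proof (rule vanishes_below_prod)
    fix i assume "i \<in> {..<N}"
    then obtain k where k: "gZ $$ (i, i) = even_z - even_scal k" "gZi $$ (i, i) = even_geom_z k"
      using gZ_diag[of i] by blast
    show "vanishes_below (if par i then 1 else - 1) (rep (if par i then gZi $$ (i, i) else gZ $$ (i, i)))"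
      unfolding k by (auto simp: Rep.hom_minus Rep_even_zw Rep_even_scal Rep_even_geom vanishes_below_def)
  qed simp
  moreover have "(\<Sum>i<N. if par i then 1 else - 1 :: int) = int q + int n - int p - int m"
    by (simp add: sum_lessThan_add ipar_def)
  ultimately show ?thesis by (simp add: diag_factor_def)
qed

text \<open>The outer variable enters only through \<open>gZi\<close>, whose entries contain no
  positive power of z.\<close>

lemma vanishes_below_poly_series_hom_det:
  "vanishes_below 0 (rep (poly_series_hom phi (det (gl_gaudin_matrix d d' xi w l gam z))))"
proof -
  interpret P: comm_ring_hom "poly_series_hom phi" by (rule poly_series_hom[OF phi_hom(1) phi_even])
  have "vanishes_below 0 (rep (gW $$ (a, b)))" if "a < d" "b < d" for a b
    using that by (simp add: gW_def jordan_char_def Rep.hom_minus Rep_even_zw Rep_even_scal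
        vanishes_below_diff vanishes_below_const vanishes_below_0)
  moreover have "vanishes_below 0 (rep (gZi $$ (r, s)))" if "r < N" "s < N" for r s
    using that by (simp add: gZi_def jordan_char_inv_def)
      (rule vanishes_below_jordan_inv, simp add: Rep_even_geom vanishes_below_def)
  moreover have "vanishes_below 0 (gB i a)" "vanishes_below 0 (gC a i)" for i a
    by (simp_all add: gB_def gC_def vanishes_below_sg vanishes_below_const)
  ultimately have "vanishes_below 0 (rep (schur_right d gZi gW\<^sup>T gB gC N $$ (a, b)))" if "a < d" "b < d" for a b
    using that gW_carrier
    by (simp add: rep_schur_right[OF schur_facts])
      (intro vanishes_below_diff vanishes_below_sum vanishes_below_mult_0, simp_all)
  then show ?thesis
    unfolding P.hom_det[symmetric] map_gl_gaudin_matrix det_transpose[OF schur_right_carrier]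
    by (rule vanishes_below_det[OF schur_right_carrier])
qed

lemma vanishes_below_det_gWi: "vanishes_below 0 (rep (det gWi))"
proof (rule vanishes_below_det[OF gWi_carrier])
  fix i j assume "i < d" "j < d"
  then show "vanishes_below 0 (rep (gWi $$ (i, j)))"
    by (simp add: gWi_def jordan_char_inv_def)
      (rule vanishes_below_jordan_inv, simp add: Rep_even_geom vanishes_below_const)
qed

text \<open>The polynomial variable occurs only as the diagonal w, so the determinant is a
  characteristic polynomial.\<close>

lemma gl_gaudin_det_monic:
  "degree (det (gl_gaudin_matrix d d' xi w l gam z)) = d \<and> coeff (det (gl_gaudin_matrix d d' xi w l gam z)) d = 1"
proof -
  let ?M = "mat d d (\<lambda>(a, b). fls_const (scal (block_jordan d' xi w $$ (a, b))) +
     (\<Sum>i=1..l. \<Sum>k<gam i. fls_const (gl_elem gam i k (a + 1) (b + 1))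
            * ring_inv ((fls_X_inv - fls_const (scal (z i))) ^ (k + 1))))"
  have "gl_gaudin_matrix d d' xi w l gam z = char_poly_matrix ?M"
    unfolding gl_gaudin_matrix_def char_poly_matrix_def sum_to_poly
    by (intro eq_matI) auto
  then show ?thesis using degree_monic_char_poly[of ?M d] by (simp add: char_poly_def)
qed

theorem gaudin_duality:
  "phi ` gl_gaudin d d' xi w l gam z = varphi ` gls_gaudin p q m n d' xi w l gam z"
proof -
  define P where "P = det (gl_gaudin_matrix d d' xi w l gam z)"
  define Ber where "Ber = berezinian parities (gls_gaudin_matrix p q m n d' xi w l gam z)"
  define SA where "SA = {fls_nth (coeff P (i - 1)) s | i s. i \<in> {1..d}}"
  define SB where "SB = {fls_nth (fls_nth Ber (- i)) s | i s. i \<le> int p + int m - int q - int n}"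
  define zeta where "zeta = diag_factor gZ gZi (\<lambda>i. par i) N"
  define zeta' where "zeta' = diag_factor gZi gZ (\<lambda>i. par i) N"
  define D where "D = poly_series_hom phi P"
  \<comment> \<open>The image of the Berezinian, obtained by solving \<open>map_berezinian\<close>
    with \<open>det gWi\<close> as the inverse of \<open>det gW\<close>.\<close>
  define beta where "beta = zeta * D * det gWi"
  have SA: "fls_nth (coeff P i) s \<in> SA" if "i < d" for i s
    unfolding SA_def by (intro CollectI exI[of _ "Suc i"] exI[of _ s]) (use that in simp)
  have SB: "fls_nth (fls_nth Ber i) s \<in> SB" if "\<not> i < int q + int n - int p - int m" for i s
    unfolding SB_def by (intro CollectI exI[of _ "- i"] exI[of _ s]) (use that in simp)
  interpret F: ring_hom varphi by (rule varphi_hom(1))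
  interpret F1: ring_hom "map_fls varphi" by (rule map_fls_ring_hom[OF varphi_hom(1)])
  have "rep beta = map_fls (map_fls varphi) Ber * rep (det gW) * rep (det gWi)"
    unfolding Ber_def map_berezinian beta_def zeta_def D_def P_def Rep.hom_mult ..
  also have "\<dots> = map_fls (map_fls varphi) Ber"
    using det_gW_inverse by (simp add: mult.assoc flip: Rep.hom_mult)
  finally have rep_beta: "fls_nth (fls_nth (rep beta) i) j = varphi (fls_nth (fls_nth Ber i) j)" for i j
    by simp
  have D_nth: "fls_nth (fls_nth (rep D) s) j = (if j \<le> 0 then phi (fls_nth (coeff P (nat (- j))) s) else 0)" for s j
    unfolding D_def by (rule poly_series_hom_nth[OF phi_hom(1) phi_even])
  have D_eq: "D = zeta' * beta * det gW"
  proof -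
    have "zeta' * beta * det gW = (zeta' * zeta) * D * (det gW * det gWi)"
      unfolding beta_def by (simp only: ac_simps)
    then show ?thesis
      unfolding det_gW_inverse using diag_factor_inverse by (simp add: zeta_def zeta'_def)
  qed
  note scalars = scalar_series_diag_factor[folded zeta_def zeta'_def] scalar_series_det_gW
  note over = scalars[THEN subsetD[OF scalar_series_subset]]
  have D_over: "D \<in> series_over (phi ` SA)"
    unfolding series_over_def
  proof (intro CollectI allI)
    fix s j
    interpret G: ring_hom phi by (rule phi_hom(1))
    define i where "i = nat (- j)"
    \<comment> \<open>Only \<open>i < d\<close> gives the image of a generator. The coefficient of
      w^d is 1, and all others are zero.\<close>
    consider "j > 0" | "j \<le> 0" "i < d" | "j \<le> 0" "i = d" | "j \<le> 0" "i > d" by linarith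
    then show "fls_nth (fls_nth (rep D) s) j \<in> subalgebra_gen (phi ` SA)"
    proof cases
      case 2
      then show ?thesis
        unfolding D_nth i_def[symmetric] by (simp add: subalgebra_gen.gen SA)
    next
      case 3
      then show ?thesis
        using gl_gaudin_det_monic[folded P_def] subalgebra_gen.scal[of 1 "phi ` SA"] unfolding D_nth i_def[symmetric]
        by (simp add: subalgebra_gen_0)
    next
      case 4
      then show ?thesis
        using gl_gaudin_det_monic[folded P_def] unfolding D_nth i_def[symmetric] by (simp add: coeff_eq_0 subalgebra_gen_0)
    qed (simp add: D_nth subalgebra_gen_0)
  qed
  \<comment> \<open>The orders of the three factors add up; the bound is exactly where the list of
    generators from the Berezinian begins.\<close>
  have vanish: "vanishes_below (int q + int n - int p - int m) (rep beta)"
    using vanishes_below_mult[OF vanishes_below_mult[OF vanishes_below_diag_factor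
          vanishes_below_poly_series_hom_det] vanishes_below_det_gWi]
    unfolding beta_def zeta_def D_def P_def Rep.hom_mult by simp
  have beta_over: "beta \<in> series_over (varphi ` SB)"
    unfolding series_over_def
  proof (intro CollectI allI)
    fix i j
    show "fls_nth (fls_nth (rep beta) i) j \<in> subalgebra_gen (varphi ` SB)"
    proof (cases "i < int q + int n - int p - int m")
      case True
      then show ?thesis using vanish by (simp add: vanishes_below_def subalgebra_gen_0)
    next
      case False
      then show ?thesis unfolding rep_beta by (intro subalgebra_gen.gen imageI SB)
    qed
  qed
  have D_over': "D \<in> series_over (varphi ` SB)"
    unfolding D_eq by (intro series_over_mult over beta_over)
  have beta_over': "beta \<in> series_over (phi ` SA)"
    unfolding beta_def by (intro series_over_mult over D_over)
  have "phi ` SA \<subseteq> subalgebra_gen (varphi ` SB)"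
  proof
    fix x assume "x \<in> phi ` SA"
    then obtain i s where "x = phi (fls_nth (coeff P (i - 1)) s)" unfolding SA_def by blast
    then have "x = fls_nth (fls_nth (rep D) s) (- int (i - 1))" by (simp add: D_nth)
    then show "x \<in> subalgebra_gen (varphi ` SB)" using D_over' by (simp add: series_over_def)
  qed
  moreover have "varphi ` SB \<subseteq> subalgebra_gen (phi ` SA)"
  proof
    fix x assume "x \<in> varphi ` SB"
    then obtain i s where "x = varphi (fls_nth (fls_nth Ber (- i)) s)" unfolding SB_def by blast
    then have "x = fls_nth (fls_nth (rep beta) (- i)) s" by (simp add: rep_beta)
    then show "x \<in> subalgebra_gen (phi ` SA)" using beta_over' by (simp add: series_over_def)
  qed
  ultimately have "subalgebra_gen (phi ` SA) = subalgebra_gen (varphi ` SB)"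
    by (intro equalityI subalgebra_gen_subset)
  then show ?thesis
    unfolding gl_gaudin_def gls_gaudin_def image_subalgebra_gen[OF phi_hom(1,2)]
      image_subalgebra_gen[OF varphi_hom(1,2)] P_def[symmetric] Ber_def[symmetric]
      SA_def[symmetric] SB_def[symmetric] .
qed

end

theorem theorem1p2:
  fixes d p q m n d' p' q' m' n' :: nat
    and xi gam :: "nat \<Rightarrow> nat"
    and w z :: "nat \<Rightarrow> complex"
  assumes "1 \<le> d"
    and "\<not> (p = 0 \<and> q = 0 \<and> m = 0 \<and> n = 0)"
    and "1 \<le> d'" and "d' \<le> d"
    and "p' \<le> p" and "q' \<le> q" and "m' \<le> m" and "n' \<le> n"
    and "\<forall>a\<in>{1..d'}. 1 \<le> xi a"
    and "(\<Sum>a=1..d'. xi a) = d"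
    and "\<forall>i\<in>{1..p'+q'+m'+n'}. 1 \<le> gam i"
    and "(\<Sum>i=1..p'. gam i) = p"
    and "(\<Sum>i=1..q'. gam (p' + i)) = q"
    and "(\<Sum>i=1..m'. gam (p' + q' + i)) = m"
    and "(\<Sum>i=1..n'. gam (p' + q' + m' + i)) = n"
  shows "gaudin_phi d p q m p' q' (p'+q'+m'+n') gam ` gl_gaudin d d' xi w (p'+q'+m'+n') gam z =
    gaudin_varphi p q m n d' xi ` gls_gaudin p q m n d' xi w (p'+q'+m'+n') gam z"
  using gaudin_duality assms(10,12-15) by blast

end
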